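(* Let $R$ be a unital ring (not necessarily commutative) and $S$ a stable semigroup such that each regular $\mathscr J$-class of $S$ contains either finitely many $\mathscr L$-classes or finitely many $\mathscr R$-classes. Then the semigroup ring $RS$ is stably finite if and only if the group ring $RG$ is stably finite for each maximal subgroup $G$ of $S$. In particular, if $R$ is an integral domain of characteristic $0$, or if $R$ is locally residually Noetherian (e.g., $R$ is commutative) and each maximal subgroup of $S$ is sofic, then $RS$ is stably finite.
   Context: Rings are not assumed unital unless stated. A ring $R$ is Dedekind finite if for every idempotent $e\in R$ and all $u,v\in eRe$, $uv=e$ implies $vu=e$; $R$ is stably finite if $M_n(R)$ is Dedekind finite for all $n\geq 1$. $RS$ has $R$-basis $S$ and product $\sum_s r_ss\cdot\sum_t r'_tt=\sum_{s,t}r_sr'_t\,st$. Green's relations on a semigroup $S$: with $S^1$ denoting $S$ with an identity adjoined, $s\mathrel{\mathscr J}t$ iff $S^1sS^1=S^1tS^1$, $s\mathrel{\mathscr L}t$ iff $S^1s=S^1t$, $s\mathrel{\mathscr R}t$ iff $sS^1=tS^1$, and $\mathscr H=\mathscr L\cap\mathscr R$. $S$ is stable if, for all $s,t\in S$, $s\mathrel{\mathscr J}st$ implies $s\mathrel{\mathscr R}st$, and $s\mathrel{\mathscr J}ts$ implies $s\mathrel{\mathscr L}ts$. An element $s$ is regular if $sts=s$ for some $t\in S$; a $\mathscr J$-class $J$ of a stable semigroup is regular if all its elements are regular (otherwise $J^2\cap J=\emptyset$). The maximal subgroups of $S$ are the $\mathscr H$-classes of idempotents. A unital ring $R$ is residually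 Noetherian if for every $0\neq r\in R$ there is a two-sided ideal $I$ with $r\notin I$ and $R/I$ right or left Noetherian. $R$ is locally residually Noetherian if each finitely generated unital subring of $R$ is contained in a residually Noetherian unital subring of $R$. A group $G$ is sofic if for every finite $F\subseteq G$ and $\varepsilon>0$ there are $n\ge 1$ and a map $\sigma\colon G\to \mathrm{Sym}(n)$ such that for all $g,h\in F$, $\sigma(g)\sigma(h)$ and $\sigma(gh)$ agree on at least $(1-\varepsilon)n$ points, and for all $1\ne g\in F$, $\sigma(g)$ has at most $\varepsilon n$ fixed points. *)

theory Defs
  imports
    "HOL-Algebra.QuotRing"
    "HOL-Algebra.Generated_Rings"
    "HOL-Algebra.Sym_Groups"
begin

section \<open>Semigroups and Green's relations\<close>

text \<open>
  A semigroup is represented by a monoid record whose field \<open>one\<close> is not constrained.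
\<close>

locale semigroup_struct =
  fixes S (structure)
  assumes m_closed: "\<lbrakk>x \<in> carrier S; y \<in> carrier S\<rbrakk> \<Longrightarrow> x \<otimes> y \<in> carrier S"
    and m_assoc: "\<lbrakk>x \<in> carrier S; y \<in> carrier S; z \<in> carrier S\<rbrakk>
      \<Longrightarrow> (x \<otimes> y) \<otimes> z = x \<otimes> (y \<otimes> z)"

text \<open>
  The semigroup \<open>S\<^sup>1\<close>: a new identity \<open>None\<close> is always adjoined. If \<open>S\<close> already has an
  identity, this yields the same principal ideals as not adjoining one.
\<close>

definition adjoin_one :: "('s, 'm) monoid_scheme \<Rightarrow> 's option monoid" where
  "adjoin_one S =
    \<lparr>carrier = insert None (Some ` carrier S),
     monoid.mult = (\<lambda>x y. case x of
        None \<Rightarrow> y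
      | Some a \<Rightarrow> (case y of None \<Rightarrow> Some a | Some b \<Rightarrow> Some (a \<otimes>\<^bsub>S\<^esub> b))),
     monoid.one = None\<rparr>"

definition principal_left :: "('s, 'm) monoid_scheme \<Rightarrow> 's \<Rightarrow> 's option set" where
  "principal_left S s = carrier (adjoin_one S) #>\<^bsub>adjoin_one S\<^esub> Some s"

definition principal_right :: "('s, 'm) monoid_scheme \<Rightarrow> 's \<Rightarrow> 's option set" where
  "principal_right S s = Some s <#\<^bsub>adjoin_one S\<^esub> carrier (adjoin_one S)"

definition principal_two_sided :: "('s, 'm) monoid_scheme \<Rightarrow> 's \<Rightarrow> 's option set" where
  "principal_two_sided S s = principal_left S s <#>\<^bsub>adjoin_one S\<^esub> carrier (adjoin_one S)"

definition green_L :: "('s, 'm) monoid_scheme \<Rightarrow> 's rel" where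
  "green_L S = {(s, t) \<in> carrier S \<times> carrier S. principal_left S s = principal_left S t}"

definition green_R :: "('s, 'm) monoid_scheme \<Rightarrow> 's rel" where
  "green_R S = {(s, t) \<in> carrier S \<times> carrier S. principal_right S s = principal_right S t}"

definition green_J :: "('s, 'm) monoid_scheme \<Rightarrow> 's rel" where
  "green_J S =
    {(s, t) \<in> carrier S \<times> carrier S. principal_two_sided S s = principal_two_sided S t}"

definition green_H :: "('s, 'm) monoid_scheme \<Rightarrow> 's rel" where
  "green_H S = green_L S \<inter> green_R S"

definition stable_semigroup :: "('s, 'm) monoid_scheme \<Rightarrow> bool" where
  "stable_semigroup S \<longleftrightarrow> (\<forall>s\<in>carrier S. \<forall>t\<in>carrier S.
     ((s, s \<otimes>\<^bsub>S\<^esub> t) \<in> green_J S \<longrightarrow> (s, s \<otimes>\<^bsub>S\<^esub> t) \<in> green_R S) \<and>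
     ((s, t \<otimes>\<^bsub>S\<^esub> s) \<in> green_J S \<longrightarrow> (s, t \<otimes>\<^bsub>S\<^esub> s) \<in> green_L S))"

definition regular_element :: "('s, 'm) monoid_scheme \<Rightarrow> 's \<Rightarrow> bool" where
  "regular_element S s \<longleftrightarrow> (\<exists>t\<in>carrier S. s \<otimes>\<^bsub>S\<^esub> t \<otimes>\<^bsub>S\<^esub> s = s)"

definition regular_J_classes :: "('s, 'm) monoid_scheme \<Rightarrow> 's set set" where
  "regular_J_classes S = {J \<in> carrier S // green_J S. \<forall>s\<in>J. regular_element S s}"

text \<open>
  The \<open>\<H>\<close>-class of an idempotent \<open>e\<close>, with the multiplication of \<open>S\<close> and identity \<open>e\<close>.
\<close>

definition maximal_subgroups :: "('s, 'm) monoid_scheme \<Rightarrow> ('s, 'm) monoid_scheme set" where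
  "maximal_subgroups S =
    {S\<lparr>carrier := green_H S `` {e}, one := e\<rparr> | e. e \<in> carrier S \<and> e \<otimes>\<^bsub>S\<^esub> e = e}"


section \<open>Semigroup rings, matrix rings and stable finiteness\<close>

text \<open>
  Elements of the semigroup ring are the finitely supported functions from \<open>carrier S\<close> to
  \<open>carrier R\<close>, extended by zero outside \<open>carrier S\<close>. The field \<open>one\<close> is the identity of the
  semigroup ring if \<open>one S\<close> is an identity of \<open>S\<close>, and is meaningless otherwise.
\<close>

definition supp_in :: "('r, 'k) ring_scheme \<Rightarrow> ('s \<Rightarrow> 'r) \<Rightarrow> 's set" where
  "supp_in R f = {s. f s \<noteq> \<zero>\<^bsub>R\<^esub>}"

definition semigroup_ring ::
    "('r, 'k) ring_scheme \<Rightarrow> ('s, 'm) monoid_scheme \<Rightarrow> ('s \<Rightarrow> 'r) ring" where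
  "semigroup_ring R S =
    \<lparr>carrier = {f. range f \<subseteq> carrier R \<and> supp_in R f \<subseteq> carrier S \<and> finite (supp_in R f)},
     monoid.mult = (\<lambda>f g u. \<Oplus>\<^bsub>R\<^esub>s \<in> supp_in R f.
               \<Oplus>\<^bsub>R\<^esub>t \<in> {t \<in> supp_in R g. s \<otimes>\<^bsub>S\<^esub> t = u}. f s \<otimes>\<^bsub>R\<^esub> g t),
     monoid.one = (\<lambda>s. if s = \<one>\<^bsub>S\<^esub> then \<one>\<^bsub>R\<^esub> else \<zero>\<^bsub>R\<^esub>),
     ring.zero = (\<lambda>s. \<zero>\<^bsub>R\<^esub>),
     ring.add = (\<lambda>f g s. f s \<oplus>\<^bsub>R\<^esub> g s)\<rparr>"

text \<open>
  An \<open>n \<times> n\<close> matrix is a function of two indices that vanishes unless both are below \<open>n\<close>.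
  The coefficient ring need not have an identity; if it has none, the field \<open>one\<close> is
  meaningless.
\<close>

definition matrix_ring :: "nat \<Rightarrow> ('a, 'k) ring_scheme \<Rightarrow> (nat \<Rightarrow> nat \<Rightarrow> 'a) ring" where
  "matrix_ring n A =
    \<lparr>carrier = {M. \<forall>i j. if i < n \<and> j < n then M i j \<in> carrier A else M i j = \<zero>\<^bsub>A\<^esub>},
     monoid.mult = (\<lambda>M N i j. if i < n \<and> j < n
               then \<Oplus>\<^bsub>A\<^esub>k \<in> {..<n}. M i k \<otimes>\<^bsub>A\<^esub> N k j else \<zero>\<^bsub>A\<^esub>),
     monoid.one = (\<lambda>i j. if i < n \<and> i = j then \<one>\<^bsub>A\<^esub> else \<zero>\<^bsub>A\<^esub>),
     ring.zero = (\<lambda>i j. \<zero>\<^bsub>A\<^esub>),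
     ring.add = (\<lambda>M N i j. if i < n \<and> j < n then M i j \<oplus>\<^bsub>A\<^esub> N i j else \<zero>\<^bsub>A\<^esub>)\<rparr>"

definition corner :: "('a, 'k) ring_scheme \<Rightarrow> 'a \<Rightarrow> 'a set" where
  "corner A e = {e \<otimes>\<^bsub>A\<^esub> a \<otimes>\<^bsub>A\<^esub> e | a. a \<in> carrier A}"

definition dedekind_finite :: "('a, 'k) ring_scheme \<Rightarrow> bool" where
  "dedekind_finite A \<longleftrightarrow> (\<forall>e\<in>carrier A. e \<otimes>\<^bsub>A\<^esub> e = e \<longrightarrow>
     (\<forall>u\<in>corner A e. \<forall>v\<in>corner A e. u \<otimes>\<^bsub>A\<^esub> v = e \<longrightarrow> v \<otimes>\<^bsub>A\<^esub> u = e))"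

definition stably_finite :: "('a, 'k) ring_scheme \<Rightarrow> bool" where
  "stably_finite A \<longleftrightarrow> (\<forall>n\<ge>1. dedekind_finite (matrix_ring n A))"


section \<open>Conditions on the coefficient ring\<close>

definition char_zero :: "('r, 'k) ring_scheme \<Rightarrow> bool" where
  "char_zero R \<longleftrightarrow> (\<forall>n::nat. n > 0 \<longrightarrow> [n] \<cdot>\<^bsub>R\<^esub> \<one>\<^bsub>R\<^esub> \<noteq> \<zero>\<^bsub>R\<^esub>)"

text \<open>
  The library's \<open>noetherian_ring\<close> concerns two-sided ideals only, so the one-sided chain
  conditions are stated here.
\<close>

definition left_ideal :: "'r set \<Rightarrow> ('r, 'k) ring_scheme \<Rightarrow> bool" where
  "left_ideal I R \<longleftrightarrow> additive_subgroup I R \<and> (\<forall>a\<in>I. \<forall>x\<in>carrier R. x \<otimes>\<^bsub>R\<^esub> a \<in> I)"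

definition right_ideal :: "'r set \<Rightarrow> ('r, 'k) ring_scheme \<Rightarrow> bool" where
  "right_ideal I R \<longleftrightarrow> additive_subgroup I R \<and> (\<forall>a\<in>I. \<forall>x\<in>carrier R. a \<otimes>\<^bsub>R\<^esub> x \<in> I)"

definition left_noetherian :: "('r, 'k) ring_scheme \<Rightarrow> bool" where
  "left_noetherian R \<longleftrightarrow>
    (\<forall>I :: nat \<Rightarrow> 'r set. (\<forall>n. left_ideal (I n) R) \<and> (\<forall>n. I n \<subseteq> I (Suc n)) \<longrightarrow>
       (\<exists>N. \<forall>n\<ge>N. I n = I N))"

definition right_noetherian :: "('r, 'k) ring_scheme \<Rightarrow> bool" where
  "right_noetherian R \<longleftrightarrow>
    (\<forall>I :: nat \<Rightarrow> 'r set. (\<forall>n. right_ideal (I n) R) \<and> (\<forall>n. I n \<subseteq> I (Suc n)) \<longrightarrow>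
       (\<exists>N. \<forall>n\<ge>N. I n = I N))"

definition residually_noetherian :: "('r, 'k) ring_scheme \<Rightarrow> bool" where
  "residually_noetherian R \<longleftrightarrow> (\<forall>r\<in>carrier R. r \<noteq> \<zero>\<^bsub>R\<^esub> \<longrightarrow>
     (\<exists>I. ideal I R \<and> r \<notin> I \<and> (right_noetherian (R Quot I) \<or> left_noetherian (R Quot I))))"

definition locally_residually_noetherian :: "('r, 'k) ring_scheme \<Rightarrow> bool" where
  "locally_residually_noetherian R \<longleftrightarrow> (\<forall>F. finite F \<and> F \<subseteq> carrier R \<longrightarrow>
     (\<exists>K. subring K R \<and> generate_ring R F \<subseteq> K \<and> residually_noetherian (R\<lparr>carrier := K\<rparr>)))"


section \<open>Sofic groups\<close>

definition sofic :: "('g, 'm) monoid_scheme \<Rightarrow> bool" where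
  "sofic G \<longleftrightarrow> (\<forall>F (\<epsilon>::real). finite F \<and> F \<subseteq> carrier G \<and> \<epsilon> > 0 \<longrightarrow>
     (\<exists>n\<ge>1. \<exists>\<sigma> \<in> carrier G \<rightarrow> carrier (sym_group n).
        (\<forall>g\<in>F. \<forall>h\<in>F.
           real (card {i \<in> {1..n}. (\<sigma> g \<otimes>\<^bsub>sym_group n\<^esub> \<sigma> h) i = \<sigma> (g \<otimes>\<^bsub>G\<^esub> h) i})
             \<ge> (1 - \<epsilon>) * real n) \<and>
        (\<forall>g\<in>F. g \<noteq> \<one>\<^bsub>G\<^esub> \<longrightarrow>
           real (card {i \<in> {1..n}. \<sigma> g i = i}) \<le> \<epsilon> * real n)))"

end

theory Submission
  imports Defs "HOL-Library.Poly_Mapping" "HOL-Library.Nat_Bijection"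
    "HOL-Computational_Algebra.Fundamental_Theorem_Algebra"
begin

text \<open>
  Coefficients are lifted to a type class ring \<open>F = \<int>[M]\<close> with a surjection \<open>F \<rightarrow> R\<close>; every
  statement is then read modulo its kernel. Failing stable finiteness means \<open>uv = e\<close> for some
  \<open>u\<close>, \<open>v\<close> in a corner, with defect \<open>f = e - vu \<noteq> 0\<close> idempotent.

  Semigroups: a \<open>\<J>\<close>-class that is maximal among those meeting the support of \<open>f\<close> is regular,
  because \<open>f = f\<^sup>2\<close>. If it has finitely many \<open>\<L>\<close>-classes, the Schuetzenberger representation
  maps everything to matrices over the group ring of a maximal subgroup; in Rees coordinates
  \<open>f\<close> is a matrix \<open>X\<close> with \<open>X = XPX\<close> and its image is \<open>PX\<close>, which therefore is not zero.

  Domains of characteristic zero: a finitely generated subring has a homomorphism to the complex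
  numbers that does not kill a prescribed nonzero element, here a coefficient of \<open>f\<close>. Over the
  complex numbers a nonzero idempotent has nonzero trace, while \<open>tr f = tr (uv) - tr (vu) = 0\<close>.

  Sofic groups: after passing to a Noetherian quotient, the elements \<open>f u\<^sup>l\<close> for \<open>l < k\<close> are
  independent copies of one another. Placed at far apart good points of a sofic approximation
  with \<open>N\<close> points, they yield about \<open>kN\<close> independent vectors in \<open>R\<^bsup>nN\<^esup>\<close>, more than the uniform
  dimension allows when \<open>k\<close> is large.
\<close>


text \<open>The rings involved need not have an identity, and several arguments change the
  coefficients. Everything is therefore stated for a total multiplication together with an ideal:
  passing to a quotient of \<open>R\<close> merely enlarges the ideal, and nothing has to be lifted
  again.

  Finiteness of the number of L-classes or of R-classes is what keeps the Schuetzenberger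
  representation inside finite matrices over a group ring. The two cases are mirror images; the
  second is reduced to the first by transposing matrices and reversing both the coefficient ring and
  the semigroup.

  Over noncommutative coefficients no trace with useful positivity exists, so sofic groups are
  treated by counting. Uniform dimension takes the place of rank: it is finite under a one-sided
  chain condition, it is subadditive for intersections of submodules, and it ignores annihilators,
  so the entries of \<open>f\<close> may be zero divisors. The number of layers f u^l can be made as
  large as desired because the separation between the chosen points depends on \<open>f\<close>
  alone.\<close>

abbreviation lookup where "lookup \<equiv> Poly_Mapping.lookup"
abbreviation keys where "keys \<equiv> Poly_Mapping.keys"
abbreviation single where "single \<equiv> Poly_Mapping.single"

section \<open>Finitely supported functions\<close>

lemma poly_mapping_expand:
  fixes f :: "'p \<Rightarrow>\<^sub>0 'f::ab_group_add"
  assumes "finite A" "keys f \<subseteq> A"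
  shows "f = (\<Sum>p\<in>A. single p (lookup f p))"
proof (rule poly_mapping_eqI)
  fix k
  have "lookup (\<Sum>p\<in>A. single p (lookup f p)) k = (\<Sum>p\<in>A. if p = k then lookup f p else 0)"
    by (simp add: lookup_sum lookup_single when_def)
  also have "\<dots> = lookup f k"
    using assms by (auto simp: sum.delta in_keys_iff)
  finally show "lookup f k = lookup (\<Sum>p\<in>A. single p (lookup f p)) k" by simp
qed

text \<open>Identities between additive maps are reduced by this rule to single terms;
  \<open>K\<close> carries a support condition into the base case.\<close>

lemma poly_mapping_additive_induct [consumes 1, case_names zero add single]:
  fixes f :: "'p \<Rightarrow>\<^sub>0 'f::ab_group_add"
  assumes "keys f \<subseteq> K" and "P 0" "\<And>f g. P f \<Longrightarrow> P g \<Longrightarrow> P (f + g)"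
    and "\<And>p a. p \<in> K \<Longrightarrow> P (single p a)"
  shows "P f"
proof -
  have "P (\<Sum>p\<in>B. single p (lookup f p))" if "finite B" "B \<subseteq> K" for B
    using that by induction (auto intro: assms)
  from this[of "keys f"] show ?thesis
    using poly_mapping_expand[of "keys f" f] assms by simp
qed

subsection \<open>Rings without unit on a type class group, modulo an ideal\<close>

text \<open>No identity is assumed, since a semigroup ring need not have one. Congruence modulo the
  two-sided ideal \<open>I\<close> stands for equality in the quotient ring.\<close>

locale mult_mod =
  fixes mul :: "'a::ab_group_add \<Rightarrow> 'a \<Rightarrow> 'a" (infixl \<open>\<cdot>\<close> 70) and I :: "'a set"
  assumes distl: "(x + y) \<cdot> z = x \<cdot> z + y \<cdot> z"
    and distr: "x \<cdot> (y + z) = x \<cdot> y + x \<cdot> z"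
    and assoc: "(x \<cdot> y) \<cdot> z = x \<cdot> (y \<cdot> z)"
    and zero_in [simp]: "0 \<in> I"
    and diff_in: "x \<in> I \<Longrightarrow> y \<in> I \<Longrightarrow> x - y \<in> I"
    and mul_in_l: "x \<in> I \<Longrightarrow> x \<cdot> y \<in> I"
    and mul_in_r: "y \<in> I \<Longrightarrow> x \<cdot> y \<in> I"
begin

lemma uminus_in: "x \<in> I \<Longrightarrow> - x \<in> I"
  using diff_in[OF zero_in] by simp

lemma add_in: "x \<in> I \<Longrightarrow> y \<in> I \<Longrightarrow> x + y \<in> I"
  using diff_in[OF _ uminus_in] by force

lemma sum_in: "(\<And>x. x \<in> A \<Longrightarrow> f x \<in> I) \<Longrightarrow> sum f A \<in> I"
  by (induction A rule: infinite_finite_induct) (auto intro: add_in)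

lemma mul_0_l [simp]: "0 \<cdot> x = 0"
  using distl[of 0 0 x] by simp

lemma mul_0_r [simp]: "x \<cdot> 0 = 0"
  using distr[of x 0 0] by simp

lemma mul_minus_l: "(- x) \<cdot> y = - (x \<cdot> y)"
  using distl[of "- x" x y] by (simp add: eq_neg_iff_add_eq_0)

lemma mul_minus_r: "x \<cdot> (- y) = - (x \<cdot> y)"
  using distr[of x "- y" y] by (simp add: eq_neg_iff_add_eq_0)

lemma mul_diff_l: "(x - y) \<cdot> z = x \<cdot> z - y \<cdot> z"
  using distl[of x "- y" z] by (simp add: mul_minus_l)

lemma mul_diff_r: "x \<cdot> (y - z) = x \<cdot> y - x \<cdot> z"
  using distr[of x y "- z"] by (simp add: mul_minus_r)

lemma mul_sum_r: "z \<cdot> sum f A = (\<Sum>x\<in>A. z \<cdot> f x)"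
  by (induction A rule: infinite_finite_induct) (auto simp: distr)

definition cong_mod (infix \<open>\<approx>\<close> 50) where "x \<approx> y \<longleftrightarrow> x - y \<in> I"

lemma cong_refl [simp]: "x \<approx> x"
  by (simp add: cong_mod_def)

lemma cong_sym: "x \<approx> y \<Longrightarrow> y \<approx> x"
  unfolding cong_mod_def using uminus_in by fastforce

lemma cong_trans [trans]: "x \<approx> y \<Longrightarrow> y \<approx> z \<Longrightarrow> x \<approx> z"
  unfolding cong_mod_def using add_in[of "x - y" "y - z"] by simp

lemma cong_diff: "x \<approx> x' \<Longrightarrow> y \<approx> y' \<Longrightarrow> x - y \<approx> x' - y'"
  unfolding cong_mod_def using diff_in[of "x - x'" "y - y'"] by (simp add: algebra_simps)

lemma cong_mul: "x \<approx> x' \<Longrightarrow> y \<approx> y' \<Longrightarrow> x \<cdot> y \<approx> x' \<cdot> y'"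
  unfolding cong_mod_def
  using add_in[OF mul_in_l[of "x - x'" y] mul_in_r[of "y - y'" x']]
  by (simp add: mul_diff_l mul_diff_r)

lemma cong_mul_l: "x \<approx> x' \<Longrightarrow> x \<cdot> y \<approx> x' \<cdot> y"
  by (simp add: cong_mul)

lemma cong_mul_r: "y \<approx> y' \<Longrightarrow> x \<cdot> y \<approx> x \<cdot> y'"
  by (simp add: cong_mul)

lemma cong_0: "x \<approx> 0 \<longleftrightarrow> x \<in> I"
  by (simp add: cong_mod_def)

lemma cong_in: "x \<approx> y \<Longrightarrow> x \<in> I \<longleftrightarrow> y \<in> I"
  by (meson cong_0 cong_sym cong_trans)

text \<open>Membership of \<open>u\<close> and \<open>v\<close> in the corner of \<open>e\<close> is
  encoded by \<open>e\<close> acting on them as a two-sided identity.\<close>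

definition corner_pair :: "'a \<Rightarrow> 'a \<Rightarrow> 'a \<Rightarrow> bool" where
  "corner_pair e u v \<longleftrightarrow> e \<cdot> e \<approx> e \<and> u \<cdot> v \<approx> e \<and>
     e \<cdot> u \<approx> u \<and> u \<cdot> e \<approx> u \<and> e \<cdot> v \<approx> v \<and> v \<cdot> e \<approx> v"

lemma corner_pairD:
  assumes "corner_pair e u v"
  shows "e \<cdot> e \<approx> e" "u \<cdot> v \<approx> e" "e \<cdot> u \<approx> u" "u \<cdot> e \<approx> u" "e \<cdot> v \<approx> v" "v \<cdot> e \<approx> v"
  using assms by (auto simp: corner_pair_def)

text \<open>Since \<open>u \<cdot> v\<close> collapses to \<open>e\<close>, the element
  \<open>v \<cdot> u\<close> is an idempotent of the corner, and \<open>f\<close> is its complement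
  there.\<close>

lemma corner_defect:
  assumes "corner_pair e u v"
  defines "f \<equiv> e - v \<cdot> u"
  shows "f \<cdot> f \<approx> f" "u \<cdot> f \<approx> 0" "f \<cdot> v \<approx> 0" "e \<cdot> f \<approx> f" "f \<cdot> e \<approx> f"
proof -
  note c = corner_pairD[OF assms(1)]
  have "u \<cdot> (v \<cdot> u) \<approx> e \<cdot> u"
    using cong_mul_l[OF c(2)] by (simp add: assoc)
  then have uvu: "u \<cdot> (v \<cdot> u) \<approx> u"
    using c(3) cong_trans by blast
  have "(v \<cdot> u) \<cdot> v \<approx> v \<cdot> e"
    using cong_mul_r[OF c(2)] by (simp add: assoc)
  then have vuv: "(v \<cdot> u) \<cdot> v \<approx> v"
    using c(6) cong_trans by blast
  show uf: "u \<cdot> f \<approx> 0"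
    using cong_diff[OF c(4) uvu] by (simp add: f_def mul_diff_r)
  show "f \<cdot> v \<approx> 0"
    using cong_diff[OF c(5) vuv] by (simp add: f_def mul_diff_l)
  show ef: "e \<cdot> f \<approx> f"
    using cong_diff[OF c(1) cong_mul_l[OF c(5)]] by (simp add: f_def mul_diff_r assoc)
  show "f \<cdot> e \<approx> f"
    using cong_diff[OF c(1) cong_mul_r[OF c(4)]] by (simp add: f_def mul_diff_l assoc)
  have "v \<cdot> (u \<cdot> f) \<approx> 0"
    using cong_mul_r[OF uf] by simp
  moreover have "f \<cdot> f = e \<cdot> f - v \<cdot> (u \<cdot> f)"
    by (subst (1) f_def) (simp add: mul_diff_l assoc)
  ultimately show "f \<cdot> f \<approx> f"
    using cong_diff[OF ef, of "v \<cdot> (u \<cdot> f)" 0] by simp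
qed

primrec rpow where
  "rpow f u 0 = f"
| "rpow f u (Suc l) = rpow f u l \<cdot> u"

primrec lpow where
  "lpow f v 0 = f"
| "lpow f v (Suc l) = v \<cdot> lpow f v l"

text \<open>The elements v^l f u^m form a system of matrix units, as in Jacobson's construction. The
  inner product u^l v^m cancels to a power of u or of v alone, which \<open>f\<close> kills unless
  it is trivial. Hence multiplication on the right by v^m f isolates one of the copies f
  u^l.\<close>

lemma matrix_units:
  assumes "corner_pair e u v"
  defines "f \<equiv> e - v \<cdot> u"
  shows "rpow f u l \<cdot> lpow f v m \<approx> (if l = m then f else 0)"
proof -
  note c = corner_pairD[OF assms(1)]
  note d = corner_defect[OF assms(1), folded f_def]
  have e_lpow: "e \<cdot> lpow f v m \<approx> lpow f v m" for m
  proof (cases m)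
    case (Suc k)
    then show ?thesis using cong_mul_l[OF c(5), of "lpow f v k"] by (simp add: assoc)
  qed (simp add: d)
  show ?thesis
  proof (induction l arbitrary: m)
    case 0
    show ?case
    proof (cases m)
      case (Suc k)
      then show ?thesis using cong_mul_l[OF d(3), of "lpow f v k"] by (simp add: assoc)
    qed (simp add: d)
  next
    case (Suc l)
    show ?case
    proof (cases m)
      case 0
      then show ?thesis using cong_mul_r[OF d(2), of "rpow f u l"] by (simp add: assoc)
    next
      case (Suc k)
      have "u \<cdot> (v \<cdot> lpow f v k) \<approx> lpow f v k"
        using cong_trans[OF cong_mul_l[OF c(2)] e_lpow] by (simp add: assoc)
      from cong_trans[OF cong_mul_r[OF this] Suc.IH[of k]] show ?thesis
        using \<open>m = Suc k\<close> by (simp add: assoc)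
    qed
  qed
qed

end


subsection \<open>Convolution\<close>

text \<open>\<open>None\<close> stands for a zero product. Since the three index types may differ,
  the same construction gives semigroup rings, matrix rings over them, and the action of matrices on
  row vectors.\<close>

definition conv :: "('f \<Rightarrow> 'f \<Rightarrow> 'f::comm_monoid_add) \<Rightarrow> ('p \<Rightarrow> 'q \<Rightarrow> 'z option) \<Rightarrow>
    ('p \<Rightarrow>\<^sub>0 'f) \<Rightarrow> ('q \<Rightarrow>\<^sub>0 'f) \<Rightarrow> ('z \<Rightarrow>\<^sub>0 'f)" where
  "conv mul op f g = (\<Sum>p\<in>keys f. \<Sum>q\<in>keys g.
     case op p q of None \<Rightarrow> 0 | Some z \<Rightarrow> single z (mul (lookup f p) (lookup g q)))"

definition coeffs_in :: "'f::zero set \<Rightarrow> ('p \<Rightarrow>\<^sub>0 'f) set" where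
  "coeffs_in I = {f. \<forall>p. lookup f p \<in> I}"

definition additive_ext :: "('p \<Rightarrow> 'f \<Rightarrow> 'v) \<Rightarrow> ('p \<Rightarrow>\<^sub>0 'f::zero) \<Rightarrow> 'v::comm_monoid_add" where
  "additive_ext r f = (\<Sum>p\<in>keys f. r p (lookup f p))"

lemma additive_ext_superset:
  assumes "\<And>p. r p 0 = 0" "finite A" "keys f \<subseteq> A"
  shows "additive_ext r f = (\<Sum>p\<in>A. r p (lookup f p))"
  unfolding additive_ext_def using assms
  by (intro sum.mono_neutral_left) (auto simp: in_keys_iff)

lemma additive_ext_single:
  assumes "\<And>p. r p 0 = 0"
  shows "additive_ext r (single p a) = r p a"
  using additive_ext_superset[of r "{p}" "single p a"] assms by simp

lemma additive_ext_0 [simp]: "additive_ext r 0 = 0"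
  by (simp add: additive_ext_def)

lemma additive_ext_add:
  fixes r :: "'p \<Rightarrow> 'f::ab_group_add \<Rightarrow> 'v::ab_group_add"
  assumes "\<And>p a b. r p (a + b) = r p a + r p b"
  shows "additive_ext r (f + g) = additive_ext r f + additive_ext r g"
proof -
  have z: "r p 0 = 0" for p using assms[of p 0 0] by simp
  show ?thesis
    using Poly_Mapping.keys_add[of f g]
    by (simp add: additive_ext_superset[of r "keys f \<union> keys g", OF z] lookup_add assms sum.distrib)
qed

context mult_mod
begin

abbreviation cv where "cv op \<equiv> conv mul op"

lemma conv_superset:
  assumes "finite A" "finite B" "keys f \<subseteq> A" "keys g \<subseteq> B"
  shows "cv op f g = (\<Sum>p\<in>A. \<Sum>q\<in>B.
     case op p q of None \<Rightarrow> 0 | Some z \<Rightarrow> single z (lookup f p \<cdot> lookup g q))"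
proof -
  have "cv op f g = (\<Sum>p\<in>A. \<Sum>q\<in>keys g.
     case op p q of None \<Rightarrow> 0 | Some z \<Rightarrow> single z (lookup f p \<cdot> lookup g q))"
    unfolding conv_def using assms
    by (intro sum.mono_neutral_left ballI sum.neutral) (auto simp: in_keys_iff split: option.split)
  also have "\<dots> = (\<Sum>p\<in>A. \<Sum>q\<in>B.
     case op p q of None \<Rightarrow> 0 | Some z \<Rightarrow> single z (lookup f p \<cdot> lookup g q))"
    using assms
    by (intro sum.cong refl sum.mono_neutral_left) (auto simp: in_keys_iff split: option.split)
  finally show ?thesis .
qed

lemma conv_add_l: "cv op (f + f') g = cv op f g + cv op f' g"
proof -
  have "keys (f + f') \<subseteq> keys f \<union> keys f'" by (rule Poly_Mapping.keys_add)
  then show ?thesis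
    by (simp add: conv_superset[of "keys f \<union> keys f'" "keys g"] flip: sum.distrib)
       (intro sum.cong refl, simp add: lookup_add distl single_add split: option.split)
qed

lemma conv_add_r: "cv op f (g + g') = cv op f g + cv op f g'"
proof -
  have "keys (g + g') \<subseteq> keys g \<union> keys g'" by (rule Poly_Mapping.keys_add)
  then show ?thesis
    by (simp add: conv_superset[of "keys f" "keys g \<union> keys g'"] flip: sum.distrib)
       (intro sum.cong refl, simp add: lookup_add distr single_add split: option.split)
qed

lemma conv_0_l [simp]: "cv op 0 g = 0"
  by (simp add: conv_def)

lemma conv_0_r [simp]: "cv op f 0 = 0"
  by (simp add: conv_def)

lemma conv_single:
  "cv op (single p a) (single q b) = (case op p q of None \<Rightarrow> 0 | Some z \<Rightarrow> single z (a \<cdot> b))"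
  by (subst conv_superset[of "{p}" "{q}"]) (auto split: option.split)

lemma lookup_conv:
  assumes "finite A" "finite B" "keys f \<subseteq> A" "keys g \<subseteq> B"
  shows "lookup (cv op f g) z = (\<Sum>p\<in>A. \<Sum>q\<in>B. lookup f p \<cdot> lookup g q when op p q = Some z)"
  by (subst conv_superset[OF assms], simp add: lookup_sum)
     (intro sum.cong refl, simp add: lookup_single when_def split: option.split)

lemma conv_sum_l: "cv op (sum f A) g = (\<Sum>x\<in>A. cv op (f x) g)"
  by (induction A rule: infinite_finite_induct) (auto simp: conv_add_l)

lemma conv_sum_r: "cv op f (sum g A) = (\<Sum>x\<in>A. cv op f (g x))"
  by (induction A rule: infinite_finite_induct) (auto simp: conv_add_r)

lemma keys_conv: "keys (cv op f g) \<subseteq> {z. \<exists>p\<in>keys f. \<exists>q\<in>keys g. op p q = Some z}"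
proof
  fix z assume z: "z \<in> keys (cv op f g)"
  show "z \<in> {z. \<exists>p\<in>keys f. \<exists>q\<in>keys g. op p q = Some z}"
  proof (rule ccontr)
    assume "\<not> ?thesis"
    then have "lookup (cv op f g) z = 0"
      by (auto simp: lookup_conv[of "keys f" "keys g"] when_def intro!: sum.neutral)
    with z show False by (simp add: in_keys_iff)
  qed
qed

lemma coeffs_in_conv_l: "f \<in> coeffs_in I \<Longrightarrow> cv op f g \<in> coeffs_in I"
  unfolding coeffs_in_def
  by (auto simp: lookup_conv[of "keys f" "keys g"] when_def intro!: sum_in mul_in_l)

lemma coeffs_in_conv_r: "g \<in> coeffs_in I \<Longrightarrow> cv op f g \<in> coeffs_in I"
  unfolding coeffs_in_def
  by (auto simp: lookup_conv[of "keys f" "keys g"] when_def intro!: sum_in mul_in_r)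

text \<open>Both sides are biadditive, so single terms decide. Three separate maps are allowed: with
  right multiplications for \<open>\<theta>\<close> and \<open>\<psi>\<close> the lemma yields
  associativity, and with different index types it yields compatibility with an action.\<close>

lemma conv_hom:
  assumes \<phi>: "\<And>f g. \<phi> (f + g) = \<phi> f + \<phi> g" and \<psi>: "\<And>f g. \<psi> (f + g) = \<psi> f + \<psi> g"
    and \<theta>: "\<And>f g. \<theta> (f + g) = \<theta> f + \<theta> g"
    and s: "\<And>p q a b. p \<in> K \<Longrightarrow> q \<in> L \<Longrightarrow>
      \<theta> (cv op (single p a) (single q b)) = cv op' (\<phi> (single p a)) (\<psi> (single q b))"
    and k: "keys f \<subseteq> K" "keys g \<subseteq> L"
  shows "(\<theta> (cv op f g) :: 'z \<Rightarrow>\<^sub>0 'a) = cv op' (\<phi> f) (\<psi> g)"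
proof -
  have z: "\<phi> 0 = 0" "\<psi> 0 = 0" "\<theta> 0 = 0"
    using \<phi>[of 0 0] \<psi>[of 0 0] \<theta>[of 0 0] by auto
  have 1: "\<theta> (cv op (single p a) g) = cv op' (\<phi> (single p a)) (\<psi> g)" if "p \<in> K" for p a
    using k(2)
    by (induction g rule: poly_mapping_additive_induct)
       (auto simp: z conv_add_r \<psi> \<theta> s that)
  show ?thesis
    using k(1)
    by (induction f rule: poly_mapping_additive_induct)
       (auto simp: z conv_add_l \<phi> \<theta> 1)
qed

lemma conv_assoc:
  assumes "\<And>p q r. p \<in> K \<Longrightarrow> q \<in> L \<Longrightarrow> r \<in> M \<Longrightarrow>
      Option.bind (op1 p q) (\<lambda>z. op2 z r) = Option.bind (op3 q r) (op4 p)"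
    and k: "keys f \<subseteq> K" "keys g \<subseteq> L" "keys h \<subseteq> M"
  shows "cv op2 (cv op1 f g) h = cv op4 f (cv op3 g h)"
  using k(3)
proof (induction h rule: poly_mapping_additive_induct)
  case (single r c)
  show ?case
  proof (rule conv_hom[where \<theta> = "\<lambda>x. cv op2 x (single r c)" and \<phi> = "\<lambda>x. x" and K = K and L = L
        and \<psi> = "\<lambda>x. cv op3 x (single r c)", OF _ _ _ _ k(1,2)])
    fix p q a b assume "p \<in> K" "q \<in> L"
    then show "cv op2 (cv op1 (single p a) (single q b)) (single r c) =
        cv op4 (single p a) (cv op3 (single q b) (single r c))"
      using assms(1)[OF _ _ \<open>r \<in> M\<close>, of p q]
      by (auto simp: conv_single assoc split: option.splits)
  qed (auto simp: conv_add_l)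
qed (auto simp: conv_add_r)

lemma mult_mod_conv:
  assumes "\<And>p q r. Option.bind (op p q) (\<lambda>z. op z r) = Option.bind (op q r) (op p)"
  shows "mult_mod (conv mul op) (coeffs_in I)"
proof
  fix x y :: "'b \<Rightarrow>\<^sub>0 'a"
  show "x - y \<in> coeffs_in I" if "x \<in> coeffs_in I" "y \<in> coeffs_in I"
    using that by (auto simp: coeffs_in_def lookup_minus diff_in)
  show "cv op (cv op x y) z = cv op x (cv op y z)" for z
    by (rule conv_assoc[where K = UNIV and L = UNIV and M = UNIV]) (auto simp: assms)
qed (auto simp: conv_add_l conv_add_r coeffs_in_conv_l coeffs_in_conv_r, simp add: coeffs_in_def)

end


section \<open>Matrices over semigroup rings\<close>

text \<open>The tests for membership in \<open>C\<close> make the partial operation associative on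
  the whole index type, although \<open>m\<close> is associative only on \<open>C\<close>; products
  of arbitrary finitely supported functions then need no side condition.\<close>

definition triple_op :: "'s set \<Rightarrow> ('s \<Rightarrow> 's \<Rightarrow> 's) \<Rightarrow> nat \<times> 's \<times> nat \<Rightarrow> nat \<times> 's \<times> nat \<Rightarrow>
    (nat \<times> 's \<times> nat) option" where
  "triple_op C m = (\<lambda>(i, s, j) (k, t, l). if j = k \<and> s \<in> C \<and> t \<in> C then Some (i, m s t, l) else None)"

text \<open>
  An \<open>n \<times> n\<close> matrix over the semigroup ring of \<open>(C, m)\<close> is a finitely supported function on
  triples (row, semigroup element, column).
\<close>

abbreviation triples :: "nat \<Rightarrow> 's set \<Rightarrow> (nat \<times> 's \<times> nat) set" where
  "triples n C \<equiv> {..<n} \<times> C \<times> {..<n}"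

abbreviation mat_conv where
  "mat_conv mul C m \<equiv> conv mul (triple_op C m)"

text \<open>Stable finiteness of the semigroup ring of \<open>C\<close> over the coefficients modulo
  \<open>I\<close>, phrased without forming a quotient. The size \<open>n = 0\<close> is included
  and is trivial.\<close>

definition sfin_mod :: "('f \<Rightarrow> 'f \<Rightarrow> 'f::ab_group_add) \<Rightarrow> 'f set \<Rightarrow> 's set \<Rightarrow> ('s \<Rightarrow> 's \<Rightarrow> 's) \<Rightarrow> bool" where
  "sfin_mod mul I C m \<longleftrightarrow> (\<forall>n e u v. keys e \<subseteq> triples n C \<longrightarrow> keys u \<subseteq> triples n C \<longrightarrow>
     keys v \<subseteq> triples n C \<longrightarrow> mult_mod.corner_pair (mat_conv mul C m) (coeffs_in I) e u v \<longrightarrow>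
     mat_conv mul C m v u - e \<in> coeffs_in I)"

locale semigroup_on =
  fixes C :: "'s set" and m :: "'s \<Rightarrow> 's \<Rightarrow> 's"
  assumes closed: "s \<in> C \<Longrightarrow> t \<in> C \<Longrightarrow> m s t \<in> C"
    and assoc: "s \<in> C \<Longrightarrow> t \<in> C \<Longrightarrow> u \<in> C \<Longrightarrow> m (m s t) u = m s (m t u)"

lemma (in semigroup_on) triple_op_assoc:
  "Option.bind (triple_op C m p q) (\<lambda>z. triple_op C m z r) =
   Option.bind (triple_op C m q r) (triple_op C m p)"
  by (cases p; cases q; cases r) (auto simp: triple_op_def closed assoc)

lemma mult_mod_mat_conv:
  assumes "mult_mod mul I" "semigroup_on C m"
  shows "mult_mod (mat_conv mul C m) (coeffs_in I)"
  by (rule mult_mod.mult_mod_conv[OF assms(1)]) (rule semigroup_on.triple_op_assoc[OF assms(2)])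

lemma keys_mat_conv:
  assumes "mult_mod mul I" "semigroup_on C m" "keys f \<subseteq> triples n C" "keys g \<subseteq> triples n C"
  shows "keys (mat_conv mul C m f g) \<subseteq> triples n C"
proof
  fix z assume "z \<in> keys (mat_conv mul C m f g)"
  then obtain p q where "p \<in> keys f" "q \<in> keys g" "triple_op C m p q = Some z"
    using mult_mod.keys_conv[OF assms(1)] by fastforce
  then show "z \<in> triples n C"
    using assms(3,4) semigroup_on.closed[OF assms(2)]
    by (auto simp: triple_op_def split: prod.splits if_splits)
qed

lemma keys_diff_subset: "keys f \<subseteq> A \<Longrightarrow> keys g \<subseteq> A \<Longrightarrow> keys (f - g) \<subseteq> A"
proof
  fix p assume k: "keys f \<subseteq> A" "keys g \<subseteq> A" and "p \<in> keys (f - g)"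
  then have "lookup f p \<noteq> 0 \<or> lookup g p \<noteq> 0"
    by (auto simp: in_keys_iff lookup_minus)
  then show "p \<in> A" using k by (auto simp: in_keys_iff)
qed

lemma keys_add_subset: "keys f \<subseteq> A \<Longrightarrow> keys g \<subseteq> A \<Longrightarrow> keys (f + g) \<subseteq> A"
  by (meson Poly_Mapping.keys_add Un_least subset_trans)

lemma sfin_modD:
  assumes "sfin_mod mul I C m" "keys e \<subseteq> triples n C" "keys u \<subseteq> triples n C"
    "keys v \<subseteq> triples n C" "mult_mod.corner_pair (mat_conv mul C m) (coeffs_in I) e u v"
  shows "mat_conv mul C m v u - e \<in> coeffs_in I"
  using assms unfolding sfin_mod_def by blast

lemma semigroup_on_iff: "semigroup_struct S \<longleftrightarrow> semigroup_on (carrier S) (monoid.mult S)"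
  by (simp add: semigroup_struct_def semigroup_on_def)


subsection \<open>Covering a carrier-based ring by a type class ring\<close>

text \<open>Replaces membership in a carrier by a type: every element of \<open>R\<close> is a value
  of \<open>ev\<close>, and equality in \<open>R\<close> becomes congruence modulo the
  kernel.\<close>

locale ring_cover = ring R for R (structure) +
  fixes ev :: "'f::ring_1 \<Rightarrow> 'a"
  assumes ev_closed [simp]: "ev x \<in> carrier R"
    and ev_add: "ev (x + y) = ev x \<oplus> ev y"
    and ev_mult: "ev (x * y) = ev x \<otimes> ev y"
    and ev_one: "ev 1 = \<one>"
    and ev_surj: "r \<in> carrier R \<Longrightarrow> \<exists>x. ev x = r"
begin

definition ker where "ker = {x. ev x = \<zero>}"

lemma ev_0 [simp]: "ev 0 = \<zero>"
  using ev_add[of 0 0] by (metis add.r_cancel_one ev_closed add_0)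

lemma ev_uminus: "ev (- x) = \<ominus> ev x"
  using ev_add[of "- x" x] by (simp add: minus_equality)

lemma ev_diff: "ev (x - y) = ev x \<ominus> ev y"
  using ev_add[of x "- y"] by (simp add: ev_uminus a_minus_def)

lemma ev_eq_iff: "ev x = ev y \<longleftrightarrow> x - y \<in> ker"
  by (simp add: ker_def ev_diff r_right_minus_eq)

lemma ev_sum: "finite A \<Longrightarrow> ev (sum f A) = (\<Oplus>x\<in>A. ev (f x))"
  by (induction A rule: finite_induct) (auto simp: ev_add)

sublocale mult_mod "(*)" ker
  by unfold_locales (auto simp: algebra_simps ker_def ev_diff ev_mult a_minus_def)

definition sr :: "('s \<Rightarrow>\<^sub>0 'f) \<Rightarrow> 's \<Rightarrow> 'a" where
  "sr f s = ev (lookup f s)"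

lemma supp_sr: "supp_in R (sr f) \<subseteq> keys f"
  by (auto simp: supp_in_def sr_def in_keys_iff)

lemma sr_carrier: "keys f \<subseteq> carrier S \<Longrightarrow> sr f \<in> carrier (semigroup_ring R S)"
  using supp_sr[of f] finite_subset[OF supp_sr]
  by (auto simp: semigroup_ring_def sr_def)

text \<open>Zero is lifted to zero, so that lifting coefficient by coefficient preserves finite
  support.\<close>

definition sect where "sect r = (if r = \<zero> then 0 else (SOME x. ev x = r))"

lemma ev_sect: "r \<in> carrier R \<Longrightarrow> ev (sect r) = r"
  unfolding sect_def using someI_ex[OF ev_surj] by auto

lemma sr_lift:
  assumes "a \<in> carrier (semigroup_ring R S)"
  shows "\<exists>f. keys f \<subseteq> carrier S \<and> sr f = a"
proof -
  from assms have a: "range a \<subseteq> carrier R" "supp_in R a \<subseteq> carrier S" "finite (supp_in R a)"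
    by (auto simp: semigroup_ring_def)
  have "{s. sect (a s) \<noteq> 0} \<subseteq> supp_in R a"
    by (auto simp: supp_in_def sect_def)
  then have fin: "finite {s. sect (a s) \<noteq> 0}"
    using a(3) finite_subset by blast
  define f where "f = Abs_poly_mapping (\<lambda>s. sect (a s))"
  have l: "lookup f s = sect (a s)" for s
    unfolding f_def using fin by simp
  have "sr f = a"
  proof
    fix s
    have "a s \<in> carrier R" using a(1) by auto
    then show "sr f s = a s" by (simp add: sr_def l ev_sect)
  qed
  moreover have "keys f \<subseteq> carrier S"
    using a(2) by (auto simp: in_keys_iff l sect_def supp_in_def)
  ultimately show ?thesis by blast
qed

lemma sr_add: "sr f \<oplus>\<^bsub>semigroup_ring R S\<^esub> sr g = sr (f + g)"
  by (auto simp: semigroup_ring_def sr_def lookup_add ev_add)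

lemma sr_0: "\<zero>\<^bsub>semigroup_ring R S\<^esub> = sr 0"
  by (auto simp: semigroup_ring_def sr_def)

lemma abelian_monoid_semigroup_ring: "abelian_monoid (semigroup_ring R S)"
proof (rule abelian_monoidI)
  fix a b c assume "a \<in> carrier (semigroup_ring R S)" "b \<in> carrier (semigroup_ring R S)"
    "c \<in> carrier (semigroup_ring R S)"
  then obtain f g h where f: "a = sr f" "keys f \<subseteq> carrier S" and g: "b = sr g" "keys g \<subseteq> carrier S"
    and h: "c = sr h" "keys h \<subseteq> carrier S"
    using sr_lift by metis
  show "a \<oplus>\<^bsub>semigroup_ring R S\<^esub> b \<in> carrier (semigroup_ring R S)"
    using f g keys_add_subset[of f _ g] by (simp add: sr_add sr_carrier)
  show "a \<oplus>\<^bsub>semigroup_ring R S\<^esub> b \<oplus>\<^bsub>semigroup_ring R S\<^esub> c =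
    a \<oplus>\<^bsub>semigroup_ring R S\<^esub> (b \<oplus>\<^bsub>semigroup_ring R S\<^esub> c)"
    using f g h by (simp add: sr_add add.assoc)
  show "\<zero>\<^bsub>semigroup_ring R S\<^esub> \<oplus>\<^bsub>semigroup_ring R S\<^esub> a = a"
    using f by (simp add: sr_0 sr_add)
  show "a \<oplus>\<^bsub>semigroup_ring R S\<^esub> b = b \<oplus>\<^bsub>semigroup_ring R S\<^esub> a"
    using f g by (simp add: sr_add add.commute)
next
  show "\<zero>\<^bsub>semigroup_ring R S\<^esub> \<in> carrier (semigroup_ring R S)"
    unfolding sr_0 by (rule sr_carrier) simp
qed

text \<open>The product of the record sums over \<open>supp_in R (sr f)\<close>, which may be
  smaller than \<open>keys f\<close> when \<open>ev\<close> kills a coefficient; the additional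
  terms lie in \<open>ker\<close> and evaluate to zero.\<close>

lemma sr_mult:
  "sr f \<otimes>\<^bsub>semigroup_ring R S\<^esub> sr g = sr (conv (*) (\<lambda>s t. Some (s \<otimes>\<^bsub>S\<^esub> t)) f g)"
proof
  fix u
  have inner: "(\<Oplus>t \<in> {t \<in> supp_in R (sr g). s \<otimes>\<^bsub>S\<^esub> t = u}. sr f s \<otimes> sr g t) =
      ev (\<Sum>t\<in>keys g. lookup f s * lookup g t when s \<otimes>\<^bsub>S\<^esub> t = u)" for s
  proof -
    have "(\<Oplus>t \<in> {t \<in> supp_in R (sr g). s \<otimes>\<^bsub>S\<^esub> t = u}. sr f s \<otimes> sr g t) =
      (\<Oplus>t\<in>keys g. ev (lookup f s * lookup g t when s \<otimes>\<^bsub>S\<^esub> t = u))"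
      using supp_sr[of g]
      by (intro add.finprod_mono_neutral_cong)
         (auto simp: when_def supp_in_def sr_def ev_mult in_keys_iff
           intro: finite_subset[OF _ Poly_Mapping.finite_keys[of g]])
    then show ?thesis by (simp add: ev_sum)
  qed
  have "(sr f \<otimes>\<^bsub>semigroup_ring R S\<^esub> sr g) u =
    (\<Oplus>s \<in> supp_in R (sr f). ev (\<Sum>t\<in>keys g. lookup f s * lookup g t when s \<otimes>\<^bsub>S\<^esub> t = u))"
    by (simp add: semigroup_ring_def inner)
  also have "\<dots> = (\<Oplus>s\<in>keys f. ev (\<Sum>t\<in>keys g. lookup f s * lookup g t when s \<otimes>\<^bsub>S\<^esub> t = u))"
  proof (intro add.finprod_mono_neutral_cong_left supp_sr)
    fix s assume s: "s \<in> keys f - supp_in R (sr f)"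
    show "ev (\<Sum>t\<in>keys g. lookup f s * lookup g t when s \<otimes>\<^bsub>S\<^esub> t = u) = \<zero>"
    proof -
      from s have "lookup f s \<in> ker" by (auto simp: supp_in_def sr_def ker_def)
      then have "(\<Sum>t\<in>keys g. lookup f s * lookup g t when s \<otimes>\<^bsub>S\<^esub> t = u) \<in> ker"
        by (intro sum_in) (auto simp: when_def intro: mul_in_l)
      then show "ev (\<Sum>t\<in>keys g. lookup f s * lookup g t when s \<otimes>\<^bsub>S\<^esub> t = u) = \<zero>"
        by (simp add: ker_def)
    qed
  qed auto
  also have "\<dots> = sr (conv (*) (\<lambda>s t. Some (s \<otimes>\<^bsub>S\<^esub> t)) f g) u"
    by (simp add: sr_def lookup_conv[of "keys f" "keys g"] flip: ev_sum)
  finally show "(sr f \<otimes>\<^bsub>semigroup_ring R S\<^esub> sr g) u =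
    sr (conv (*) (\<lambda>s t. Some (s \<otimes>\<^bsub>S\<^esub> t)) f g) u" .
qed

lemma sr_finsum:
  assumes "finite K" "\<And>k. k \<in> K \<Longrightarrow> keys (h k) \<subseteq> carrier S"
  shows "finsum (semigroup_ring R S) (\<lambda>k. sr (h k)) K = sr (sum h K)"
proof -
  interpret A: abelian_monoid "semigroup_ring R S" by (rule abelian_monoid_semigroup_ring)
  show ?thesis
    using assms by (induction K rule: finite_induct) (auto simp: sr_0 sr_add sr_carrier)
qed

end

section \<open>Matrix records and their lifts\<close>

definition slice :: "nat \<Rightarrow> nat \<Rightarrow> (nat \<times> 's \<times> nat \<Rightarrow>\<^sub>0 'f) \<Rightarrow> ('s \<Rightarrow>\<^sub>0 'f::ab_group_add)" where
  "slice i j = additive_ext (\<lambda>(i', s, j') a. if i = i' \<and> j = j' then single s a else 0)"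

lemma slice_add: "slice i j (f + g) = slice i j f + slice i j g"
  unfolding slice_def by (rule additive_ext_add) (auto simp: single_add split: prod.split)

lemma slice_0 [simp]: "slice i j 0 = 0"
  by (simp add: slice_def)

lemma slice_single:
  "slice i j (single (i', s, j') a) = (if i = i' \<and> j = j' then single s a else 0)"
  unfolding slice_def by (subst additive_ext_single) (auto split: prod.split)

lemma lookup_slice: "lookup (slice i j f) s = lookup f (i, s, j)"
proof -
  have "keys f \<subseteq> UNIV" by simp
  then show ?thesis
  proof (induction f rule: poly_mapping_additive_induct)
    case (single p a)
    show ?case
      by (cases p) (auto simp: slice_single lookup_single when_def)
  qed (auto simp: slice_add lookup_add)
qed

lemma (in mult_mod) slice_mat_conv:
  assumes "keys f \<subseteq> triples n C" "keys g \<subseteq> triples n C"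
  shows "slice i j (mat_conv mul C m f g) =
    (\<Sum>k<n. conv mul (\<lambda>s t. Some (m s t)) (slice i k f) (slice k j g))"
  using assms(1)
proof (induction f rule: poly_mapping_additive_induct)
  case (single p a)
  show ?case
    using assms(2)
  proof (induction g rule: poly_mapping_additive_induct)
    case (single q b)
    obtain i' s k where p: "p = (i', s, k)" by (cases p)
    obtain k' t j' where q: "q = (k', t, j')" by (cases q)
    have "(\<Sum>l<n. conv mul (\<lambda>s t. Some (m s t)) (slice i l (single p a)) (slice l j (single q b))) =
      (\<Sum>l<n. if l = k then (if i = i' \<and> k = k' \<and> j = j' then single (m s t) (a \<cdot> b) else 0) else 0)"
      by (intro sum.cong refl) (auto simp: p q slice_single conv_single)
    also have "\<dots> = slice i j (mat_conv mul C m (single p a) (single q b))"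
      using \<open>p \<in> _\<close> \<open>q \<in> _\<close>
      by (auto simp: p q conv_single triple_op_def slice_single)
    finally show ?case ..
  qed (auto simp: slice_add conv_add_r sum.distrib)
qed (auto simp: slice_add conv_add_l sum.distrib)

context ring_cover
begin

definition mat_of :: "(nat \<times> 's \<times> nat \<Rightarrow>\<^sub>0 'f) \<Rightarrow> nat \<Rightarrow> nat \<Rightarrow> 's \<Rightarrow> 'a" where
  "mat_of f i j = sr (slice i j f)"

lemma mat_of_eq_iff: "mat_of f = mat_of g \<longleftrightarrow> f - g \<in> coeffs_in ker"
  by (auto simp: mat_of_def fun_eq_iff sr_def lookup_slice ev_eq_iff coeffs_in_def lookup_minus)

lemma keys_slice:
  assumes "keys f \<subseteq> triples n C"
  shows "keys (slice i j f) \<subseteq> C" "\<not> (i < n \<and> j < n) \<Longrightarrow> slice i j f = 0"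
proof -
  show "keys (slice i j f) \<subseteq> C"
    using assms by (auto simp: in_keys_iff lookup_slice)
  show "slice i j f = 0" if "\<not> (i < n \<and> j < n)"
    using that assms
    by (intro poly_mapping_eqI) (auto simp: lookup_slice in_keys_iff subset_iff)
qed

lemma mat_of_carrier:
  assumes "keys f \<subseteq> triples n (carrier S)"
  shows "mat_of f \<in> carrier (matrix_ring n (semigroup_ring R S))"
  using keys_slice[OF assms] by (auto simp: matrix_ring_def mat_of_def sr_carrier sr_0)

lemma mat_of_lift:
  assumes M: "M \<in> carrier (matrix_ring n (semigroup_ring R S))"
  shows "\<exists>f. keys f \<subseteq> triples n (carrier S) \<and> mat_of f = M"
proof -
  have "\<exists>h. keys h \<subseteq> carrier S \<and> (i < n \<and> j < n \<longrightarrow> sr h = M i j)" for i j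
  proof (cases "i < n \<and> j < n")
    case True
    then have "M i j \<in> carrier (semigroup_ring R S)" using M by (simp add: matrix_ring_def)
    then show ?thesis using sr_lift by blast
  next
    case False
    then show ?thesis by (intro exI[of _ 0]) auto
  qed
  then obtain h where h: "\<And>i j. keys (h i j) \<subseteq> carrier S" "\<And>i j. i < n \<Longrightarrow> j < n \<Longrightarrow> sr (h i j) = M i j"
    by metis
  define F where "F = (\<lambda>(i, s, j). if i < n \<and> j < n then lookup (h i j) s else 0)"
  have "{p. F p \<noteq> 0} \<subseteq> {..<n} \<times> (\<Union>i<n. \<Union>j<n. keys (h i j)) \<times> {..<n}"
    by (auto simp: F_def in_keys_iff split: if_splits) blast
  then have "finite {p. F p \<noteq> 0}"
    by (rule finite_subset) auto
  then have l: "lookup (Abs_poly_mapping F) p = F p" for p by simp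
  have "mat_of (Abs_poly_mapping F) = M"
  proof (intro ext)
    fix i j s
    show "mat_of (Abs_poly_mapping F) i j s = M i j s"
    proof (cases "i < n \<and> j < n")
      case True
      then show ?thesis
        using fun_cong[OF h(2)[of i j], of s] unfolding mat_of_def sr_def lookup_slice l
        by (auto simp: F_def)
    next
      case False
      then have "M i j = \<zero>\<^bsub>semigroup_ring R S\<^esub>" using M by (auto simp: matrix_ring_def)
      then show ?thesis
        using False unfolding mat_of_def sr_def lookup_slice l
        by (auto simp: F_def semigroup_ring_def)
    qed
  qed
  moreover have "keys (Abs_poly_mapping F) \<subseteq> triples n (carrier S)"
  proof
    fix p assume "p \<in> keys (Abs_poly_mapping F)"
    then have "F p \<noteq> 0" by (simp only: in_keys_iff l) simp
    then show "p \<in> triples n (carrier S)"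
      using h(1) by (auto simp: F_def in_keys_iff subset_iff split: prod.splits if_splits)
  qed
  ultimately show ?thesis by blast
qed

lemma mat_of_mult:
  assumes "semigroup_struct S"
    and f: "keys f \<subseteq> triples n (carrier S)" and g: "keys g \<subseteq> triples n (carrier S)"
  shows "mat_of f \<otimes>\<^bsub>matrix_ring n (semigroup_ring R S)\<^esub> mat_of g =
    mat_of (mat_conv (*) (carrier S) (monoid.mult S) f g)"
proof (intro ext)
  fix i j s
  let ?h = "\<lambda>k. conv (*) (\<lambda>s t. Some (s \<otimes>\<^bsub>S\<^esub> t)) (slice i k f) (slice k j g)"
  have S: "semigroup_on (carrier S) (monoid.mult S)" using assms(1) by (simp add: semigroup_on_iff)
  have k: "keys (?h k) \<subseteq> carrier S" for k
    using keys_conv[of "\<lambda>s t. Some (s \<otimes>\<^bsub>S\<^esub> t)" "slice i k f" "slice k j g"]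
      keys_slice(1)[OF f, of i k] keys_slice(1)[OF g, of k j] semigroup_on.closed[OF S] by blast
  have fg: "keys (mat_conv (*) (carrier S) (monoid.mult S) f g) \<subseteq> triples n (carrier S)"
    by (rule keys_mat_conv[OF mult_mod_axioms S f g])
  show "(mat_of f \<otimes>\<^bsub>matrix_ring n (semigroup_ring R S)\<^esub> mat_of g) i j s =
    mat_of (mat_conv (*) (carrier S) (monoid.mult S) f g) i j s"
  proof (cases "i < n \<and> j < n")
    case True
    then show ?thesis
      by (simp add: matrix_ring_def mat_of_def sr_mult sr_finsum[OF _ k] slice_mat_conv[OF f g])
  next
    case False
    then show ?thesis
      using keys_slice(2)[OF fg False] by (auto simp: matrix_ring_def mat_of_def sr_0)
  qed
qed

text \<open>\<open>mat_of\<close> maps onto the matrix record, respects products, and identifies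
  exactly the matrices that are congruent modulo \<open>ker\<close>; idempotents and corners
  therefore correspond. As the left side does not mention the cover, different covers may serve
  different coefficient rings.\<close>

theorem stably_finite_iff_sfin_mod:
  fixes S :: "('c, 'k) monoid_scheme"
  assumes "semigroup_struct S"
  shows "stably_finite (semigroup_ring R S) \<longleftrightarrow> sfin_mod (*) ker (carrier S) (monoid.mult S)"
proof -
  let ?C = "carrier S"
  define cv :: "(nat \<times> 'c \<times> nat \<Rightarrow>\<^sub>0 'f) \<Rightarrow> _"
    where "cv = mat_conv (*) ?C (monoid.mult S)"
  have S: "semigroup_on (carrier S) (monoid.mult S)" using assms(1) by (simp add: semigroup_on_iff)
  interpret M: mult_mod cv "coeffs_in ker"
    unfolding cv_def by (rule mult_mod_mat_conv[OF mult_mod_axioms S])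
  note kc = keys_mat_conv[OF mult_mod_axioms S, folded cv_def]
  let ?A = "\<lambda>n. matrix_ring n (semigroup_ring R S)"
  note mult = mat_of_mult[OF assms, folded cv_def]
  have eq: "mat_of f = mat_of g \<longleftrightarrow> M.cong_mod f g" for f g :: "nat \<times> 'c \<times> nat \<Rightarrow>\<^sub>0 'f"
    by (simp add: mat_of_eq_iff M.cong_mod_def)
  have "dedekind_finite (?A n) \<longleftrightarrow> (\<forall>e u v. keys e \<subseteq> triples n ?C \<longrightarrow> keys u \<subseteq> triples n ?C \<longrightarrow>
     keys v \<subseteq> triples n ?C \<longrightarrow> M.corner_pair e u v \<longrightarrow> M.cong_mod (cv v u) e)" (is "?D \<longleftrightarrow> ?Q") for n
  proof
    assume ?D
    show ?Q
    proof (intro allI impI)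
      fix e u v assume k: "keys e \<subseteq> triples n ?C" "keys u \<subseteq> triples n ?C" "keys v \<subseteq> triples n ?C"
        and c: "M.corner_pair e u v"
      note c = M.corner_pairD[OF c, folded eq]
      have corner: "mat_of w \<in> corner (?A n) (mat_of e)"
        if w: "keys w \<subseteq> triples n ?C" "mat_of (cv e w) = mat_of w" "mat_of (cv w e) = mat_of w" for w
      proof -
        have "mat_of e \<otimes>\<^bsub>?A n\<^esub> mat_of w \<otimes>\<^bsub>?A n\<^esub> mat_of e = mat_of w"
          using w by (simp add: mult[OF k(1) w(1)] mult[OF w(1) k(1)])
        then show ?thesis
          unfolding corner_def using mat_of_carrier[OF w(1)] by (intro CollectI exI[of _ "mat_of w"]) simp
      qed
      have "mat_of v \<otimes>\<^bsub>?A n\<^esub> mat_of u = mat_of e"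
      proof -
        have "mat_of e \<otimes>\<^bsub>?A n\<^esub> mat_of e = mat_of e" "mat_of u \<otimes>\<^bsub>?A n\<^esub> mat_of v = mat_of e"
          using c by (simp_all add: mult k)
        then show ?thesis
          using \<open>?D\<close> mat_of_carrier[OF k(1)] corner[OF k(2)] corner[OF k(3)] c
          unfolding dedekind_finite_def by blast
      qed
      then show "M.cong_mod (cv v u) e" by (simp add: mult k flip: eq)
    qed
  next
    assume Q: ?Q
    show ?D
      unfolding dedekind_finite_def
    proof (intro ballI impI)
      fix E U V assume E: "E \<in> carrier (?A n)" "E \<otimes>\<^bsub>?A n\<^esub> E = E"
        and U: "U \<in> corner (?A n) E" and V: "V \<in> corner (?A n) E" and UV: "U \<otimes>\<^bsub>?A n\<^esub> V = E"
      obtain e where e: "keys e \<subseteq> triples n ?C" "mat_of e = E" using mat_of_lift[OF E(1)] by blast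
      have ee: "M.cong_mod (cv e e) e" using E(2) e by (auto simp: mult eq)
      have lift: "\<exists>w. keys w \<subseteq> triples n ?C \<and> mat_of w = W \<and> M.cong_mod (cv e w) w \<and> M.cong_mod (cv w e) w"
        if W: "W \<in> corner (?A n) E" for W
      proof -
        from W obtain X where X: "X \<in> carrier (?A n)" "W = E \<otimes>\<^bsub>?A n\<^esub> X \<otimes>\<^bsub>?A n\<^esub> E"
          by (auto simp: corner_def)
        from X(1) obtain x where x: "keys x \<subseteq> triples n ?C" "mat_of x = X" using mat_of_lift by blast
        \<comment> \<open>With a lift of this shape, associativity in the cover shows that
          \<open>e\<close> acts on it as an identity modulo the kernel.\<close>
        let ?w = "cv (cv e x) e"
        have "mat_of ?w = W"
          using mult[OF e(1) x(1)] mult[OF kc[OF e(1) x(1)] e(1)] e(2) x(2) X(2) by simp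
        moreover have "M.cong_mod (cv e ?w) ?w"
          using M.cong_mul_l[OF ee, of "cv x e"] by (simp add: M.assoc)
        moreover have "M.cong_mod (cv ?w e) ?w"
          using M.cong_mul_r[OF ee, of "cv e x"] by (simp add: M.assoc)
        moreover have "keys ?w \<subseteq> triples n ?C"
          by (intro kc e x)
        ultimately show ?thesis by (intro exI[of _ ?w]) simp
      qed
      from lift[OF U] obtain u where u: "keys u \<subseteq> triples n ?C" "mat_of u = U"
        "M.cong_mod (cv e u) u" "M.cong_mod (cv u e) u" by blast
      from lift[OF V] obtain v where v: "keys v \<subseteq> triples n ?C" "mat_of v = V"
        "M.cong_mod (cv e v) v" "M.cong_mod (cv v e) v" by blast
      have "M.cong_mod (cv u v) e"
        using UV mult[OF u(1) v(1)] e(2) u(2) v(2) eq by metis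
      then have "M.corner_pair e u v"
        using ee u v by (simp add: M.corner_pair_def)
      then have "M.cong_mod (cv v u) e" using Q e u v by blast
      then show "V \<otimes>\<^bsub>?A n\<^esub> U = E"
        using e u v by (auto simp: mult simp flip: eq)
    qed
  qed
  note D = this
  \<comment> \<open>\<open>sfin_mod\<close> also speaks of size 0, which
    \<open>stably_finite\<close> excludes; the matrices are then zero.\<close>
  have zero: "M.cong_mod (cv v u) e" if "keys e \<subseteq> triples 0 ?C" "keys u \<subseteq> triples 0 ?C" for e u v
  proof -
    have "e = 0" "u = 0"
      using that by (auto intro!: poly_mapping_eqI simp: in_keys_iff)
    then show ?thesis by simp
  qed
  show ?thesis
    unfolding stably_finite_def D sfin_mod_def cv_def[symmetric] M.cong_mod_def[symmetric]
  proof (intro iffI allI impI)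
    fix n e u v
    assume all: "\<forall>n\<ge>1. \<forall>e u v. keys e \<subseteq> triples n ?C \<longrightarrow> keys u \<subseteq> triples n ?C \<longrightarrow>
        keys v \<subseteq> triples n ?C \<longrightarrow> M.corner_pair e u v \<longrightarrow> M.cong_mod (cv v u) e"
      and k: "keys e \<subseteq> triples n ?C" "keys u \<subseteq> triples n ?C" "keys v \<subseteq> triples n ?C"
      and c: "M.corner_pair e u v"
    show "M.cong_mod (cv v u) e"
    proof (cases n)
      case 0
      show ?thesis by (rule zero) (use k 0 in auto)
    next
      case (Suc k)
      then have "n \<ge> 1" by simp
      with all k c show ?thesis by blast
    qed
  next
    fix n :: nat and e u v
    assume "\<forall>n e u v. keys e \<subseteq> triples n ?C \<longrightarrow> keys u \<subseteq> triples n ?C \<longrightarrow>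
        keys v \<subseteq> triples n ?C \<longrightarrow> M.corner_pair e u v \<longrightarrow> M.cong_mod (cv v u) e"
      and "keys e \<subseteq> triples n ?C" "keys u \<subseteq> triples n ?C" "keys v \<subseteq> triples n ?C"
      and "M.corner_pair e u v"
    then show "M.cong_mod (cv v u) e" by blast
  qed
qed

end


subsection \<open>Monoid rings over the integers as covers\<close>

text \<open>The additive extension of \<open>h\<close> to the integral monoid ring of
  \<open>'m\<close>, whose product is convolution over an additively written monoid.\<close>

definition (in ring) zeval :: "('m \<Rightarrow> 'a) \<Rightarrow> ('m \<Rightarrow>\<^sub>0 int) \<Rightarrow> 'a" where
  "zeval h p = (\<Oplus>k\<in>keys p. [lookup p k] \<cdot> h k)"

context ring
begin

lemma add_pow_0_int [simp]: "[(0::int)] \<cdot> x = \<zero>"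
  by (simp add: add_pow_def)

lemma add_pow_1_int [simp]: "x \<in> carrier R \<Longrightarrow> [(1::int)] \<cdot> x = x"
  using add.int_pow_1 by (simp add: add_pow_def)

lemma zeval_superset:
  assumes "\<And>k. h k \<in> carrier R" "finite A" "keys p \<subseteq> A"
  shows "zeval h p = (\<Oplus>k\<in>A. [lookup p k] \<cdot> h k)"
  unfolding zeval_def using assms
  by (intro add.finprod_mono_neutral_cong_left) (auto simp: in_keys_iff)

lemma zeval_closed: "(\<And>k. h k \<in> carrier R) \<Longrightarrow> zeval h p \<in> carrier R"
  unfolding zeval_def by (intro finsum_closed) auto

lemma zeval_0 [simp]: "zeval h 0 = \<zero>"
  by (simp add: zeval_def)

lemma zeval_single: "(\<And>k. h k \<in> carrier R) \<Longrightarrow> zeval h (single k c) = [c] \<cdot> h k"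
  by (subst zeval_superset[of h "{k}"]) auto

lemma zeval_add:
  assumes h: "\<And>k. h k \<in> carrier R"
  shows "zeval h (p + q) = zeval h p \<oplus> zeval h q"
proof -
  have k: "keys (p + q) \<subseteq> keys p \<union> keys q" by (rule Poly_Mapping.keys_add)
  have "(\<Oplus>k\<in>keys p \<union> keys q. [lookup p k] \<cdot> h k \<oplus> [lookup q k] \<cdot> h k) =
     (\<Oplus>k\<in>keys p \<union> keys q. [lookup p k] \<cdot> h k) \<oplus> (\<Oplus>k\<in>keys p \<union> keys q. [lookup q k] \<cdot> h k)"
    using h by (intro finsum_addf) auto
  moreover have "(\<Oplus>k\<in>keys p \<union> keys q. [lookup (p + q) k] \<cdot> h k) =
     (\<Oplus>k\<in>keys p \<union> keys q. [lookup p k] \<cdot> h k \<oplus> [lookup q k] \<cdot> h k)"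
    using h by (intro finsum_cong') (auto simp: lookup_add add.int_pow_mult)
  ultimately show ?thesis
    using k by (simp add: zeval_superset[OF h, of "keys p \<union> keys q"])
qed

lemma zeval_mult:
  assumes h: "\<And>k. h k \<in> carrier R" and hom: "\<And>k l. h (k + l) = h k \<otimes> h l"
  shows "zeval h (p * q) = zeval h p \<otimes> zeval h q"
proof -
  have "keys p \<subseteq> UNIV" by simp
  then show ?thesis
  proof (induction p rule: poly_mapping_additive_induct)
    case (add f g)
    then show ?case by (simp add: distrib_right zeval_add h zeval_closed l_distr)
  next
    case (single k c)
    have "keys q \<subseteq> UNIV" by simp
    then show ?case
    proof (induction q rule: poly_mapping_additive_induct)
      case (add f g)
      then show ?case by (simp add: distrib_left zeval_add h zeval_closed r_distr)
    next
      case (single l d)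
      have "[c] \<cdot> h k \<otimes> [d] \<cdot> h l = [d] \<cdot> ([c] \<cdot> (h k \<otimes> h l))"
        by (simp add: add_pow_ldistr_int add_pow_rdistr_int h)
      also have "\<dots> = [(c * d)] \<cdot> (h k \<otimes> h l)"
        by (simp add: add.int_pow_pow h)
      finally show ?case by (simp add: mult_single zeval_single h hom)
    qed (simp add: zeval_closed h)
  qed (simp add: zeval_closed h)
qed

lemma zeval_ring_cover:
  fixes h :: "'m::monoid_add \<Rightarrow> 'a"
  assumes h: "\<And>k. h k \<in> carrier R" and hom: "\<And>k l. h (k + l) = h k \<otimes> h l" and one: "h 0 = \<one>"
    and surj: "carrier R \<subseteq> range h"
  shows "ring_cover R (zeval h)"
proof
  show "zeval h 1 = \<one>"
    using zeval_single[of h 0 1] h by (simp add: one)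
  fix r assume "r \<in> carrier R"
  then obtain k where "h k = r" using surj by auto
  then show "\<exists>x. zeval h x = r"
    using zeval_single[of h k 1] h \<open>r \<in> carrier R\<close> by (intro exI[of _ "single k 1"]) (simp)
qed (auto simp: zeval_closed zeval_add zeval_mult h hom)

end

text \<open>The free monoid, wrapped so that concatenation can be the addition that the monoid ring
  expects; the resulting cover is a free ring.\<close>

datatype 'a word = Word (letters: "'a list")

instantiation word :: (type) monoid_add
begin

definition "0 = Word []"
definition "v + w = Word (letters v @ letters w)"

instance
  by standard (simp_all add: zero_word_def plus_word_def)

end

context ring
begin

text \<open>All elements of the type serve as letters, and those outside the carrier are read as
  zero. The value of a word therefore depends on the carrier, which matters once the same words are
  evaluated in a subring.\<close>

definition word_eval :: "'a word \<Rightarrow> 'a" where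
  "word_eval w = foldr (\<lambda>a r. (if a \<in> carrier R then a else \<zero>) \<otimes> r) (letters w) \<one>"

lemma word_eval_Nil: "word_eval (Word []) = \<one>"
  by (simp add: word_eval_def)

lemma word_eval_Cons:
  "word_eval (Word (a # as)) = (if a \<in> carrier R then a else \<zero>) \<otimes> word_eval (Word as)"
  by (simp add: word_eval_def)

lemma word_eval_closed [simp]: "word_eval w \<in> carrier R"
proof (cases w)
  case (Word as)
  have "word_eval (Word as) \<in> carrier R"
    by (induction as) (auto simp: word_eval_Nil word_eval_Cons)
  then show ?thesis using Word by simp
qed

lemma word_eval_add: "word_eval (v + w) = word_eval v \<otimes> word_eval w"
proof (cases v)
  case (Word as)
  have "word_eval (Word as + w) = word_eval (Word as) \<otimes> word_eval w"
    by (induction as) (auto simp: word_eval_Nil word_eval_Cons plus_word_def m_assoc)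
  then show ?thesis using Word by simp
qed

lemma word_eval_letter: "r \<in> carrier R \<Longrightarrow> word_eval (Word [r]) = r"
  by (simp add: word_eval_def)

lemma word_cover: "ring_cover R (zeval word_eval)"
proof (rule zeval_ring_cover)
  show "carrier R \<subseteq> range word_eval"
    using word_eval_letter by (metis rangeI subsetI)
qed (auto simp: word_eval_add zero_word_def word_eval_Nil)

lemma zeval_letter: "r \<in> carrier R \<Longrightarrow> zeval word_eval (single (Word [r]) 1) = r"
  by (simp add: zeval_single word_eval_letter)

end

context cring
begin

text \<open>With multisets as monomials the cover is an integral polynomial ring, hence commutative,
  as the later arguments with univariate polynomials over it require.\<close>

definition mset_eval :: "'a multiset \<Rightarrow> 'a" where
  "mset_eval M = (\<Otimes>a\<in>set_mset M. (if a \<in> carrier R then a else \<zero>) [^] count M a)"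

lemma mset_eval_superset:
  assumes "finite A" "set_mset M \<subseteq> A"
  shows "mset_eval M = (\<Otimes>a\<in>A. (if a \<in> carrier R then a else \<zero>) [^] count M a)"
  unfolding mset_eval_def using assms
  by (intro finprod_mono_neutral_cong_left) (auto simp: not_in_iff simp del: count_eq_zero_iff)

lemma mset_eval_closed [simp]: "mset_eval M \<in> carrier R"
  unfolding mset_eval_def by (intro finprod_closed) auto

lemma mset_eval_add: "mset_eval (M + N) = mset_eval M \<otimes> mset_eval N"
proof -
  let ?A = "set_mset M \<union> set_mset N" and ?g = "\<lambda>a. if a \<in> carrier R then a else \<zero>"
  have "(\<Otimes>a\<in>?A. ?g a [^] count M a \<otimes> ?g a [^] count N a) =
    (\<Otimes>a\<in>?A. ?g a [^] count M a) \<otimes> (\<Otimes>a\<in>?A. ?g a [^] count N a)"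
    by (intro finprod_multf) auto
  moreover have "(\<Otimes>a\<in>?A. ?g a [^] count (M + N) a) =
    (\<Otimes>a\<in>?A. ?g a [^] count M a \<otimes> ?g a [^] count N a)"
    by (intro finprod_cong') (auto simp: nat_pow_mult)
  ultimately show ?thesis
    by (simp add: mset_eval_superset[of ?A])
qed

lemma mset_cover: "ring_cover R (zeval mset_eval)"
proof (rule zeval_ring_cover)
  have "mset_eval {#r#} = r" if "r \<in> carrier R" for r
    using that mset_eval_superset[of "{r}" "{#r#}"] by simp
  then show "carrier R \<subseteq> range mset_eval"
    by (metis rangeI subsetI)
qed (auto simp: mset_eval_add, simp add: mset_eval_def)

end


subsection \<open>Uniform dimension of modules\<close>

locale left_module =
  fixes mul :: "'f::ab_group_add \<Rightarrow> 'f \<Rightarrow> 'f" and un :: 'f and sc :: "'f \<Rightarrow> 'v::ab_group_add \<Rightarrow> 'v"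
  assumes sc_add_l: "sc (a + b) x = sc a x + sc b x"
    and sc_add_r: "sc a (x + y) = sc a x + sc a y"
    and sc_mul: "sc (mul a b) x = sc a (sc b x)"
    and sc_un: "sc un x = x"
begin

definition submod :: "'v set \<Rightarrow> bool" where
  "submod Z \<longleftrightarrow> 0 \<in> Z \<and> (\<forall>x\<in>Z. \<forall>y\<in>Z. x - y \<in> Z) \<and> (\<forall>x\<in>Z. \<forall>a. sc a x \<in> Z)"

text \<open>The cyclic submodules generated by the \<open>w t\<close> modulo \<open>Z\<close> are
  nonzero and their sum is direct. Only the terms of a relation have to vanish, not the
  coefficients, so elements with annihilators are allowed.\<close>

definition indep :: "'v set \<Rightarrow> 't set \<Rightarrow> ('t \<Rightarrow> 'v) \<Rightarrow> bool" where
  "indep Z T w \<longleftrightarrow> finite T \<and> (\<forall>t\<in>T. w t \<notin> Z) \<and>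
     (\<forall>r. (\<Sum>t\<in>T. sc (r t) (w t)) \<in> Z \<longrightarrow> (\<forall>t\<in>T. sc (r t) (w t) \<in> Z))"

text \<open>A bound on the uniform dimension of the quotient by \<open>Z\<close>. Index sets consist
  of naturals, which loses nothing because independent families are finite.\<close>

definition rank_le :: "'v set \<Rightarrow> nat \<Rightarrow> bool" where
  "rank_le Z d \<longleftrightarrow> (\<forall>(T::nat set) w. indep Z T w \<longrightarrow> card T \<le> d)"

definition acc_above :: "'v set \<Rightarrow> bool" where
  "acc_above Z \<longleftrightarrow> (\<forall>L :: nat \<Rightarrow> 'v set. (\<forall>n. submod (L n) \<and> Z \<subseteq> L n \<and> L n \<subseteq> L (Suc n)) \<longrightarrow>
     (\<exists>N. \<forall>n\<ge>N. L n = L N))"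

lemma sc_0_l [simp]: "sc 0 x = 0"
  using sc_add_l[of 0 0 x] by simp

lemma sc_0_r [simp]: "sc a 0 = 0"
  using sc_add_r[of a 0 0] by simp

lemma sc_minus_l: "sc (- a) x = - sc a x"
  using sc_add_l[of "- a" a x] by (simp add: eq_neg_iff_add_eq_0)

lemma sc_diff_l: "sc (a - b) x = sc a x - sc b x"
  using sc_add_l[of a "- b" x] by (simp add: sc_minus_l)

lemma sc_sum_l: "sc (sum f A) x = (\<Sum>a\<in>A. sc (f a) x)"
  by (induction A rule: infinite_finite_induct) (auto simp: sc_add_l)

lemma sc_sum_r: "sc a (sum f A) = (\<Sum>x\<in>A. sc a (f x))"
  by (induction A rule: infinite_finite_induct) (auto simp: sc_add_r)

lemma submodD:
  assumes "submod Z"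
  shows "0 \<in> Z" "x \<in> Z \<Longrightarrow> y \<in> Z \<Longrightarrow> x - y \<in> Z" "x \<in> Z \<Longrightarrow> sc a x \<in> Z"
    "x \<in> Z \<Longrightarrow> y \<in> Z \<Longrightarrow> x + y \<in> Z"
proof -
  show *: "0 \<in> Z" "x \<in> Z \<Longrightarrow> y \<in> Z \<Longrightarrow> x - y \<in> Z" "x \<in> Z \<Longrightarrow> sc a x \<in> Z" for x y a
    using assms by (auto simp: submod_def)
  show "x \<in> Z \<Longrightarrow> y \<in> Z \<Longrightarrow> x + y \<in> Z"
    using *(2)[of x "0 - y"] *(2)[of 0 y] *(1) by simp
qed

lemma submod_sum: "submod Z \<Longrightarrow> (\<And>x. x \<in> A \<Longrightarrow> f x \<in> Z) \<Longrightarrow> sum f A \<in> Z"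
  by (induction A rule: infinite_finite_induct) (auto intro: submodD)

lemma submod_inter: "submod A \<Longrightarrow> submod B \<Longrightarrow> submod (A \<inter> B)"
  by (auto simp: submod_def)

lemma submod_adjoin:
  assumes "submod L"
  shows "submod {l + sc a x | l a. l \<in> L}"
proof -
  note L = submodD[OF assms]
  show ?thesis
    unfolding submod_def
  proof (intro conjI ballI allI)
    show "0 \<in> {l + sc a x |l a. l \<in> L}"
      using L(1) by (intro CollectI exI[of _ 0]) simp
    fix y assume "y \<in> {l + sc a x |l a. l \<in> L}"
    then obtain l a where y: "y = l + sc a x" "l \<in> L" by blast
    show "sc b y \<in> {l + sc a x |l a. l \<in> L}" for b
      using L(3)[OF y(2), of b] unfolding y(1)
      by (intro CollectI exI[of _ "sc b l"] exI[of _ "mul b a"]) (simp add: sc_add_r sc_mul)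
    fix z assume "z \<in> {l + sc a x |l a. l \<in> L}"
    then obtain k b where z: "z = k + sc b x" "k \<in> L" by blast
    show "y - z \<in> {l + sc a x |l a. l \<in> L}"
      using L(2)[OF y(2) z(2)] unfolding y(1) z(1)
      by (intro CollectI exI[of _ "l - k"] exI[of _ "a - b"]) (simp add: sc_diff_l)
  qed
qed

lemma indep_sum_on:
  assumes "indep Z T w" "T0 \<subseteq> T" "(\<Sum>t\<in>T0. sc (r t) (w t)) \<in> Z" "t \<in> T0"
  shows "sc (r t) (w t) \<in> Z"
proof -
  let ?r = "\<lambda>t. if t \<in> T0 then r t else 0"
  have "(\<Sum>t\<in>T. sc (?r t) (w t)) = (\<Sum>t\<in>T0. sc (r t) (w t))"
    using assms(1,2) by (intro sum.mono_neutral_cong_right) (auto simp: indep_def)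
  then have "sc (?r t) (w t) \<in> Z"
    using assms unfolding indep_def by (metis subsetD)
  then show ?thesis using assms(4) by simp
qed

text \<open>
  The kernel of \<open>V/(A \<inter> B) \<rightarrow> V/B\<close> embeds into \<open>V/A\<close>. In an independent family take a
  subfamily \<open>T0\<close> maximal among those that stay independent modulo \<open>B\<close>; each remaining member
  can be corrected by a combination over \<open>T0\<close> so as to lie in \<open>B\<close>.
\<close>

lemma rank_le_inter:
  assumes A: "submod A" "rank_le A dA" and B: "submod B" "rank_le B dB"
  shows "rank_le (A \<inter> B) (dA + dB)"
  unfolding rank_le_def
proof (intro allI impI)
  fix T :: "nat set" and w
  let ?Z = "A \<inter> B"
  assume ind: "indep ?Z T w"
  then have T: "finite T" by (simp add: indep_def)
  have Z: "submod ?Z" using A B by (simp add: submod_inter)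
  \<comment> \<open>\<open>Q T0\<close> says that the span of the members in \<open>T0\<close> meets
    \<open>B\<close> only inside \<open>A \<inter> B\<close>.\<close>
  define Q where "Q T0 \<longleftrightarrow> (\<forall>r. (\<Sum>t\<in>T0. sc (r t) (w t)) \<in> B \<longrightarrow> (\<Sum>t\<in>T0. sc (r t) (w t)) \<in> ?Z)" for T0
  have "Q {}" using submodD(1)[OF Z] by (simp add: Q_def)
  moreover have "finite {T0. T0 \<subseteq> T \<and> Q T0}" using T by simp
  ultimately have "\<exists>T0\<in>{T0. T0 \<subseteq> T \<and> Q T0}. \<forall>T1\<in>{T0. T0 \<subseteq> T \<and> Q T0}. T0 \<subseteq> T1 \<longrightarrow> T0 = T1"
    using finite_has_maximal[of "{T0. T0 \<subseteq> T \<and> Q T0}"] by blast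
  then obtain T0 where "T0 \<in> {T0. T0 \<subseteq> T \<and> Q T0}"
    and T0_max: "\<forall>T1\<in>{T0. T0 \<subseteq> T \<and> Q T0}. T0 \<subseteq> T1 \<longrightarrow> T0 = T1"
    by (rule bexE)
  then have T0: "T0 \<subseteq> T" "Q T0" by simp_all
  have Q0: "(\<Sum>t\<in>T0. sc (r t) (w t)) \<in> B \<Longrightarrow> (\<Sum>t\<in>T0. sc (r t) (w t)) \<in> ?Z" for r
    using T0(2) unfolding Q_def by blast
  have max: "T0 = T1" if "T1 \<subseteq> T" "Q T1" "T0 \<subseteq> T1" for T1
    using T0_max that by simp
  have fin0: "finite T0" using T0(1) T finite_subset by blast
  have "indep B T0 w"
    unfolding indep_def
  proof (intro conjI ballI allI impI notI fin0)
    fix t assume t: "t \<in> T0" "w t \<in> B"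
    let ?r = "\<lambda>s. if s = t then un else 0"
    have "(\<Sum>s\<in>T0. sc (?r s) (w s)) = (\<Sum>s\<in>T0. if s = t then w s else 0)"
      by (intro sum.cong) (auto simp: sc_un)
    also have "\<dots> = w t" using t fin0 by simp
    finally have "w t \<in> ?Z" using T0(2) t unfolding Q_def by metis
    then show False using ind t T0 by (auto simp: indep_def)
  next
    fix r t assume "(\<Sum>t\<in>T0. sc (r t) (w t)) \<in> B" "t \<in> T0"
    then have "sc (r t) (w t) \<in> ?Z"
      using indep_sum_on[OF ind T0(1)] Q0 by blast
    then show "sc (r t) (w t) \<in> B" by simp
  qed
  then have c0: "card T0 \<le> dB" using B(2) unfolding rank_le_def by blast
  have "\<exists>r. (\<Sum>s\<in>insert t T0. sc (r s) (w s)) \<in> B - ?Z" if "t \<in> T - T0" for t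
  proof -
    have "\<not> Q (insert t T0)" using max[of "insert t T0"] that T0(1) by blast
    then show ?thesis unfolding Q_def by blast
  qed
  then obtain r where r: "\<And>t. t \<in> T - T0 \<Longrightarrow> (\<Sum>s\<in>insert t T0. sc (r t s) (w s)) \<in> B - ?Z"
    by metis
  \<comment> \<open>Since \<open>T0\<close> cannot be enlarged, each remaining \<open>t\<close>
    supplies a combination that lies in \<open>B\<close> but not in \<open>A\<close>; these
    corrected elements turn out independent modulo \<open>A\<close>.\<close>
  define a where "a t = (\<Sum>s\<in>insert t T0. sc (r t s) (w s))" for t
  have a: "a t \<in> B" "a t \<notin> A" "a t = sc (r t t) (w t) + (\<Sum>s\<in>T0. sc (r t s) (w s))"
    if "t \<in> T - T0" for t
    using r[OF that] that fin0 by (auto simp: a_def)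
  have "indep A (T - T0) a"
    unfolding indep_def
  proof (intro conjI ballI allI impI)
    show "finite (T - T0)" using T by simp
    show "a t \<notin> A" if "t \<in> T - T0" for t using a that by blast
    fix s t assume s: "(\<Sum>t\<in>T - T0. sc (s t) (a t)) \<in> A" and t: "t \<in> T - T0"
    have "(\<Sum>t\<in>T - T0. sc (s t) (a t)) \<in> B"
      using a(1) submodD(3)[OF B(1)] by (intro submod_sum[OF B(1)]) blast
    with s have in_Z: "(\<Sum>t\<in>T - T0. sc (s t) (a t)) \<in> ?Z" by blast
    \<comment> \<open>Collects the coefficients with respect to the original family after the
      elements \<open>a t\<close> are expanded, so that independence of \<open>w\<close>
      applies.\<close>
    define c where "c x = (if x \<in> T0 then (\<Sum>t\<in>T - T0. mul (s t) (r t x)) else mul (s x) (r x x))" for x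
    have "(\<Sum>t\<in>T - T0. sc (s t) (a t)) =
      (\<Sum>t\<in>T - T0. sc (mul (s t) (r t t)) (w t)) + (\<Sum>t\<in>T - T0. \<Sum>x\<in>T0. sc (mul (s t) (r t x)) (w x))"
      by (simp add: a(3) sc_add_r sc_mul sc_sum_r sum.distrib)
    also have "(\<Sum>t\<in>T - T0. \<Sum>x\<in>T0. sc (mul (s t) (r t x)) (w x)) = (\<Sum>x\<in>T0. sc (c x) (w x))"
      by (subst sum.swap) (simp add: c_def sc_sum_l)
    also have "(\<Sum>t\<in>T - T0. sc (mul (s t) (r t t)) (w t)) = (\<Sum>x\<in>T - T0. sc (c x) (w x))"
      by (intro sum.cong) (auto simp: c_def)
    also have "(\<Sum>x\<in>T - T0. sc (c x) (w x)) + (\<Sum>x\<in>T0. sc (c x) (w x)) = (\<Sum>x\<in>T. sc (c x) (w x))"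
      using sum.subset_diff[OF T0(1) T, of "\<lambda>x. sc (c x) (w x)"] by simp
    finally have "sc (c t) (w t) \<in> ?Z"
      using indep_sum_on[OF ind subset_refl] in_Z t by simp
    then have 1: "sc (s t) (sc (r t t) (w t)) \<in> ?Z"
      using t by (simp add: c_def sc_mul)
    have eq: "sc (s t) (a t) = sc (s t) (sc (r t t) (w t)) + (\<Sum>x\<in>T0. sc (mul (s t) (r t x)) (w x))"
      by (simp add: a(3)[OF t] sc_add_r sc_sum_r sc_mul)
    then have "(\<Sum>x\<in>T0. sc (mul (s t) (r t x)) (w x)) = sc (s t) (a t) - sc (s t) (sc (r t t) (w t))"
      by simp
    also have "\<dots> \<in> B" using 1 a(1)[OF t] submodD[OF B(1)] by blast
    finally have "(\<Sum>x\<in>T0. sc (mul (s t) (r t x)) (w x)) \<in> ?Z"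
      by (rule Q0)
    then show "sc (s t) (a t) \<in> A" using eq 1 submodD(4)[OF A(1)] by simp
  qed
  then have "card (T - T0) \<le> dA" using A(2) unfolding rank_le_def by blast
  then show "card T \<le> dA + dB"
    using c0 T T0(1) fin0 by (simp add: card_Diff_subset)
qed

text \<open>Noetherian induction on submodules above which the dimension is unbounded. Such an
  \<open>L\<close> admits two independent elements, and adjoining them separately gives two larger
  submodules with intersection \<open>L\<close>. If both had finite rank,
  \<open>rank_le_inter\<close> would bound that of \<open>L\<close>; so one of them is bad again and
  the chain never stops.\<close>

lemma acc_rank_le:
  assumes I: "submod I" and acc: "acc_above I"
  shows "\<exists>d. rank_le I d"
proof (rule ccontr)
  assume neg: "\<nexists>d. rank_le I d"
  define P where "P L \<longleftrightarrow> submod L \<and> I \<subseteq> L \<and> (\<nexists>d. rank_le L d)" for L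
  have step: "\<exists>L'. P L' \<and> L \<subset> L'" if L: "P L" for L
  proof (rule ccontr)
    assume no: "\<nexists>L'. P L' \<and> L \<subset> L'"
    have sL: "submod L" using L by (simp add: P_def)
    have "\<not> rank_le L 1" using L by (simp add: P_def)
    then obtain T :: "nat set" and w where ind: "indep L T w" and "\<not> card T \<le> 1"
      by (auto simp: rank_le_def)
    have "finite T" using ind by (simp add: indep_def)
    then obtain s t where st: "s \<in> T" "t \<in> T" "s \<noteq> t"
      using \<open>\<not> card T \<le> 1\<close> card_le_Suc0_iff_eq[of T] by auto
    define X where "X x = {l + sc a x | l a. l \<in> L}" for x
    have X: "submod (X (w i))" "L \<subset> X (w i)" if "i \<in> T" for i
    proof -
      show "submod (X (w i))" unfolding X_def by (rule submod_adjoin[OF sL])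
      have "L \<subseteq> X (w i)"
      proof
        fix l assume "l \<in> L"
        then show "l \<in> X (w i)"
          unfolding X_def by (intro CollectI exI[of _ l] exI[of _ 0]) simp
      qed
      moreover have "w i \<in> X (w i)"
        unfolding X_def using submodD(1)[OF sL]
        by (intro CollectI exI[of _ 0] exI[of _ un]) (simp add: sc_un)
      moreover have "w i \<notin> L" using ind that by (auto simp: indep_def)
      ultimately show "L \<subset> X (w i)" by blast
    qed
    have "\<exists>d. rank_le (X (w i)) d" if "i \<in> T" for i
      using no X[OF that] L unfolding P_def by blast
    then obtain d1 d2 where "rank_le (X (w s)) d1" "rank_le (X (w t)) d2" using st by meson
    then have "rank_le (X (w s) \<inter> X (w t)) (d1 + d2)"
      using X st by (intro rank_le_inter) auto
    moreover have "X (w s) \<inter> X (w t) = L"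
    proof
      show "L \<subseteq> X (w s) \<inter> X (w t)" using X st by blast
      show "X (w s) \<inter> X (w t) \<subseteq> L"
      proof
        fix z assume "z \<in> X (w s) \<inter> X (w t)"
        then obtain l l' a b where z: "z = l + sc a (w s)" "z = l' + sc b (w t)" "l \<in> L" "l' \<in> L"
          unfolding X_def by blast
        define r where "r i = (if i = s then a else - b)" for i
        have "(\<Sum>i\<in>{s, t}. sc (r i) (w i)) = l' - l"
          using st z(1,2) by (simp add: r_def sc_minus_l algebra_simps)
        then have "sc (r s) (w s) \<in> L"
          using indep_sum_on[OF ind, of "{s, t}" r s] st submodD(2)[OF sL] z by simp
        then show "z \<in> L" using z submodD(4)[OF sL] by (simp add: r_def)
      qed
    qed
    ultimately show False using L by (auto simp: P_def)
  qed
  have "P I" using neg I by (simp add: P_def)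
  then obtain L where L: "\<And>n. P (L n)" "\<And>n. L n \<subset> L (Suc n)"
    using dependent_nat_choice[of "\<lambda>_. P" "\<lambda>_ L L'. L \<subset> L'"] step by metis
  then have "\<exists>N. \<forall>n\<ge>N. L n = L N"
    using acc unfolding acc_above_def P_def by (metis psubsetE)
  then show False using L(2) by (metis le_Suc_eq order_refl psubset_eq)
qed

end


section \<open>Row vectors over the coefficients modulo an ideal\<close>

locale unital_mod = mult_mod mul I for mul :: "'f::ab_group_add \<Rightarrow> 'f \<Rightarrow> 'f" (infixl \<open>\<cdot>\<close> 70) and I +
  fixes un :: 'f
  assumes un_l [simp]: "un \<cdot> x = x" and un_r [simp]: "x \<cdot> un = x"
begin

sublocale reg: left_module mul un mul
  by unfold_locales (auto simp: distl distr assoc)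

definition vscale :: "'f \<Rightarrow> ('y \<Rightarrow>\<^sub>0 'f) \<Rightarrow> ('y \<Rightarrow>\<^sub>0 'f)" where
  "vscale a w = Poly_Mapping.map (mul a) w"

lemma lookup_vscale [simp]: "lookup (vscale a w) y = a \<cdot> lookup w y"
  by (auto simp: vscale_def Poly_Mapping.map.rep_eq when_def)

sublocale vec: left_module mul un "vscale :: 'f \<Rightarrow> ('y \<Rightarrow>\<^sub>0 'f) \<Rightarrow> ('y \<Rightarrow>\<^sub>0 'f)"
  by unfold_locales (auto intro!: poly_mapping_eqI simp: lookup_add distl distr assoc)

lemma rank_le_coordinate:
  assumes "reg.rank_le I d"
  shows "vec.rank_le {w. lookup w y \<in> I} d"
  unfolding vec.rank_le_def
proof (intro allI impI)
  fix T :: "nat set" and w assume "vec.indep {w. lookup w y \<in> I} T w"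
  then have "reg.indep I T (\<lambda>t. lookup (w t) y)"
    by (simp add: vec.indep_def reg.indep_def lookup_sum)
  then show "card T \<le> d" using assms unfolding reg.rank_le_def by blast
qed

text \<open>The submodule is an intersection of coordinate kernels, each with quotient of dimension
  at most \<open>d\<close>, and \<open>rank_le_inter\<close> adds the bounds.\<close>

lemma rank_le_vec:
  assumes "reg.rank_le I d" "finite Y"
  shows "vec.rank_le {w. \<forall>y\<in>Y. lookup w y \<in> I} (d * card Y)"
  using assms(2)
proof (induction Y rule: finite_induct)
  case empty
  then show ?case by (auto simp: vec.rank_le_def vec.indep_def)
next
  case (insert y Y)
  have sub: "vec.submod {w. \<forall>y\<in>Y. lookup w y \<in> I}" for Y
    by (auto simp: vec.submod_def lookup_minus diff_in mul_in_r)
  have "{w. \<forall>y\<in>insert y Y. lookup w y \<in> I} = {w. lookup w y \<in> I} \<inter> {w. \<forall>y\<in>Y. lookup w y \<in> I}"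
    by auto
  then show ?case
    using vec.rank_le_inter[OF sub[of "{y}"] _ sub[of Y] insert.IH] rank_le_coordinate[OF assms(1), of y]
      insert.hyps by simp
qed

end


subsection \<open>Sofic approximations\<close>

text \<open>Finitely many conditions are imposed, each violated on a small fraction of the points,
  so at least half of the points satisfy all of them. Inverses turn the given maps into a right
  action, the side on which matrices act on row vectors.\<close>

lemma sofic_good_points:
  assumes G: "group G" and sof: "sofic G" and D: "finite D" "D \<subseteq> carrier G"
  shows "\<exists>N\<ge>1. \<exists>act :: nat \<Rightarrow> 'g \<Rightarrow> nat. \<exists>P \<subseteq> {1..N}. N \<le> 2 * card P \<and>
     (\<forall>g\<in>carrier G. inj (\<lambda>x. act x g) \<and> (\<forall>x\<in>{1..N}. act x g \<in> {1..N})) \<and>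
     (\<forall>x\<in>P. \<forall>g\<in>D. \<forall>h\<in>D. act (act x g) h = act x (g \<otimes>\<^bsub>G\<^esub> h) \<and> (act x g = act x h \<longrightarrow> g = h))"
proof -
  interpret group G by (rule G)
  \<comment> \<open>Besides \<open>D\<close> the conditions concern inverses, because
    \<open>act\<close> uses them, and quotients h g^-1, whose lack of fixed points separates
    \<open>act x g\<close> from \<open>act x h\<close>.\<close>
  define F where "F = insert \<one>\<^bsub>G\<^esub> (D \<union> m_inv G ` D \<union> (\<lambda>(h, g). h \<otimes>\<^bsub>G\<^esub> inv\<^bsub>G\<^esub> g) ` (D \<times> D))"
  have F: "finite F" "F \<subseteq> carrier G" using D by (auto simp: F_def)
  \<comment> \<open>One condition for each pair in \<open>F\<close> and at most one for each element
    of \<open>F\<close>; the choice of \<open>\<epsilon>\<close> then makes at most half of the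
    points bad.\<close>
  define c where "c = (card F)^2 + card F"
  have "card F \<noteq> 0" using F by (auto simp: F_def)
  then have c: "c > 0" by (simp add: c_def)
  define \<epsilon> :: real where "\<epsilon> = 1 / (2 * real c)"
  have "\<epsilon> > 0" using c by (simp add: \<epsilon>_def)
  with F have "finite F \<and> F \<subseteq> carrier G \<and> \<epsilon> > 0" by simp
  from sof[unfolded sofic_def, rule_format, OF this] obtain N \<sigma> where N: "N \<ge> 1"
    and \<sigma>: "\<sigma> \<in> carrier G \<rightarrow> carrier (sym_group N)"
    and hom: "\<forall>g\<in>F. \<forall>h\<in>F. (1 - \<epsilon>) * real N \<le>
      real (card {i \<in> {1..N}. (\<sigma> g \<otimes>\<^bsub>sym_group N\<^esub> \<sigma> h) i = \<sigma> (g \<otimes>\<^bsub>G\<^esub> h) i})"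
    and fix_pts: "\<forall>g\<in>F. g \<noteq> \<one>\<^bsub>G\<^esub> \<longrightarrow> real (card {i \<in> {1..N}. \<sigma> g i = i}) \<le> \<epsilon> * real N"
    by blast
  have perm: "\<sigma> g permutes {1..N}" if "g \<in> carrier G" for g
    using \<sigma> that by (auto simp: sym_group_def)
  define act where "act x g = \<sigma> (inv\<^bsub>G\<^esub> g) x" for x g
  define bad where "bad = (\<lambda>(g, h). {i \<in> {1..N}. \<sigma> g (\<sigma> h i) \<noteq> \<sigma> (g \<otimes>\<^bsub>G\<^esub> h) i})"
  define fxd where "fxd g = {i \<in> {1..N}. \<sigma> g i = i}" for g
  have bad: "real (card (bad p)) \<le> \<epsilon> * real N" if "p \<in> F \<times> F" for p
  proof -
    obtain g h where p: "p = (g, h)" by (cases p)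
    have "card ({1..N} - bad p) = N - card (bad p)"
      by (subst card_Diff_subset) (auto simp: bad_def p)
    moreover have "{i \<in> {1..N}. (\<sigma> g \<otimes>\<^bsub>sym_group N\<^esub> \<sigma> h) i = \<sigma> (g \<otimes>\<^bsub>G\<^esub> h) i} = {1..N} - bad p"
      by (auto simp: bad_def p sym_group_def)
    moreover have "bad p \<subseteq> {1..N}" by (auto simp: bad_def p)
    then have "card (bad p) \<le> N" using card_mono[of "{1..N}" "bad p"] by simp
    moreover have "(1 - \<epsilon>) * real N \<le> real (card {i \<in> {1..N}. (\<sigma> g \<otimes>\<^bsub>sym_group N\<^esub> \<sigma> h) i = \<sigma> (g \<otimes>\<^bsub>G\<^esub> h) i})"
      using hom that p by blast
    ultimately show ?thesis
      by (simp only: of_nat_diff) (simp add: algebra_simps)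
  qed
  define B where "B = (\<Union>p\<in>F \<times> F. bad p) \<union> (\<Union>g\<in>F - {\<one>\<^bsub>G\<^esub>}. fxd g)"
  define P where "P = {1..N} - B"
  have "real (card B) \<le> real (card (\<Union>p\<in>F \<times> F. bad p)) + real (card (\<Union>g\<in>F - {\<one>\<^bsub>G\<^esub>}. fxd g))"
    unfolding B_def using card_Un_le[of "\<Union>p\<in>F \<times> F. bad p" "\<Union>g\<in>F - {\<one>\<^bsub>G\<^esub>}. fxd g"] by linarith
  also have "real (card (\<Union>p\<in>F \<times> F. bad p)) \<le> (\<Sum>p\<in>F \<times> F. real (card (bad p)))"
    using card_UN_le[of "F \<times> F" bad] F by (simp flip: of_nat_sum)
  also have "\<dots> \<le> (\<Sum>p\<in>F \<times> F. \<epsilon> * real N)" by (intro sum_mono bad)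
  also have "real (card (\<Union>g\<in>F - {\<one>\<^bsub>G\<^esub>}. fxd g)) \<le> (\<Sum>g\<in>F - {\<one>\<^bsub>G\<^esub>}. real (card (fxd g)))"
    using card_UN_le[of "F - {\<one>\<^bsub>G\<^esub>}" fxd] F by (simp flip: of_nat_sum)
  also have "\<dots> \<le> (\<Sum>g\<in>F - {\<one>\<^bsub>G\<^esub>}. \<epsilon> * real N)"
    using fix_pts by (intro sum_mono) (simp add: fxd_def)
  also have "\<dots> \<le> real (card F) * (\<epsilon> * real N)"
    using \<open>\<epsilon> > 0\<close> card_Diff1_le[of F "\<one>\<^bsub>G\<^esub>"] by (simp add: mult_right_mono)
  finally have "real (card B) \<le> real c * (\<epsilon> * real N)"
    by (simp add: c_def card_cartesian_product algebra_simps power2_eq_square)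
  also have "\<dots> = real N / 2" using c by (simp add: \<epsilon>_def)
  finally have B: "2 * card B \<le> N" by linarith
  have "B \<subseteq> {1..N}" by (auto simp: B_def bad_def fxd_def)
  then have "card P = N - card B" "finite B"
    unfolding P_def by (auto simp: card_Diff_subset finite_subset)
  then have cP: "N \<le> 2 * card P" using B by linarith
  have good: "\<sigma> g (\<sigma> h x) = \<sigma> (g \<otimes>\<^bsub>G\<^esub> h) x" if "x \<in> P" "g \<in> F" "h \<in> F" for x g h
    using that by (auto simp: P_def B_def bad_def)
  have main: "act (act x g) h = act x (g \<otimes>\<^bsub>G\<^esub> h) \<and> (act x g = act x h \<longrightarrow> g = h)"
    if x: "x \<in> P" and gh: "g \<in> D" "h \<in> D" for x g h
  proof
    have iF: "inv\<^bsub>G\<^esub> g \<in> F" "inv\<^bsub>G\<^esub> h \<in> F" "h \<in> F" "\<one>\<^bsub>G\<^esub> \<in> F" "h \<otimes>\<^bsub>G\<^esub> inv\<^bsub>G\<^esub> g \<in> F"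
      using gh by (auto simp: F_def)
    have gc: "g \<in> carrier G" "h \<in> carrier G" using gh D by auto
    show "act (act x g) h = act x (g \<otimes>\<^bsub>G\<^esub> h)"
      using good[OF x iF(2,1)] gc by (simp add: act_def inv_mult_group)
    show "act x g = act x h \<longrightarrow> g = h"
    proof
      assume eq: "act x g = act x h"
      \<comment> \<open>The approximation need not send the identity to the identity, but at a good
        point the image of the identity acts idempotently, and by injectivity it fixes that
        point.\<close>
      have "\<sigma> \<one>\<^bsub>G\<^esub> (\<sigma> \<one>\<^bsub>G\<^esub> x) = \<sigma> \<one>\<^bsub>G\<^esub> x" using good[OF x iF(4,4)] by simp
      then have "\<sigma> \<one>\<^bsub>G\<^esub> x = x" using permutes_inj[OF perm[of "\<one>\<^bsub>G\<^esub>"]] by (auto dest: injD)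
      moreover have "\<sigma> (h \<otimes>\<^bsub>G\<^esub> inv\<^bsub>G\<^esub> g) x = \<sigma> \<one>\<^bsub>G\<^esub> x"
        using good[OF x iF(3,1)] good[OF x iF(3,2)] eq gc by (simp add: act_def)
      ultimately have "x \<in> fxd (h \<otimes>\<^bsub>G\<^esub> inv\<^bsub>G\<^esub> g)" using x by (simp add: fxd_def P_def)
      then have "h \<otimes>\<^bsub>G\<^esub> inv\<^bsub>G\<^esub> g = \<one>\<^bsub>G\<^esub>" using x iF(5) by (auto simp: P_def B_def)
      then show "g = h" using gc by (metis inv_equality inv_inv inv_closed)
    qed
  qed
  have "inj (\<lambda>x. act x g) \<and> (\<forall>x\<in>{1..N}. act x g \<in> {1..N})" if "g \<in> carrier G" for g
    using permutes_inj[OF perm[of "inv\<^bsub>G\<^esub> g"]] permutes_in_image[OF perm[of "inv\<^bsub>G\<^esub> g"]] that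
    by (simp add: act_def)
  then show ?thesis using N cP main
    by (intro exI[of _ N] conjI exI[of _ act] exI[of _ P]) (auto simp: P_def)
qed

text \<open>By maximality of \<open>Q\<close> every point of \<open>P\<close> conflicts with some
  point of \<open>Q\<close>, and injectivity leaves at most one such point for each triple (x, g,
  h); this accounts for the square of \<open>card D\<close>.\<close>

lemma separated_subset:
  fixes act :: "'x \<Rightarrow> 'g \<Rightarrow> 'y"
  assumes fin: "finite P" "finite D" "D \<noteq> {}" and inj: "\<And>g. g \<in> D \<Longrightarrow> inj (\<lambda>x. act x g)"
  shows "\<exists>Q\<subseteq>P. card P \<le> card Q * (card D)^2 \<and>
    (\<forall>x\<in>Q. \<forall>y\<in>Q. \<forall>g\<in>D. \<forall>h\<in>D. act x g = act y h \<longrightarrow> x = y)"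
proof -
  define sep where "sep Q \<longleftrightarrow> (\<forall>x\<in>Q. \<forall>y\<in>Q. \<forall>g\<in>D. \<forall>h\<in>D. act x g = act y h \<longrightarrow> x = y)" for Q
  have "sep {}" by (simp add: sep_def)
  then have ne: "{Q. Q \<subseteq> P \<and> sep Q} \<noteq> {}" by blast
  have "finite {Q. Q \<subseteq> P \<and> sep Q}" using fin(1) by simp
  from finite_has_maximal[OF this ne] obtain Q where "Q \<in> {Q. Q \<subseteq> P \<and> sep Q}"
    and Q_max: "\<forall>Q'\<in>{Q. Q \<subseteq> P \<and> sep Q}. Q \<subseteq> Q' \<longrightarrow> Q = Q'"
    by (rule bexE)
  then have Q: "Q \<subseteq> P" "sep Q" by simp_all
  have max: "Q = Q'" if "Q' \<subseteq> P" "sep Q'" "Q \<subseteq> Q'" for Q'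
    using Q_max that by simp
  define W where "W = (\<lambda>(x, g, h). {y. act y h = act x g})"
  have conflict: "\<exists>x\<in>Q. \<exists>g\<in>D. \<exists>h\<in>D. act y h = act x g" if y: "y \<in> P" for y
  proof (rule ccontr)
    assume neg: "\<not> ?thesis"
    have "sep (insert y Q)"
      using Q(2) neg unfolding sep_def by (metis insert_iff)
    then have "y \<in> Q" using max[of "insert y Q"] Q(1) y by blast
    with neg fin(3) show False by blast
  qed
  have "P \<subseteq> (\<Union>t\<in>Q \<times> D \<times> D. W t)"
    using conflict by (fastforce simp: W_def)
  have W1: "finite (W t) \<and> card (W t) \<le> 1" if "t \<in> Q \<times> D \<times> D" for t
  proof -
    obtain x g h where t: "t = (x, g, h)" by (cases t)
    have "y = z" if "y \<in> W t" "z \<in> W t" for y z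
      using injD[OF inj[of h], of y z] that \<open>t \<in> _\<close> by (auto simp: W_def t)
    then have "W t = {} \<or> (\<exists>y. W t = {y})" by blast
    then show ?thesis by auto
  qed
  have finQ: "finite (Q \<times> D \<times> D)" using Q(1) fin finite_subset by blast
  have "card P \<le> card (\<Union>t\<in>Q \<times> D \<times> D. W t)"
    using \<open>P \<subseteq> _\<close> W1 finQ by (intro card_mono finite_UN_I) auto
  also have "\<dots> \<le> (\<Sum>t\<in>Q \<times> D \<times> D. card (W t))" by (rule card_UN_le[OF finQ])
  also have "\<dots> \<le> (\<Sum>t\<in>Q \<times> D \<times> D. 1)" using W1 by (intro sum_mono) blast
  also have "\<dots> = card Q * (card D)^2" by (simp add: card_cartesian_product power2_eq_square)
  finally show ?thesis using Q by (auto simp: sep_def)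
qed


subsection \<open>Sofic groups over rings with a chain condition\<close>

lemma (in mult_mod) coeffs_in_diff: "f \<in> coeffs_in I \<Longrightarrow> g \<in> coeffs_in I \<Longrightarrow> f - g \<in> coeffs_in I"
  by (simp add: coeffs_in_def lookup_minus diff_in)

lemma (in mult_mod) coeffs_in_sum:
  "(\<And>x. x \<in> A \<Longrightarrow> f x \<in> coeffs_in I) \<Longrightarrow> sum f A \<in> coeffs_in I"
  by (simp add: coeffs_in_def lookup_sum sum_in)

context unital_mod
begin

text \<open>Row \<open>i0\<close> of the matrix, scaled by \<open>r\<close> on the left, with each
  group element moved to a point. For \<open>\<tau> = act x\<close> the row is planted around the
  point \<open>x\<close> of the sofic approximation.\<close>

definition row :: "nat \<Rightarrow> ('g \<Rightarrow> 'y) \<Rightarrow> 'f \<Rightarrow> (nat \<times> 'g \<times> nat \<Rightarrow>\<^sub>0 'f) \<Rightarrow> (nat \<times> 'y \<Rightarrow>\<^sub>0 'f)" where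
  "row i0 \<tau> r = additive_ext (\<lambda>(i, g, j) c. if i = i0 then single (j, \<tau> g) (r \<cdot> c) else 0)"

lemma row_add: "row i0 \<tau> r (f + g) = row i0 \<tau> r f + row i0 \<tau> r g"
  unfolding row_def by (rule additive_ext_add) (auto simp: single_add distr split: prod.split)

lemma row_0 [simp]: "row i0 \<tau> r 0 = 0"
  by (simp add: row_def)

lemma row_single:
  "row i0 \<tau> r (single (i, g, j) c) = (if i = i0 then single (j, \<tau> g) (r \<cdot> c) else 0)"
  unfolding row_def by (subst additive_ext_single) (auto split: prod.split)

lemma row_vscale: "row i0 \<tau> r f = vscale r (row i0 \<tau> un f)"
proof -
  have "keys f \<subseteq> UNIV" by simp
  then show ?thesis
  proof (induction f rule: poly_mapping_additive_induct)
    case (single p a)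
    show ?case
      by (cases p) (auto intro!: poly_mapping_eqI simp: row_single lookup_single when_def)
  qed (auto simp: row_add vec.sc_add_r)
qed

lemma lookup_row:
  "lookup (row i0 \<tau> r f) (j, y) =
    (\<Sum>(i, g, j')\<in>keys f. r \<cdot> lookup f (i, g, j') when i = i0 \<and> j' = j \<and> \<tau> g = y)"
  unfolding row_def additive_ext_def
  by (simp add: lookup_sum split_def) (intro sum.cong refl, simp add: lookup_single when_def)

lemma row_coeffs_in: "f \<in> coeffs_in I \<Longrightarrow> row i0 \<tau> r f \<in> coeffs_in I"
  by (auto simp: coeffs_in_def lookup_row when_def split_def intro!: sum_in mul_in_r)

definition act_op :: "('x \<Rightarrow> 'g \<Rightarrow> 'y) \<Rightarrow> nat \<times> 'x \<Rightarrow> nat \<times> 'g \<times> nat \<Rightarrow> (nat \<times> 'y) option" where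
  "act_op act = (\<lambda>(i, x) (i', g, j). if i = i' then Some (j, act x g) else None)"

text \<open>Planting commutes with right multiplication as long as the action law holds on the group
  elements that occur, which is what a good point provides.\<close>

lemma row_conv:
  assumes "\<And>g h. g \<in> D \<Longrightarrow> h \<in> D \<Longrightarrow> act (\<tau> g) h = \<tau> (m g h)" "D \<subseteq> C"
    and "keys f \<subseteq> UNIV \<times> D \<times> UNIV" "keys g \<subseteq> UNIV \<times> D \<times> UNIV"
  shows "row i0 \<tau> r (mat_conv mul C m f g) = conv mul (act_op act) (row i0 \<tau> r f) g"
proof (rule conv_hom[where \<phi> = "row i0 \<tau> r" and \<psi> = "\<lambda>x. x" and \<theta> = "row i0 \<tau> r", OF _ _ _ _ assms(3,4)])
  fix p q :: "nat \<times> 'a \<times> nat" and a b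
  assume "p \<in> UNIV \<times> D \<times> UNIV" "q \<in> UNIV \<times> D \<times> UNIV"
  then show "row i0 \<tau> r (mat_conv mul C m (single p a) (single q b)) =
    conv mul (act_op act) (row i0 \<tau> r (single p a)) (single q b)"
    using assms(1,2)
    by (cases p; cases q) (auto simp: conv_single triple_op_def row_single act_op_def assoc)
qed (auto simp: row_add)

definition gparts :: "(nat \<times> 'g \<times> nat \<Rightarrow>\<^sub>0 'f) \<Rightarrow> 'g set" where
  "gparts f = (\<lambda>(i, g, j). g) ` keys f"

lemma finite_gparts [simp]: "finite (gparts f)"
  by (simp add: gparts_def)

lemma keys_gparts: "gparts f \<subseteq> D \<longleftrightarrow> keys f \<subseteq> UNIV \<times> D \<times> UNIV"
  by (force simp: gparts_def)

text \<open>The planted rows of f u^l may overlap. To see that they are independent all the same,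
  multiply a relation by v^l0 f: only the layer \<open>l0\<close> survives, as a combination of
  planted rows of \<open>f\<close>, and these have disjoint supports. So each coefficient kills row
  \<open>i0\<close> of \<open>f\<close>, and with it that row of every f u^l.\<close>

theorem sofic_sfin_mod:
  fixes G :: "('g, 'm) monoid_scheme"
  assumes G: "group G" and sof: "sofic G" and acc: "reg.acc_above I"
  shows "sfin_mod mul I (carrier G) (monoid.mult G)"
  unfolding sfin_mod_def
proof (intro allI impI)
  interpret G: group G by (rule G)
  let ?C = "carrier G" and ?m = "monoid.mult G"
  fix n e u v
  assume k: "keys e \<subseteq> triples n ?C" "keys u \<subseteq> triples n ?C" "keys v \<subseteq> triples n ?C"
    and cp: "mult_mod.corner_pair (mat_conv mul ?C ?m) (coeffs_in I) e u v"
  have sg: "semigroup_on ?C ?m"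
    by unfold_locales (auto simp: G.m_assoc)
  define cv where "cv = mat_conv mul ?C ?m"
  interpret M: mult_mod cv "coeffs_in I"
    unfolding cv_def by (rule mult_mod_mat_conv[OF mult_mod_axioms sg])
  note kc = keys_mat_conv[OF mult_mod_axioms sg, folded cv_def]
  note cp = cp[folded cv_def]
  have sub_I: "reg.submod I" by (auto simp: reg.submod_def diff_in mul_in_r)
  obtain d where d: "reg.rank_le I d" using reg.acc_rank_le[OF sub_I acc] by blast
  define f where "f = e - cv v u"
  have kf: "keys f \<subseteq> triples n ?C" unfolding f_def by (intro keys_diff_subset kc k)
  have "f \<in> coeffs_in I"
  proof (rule ccontr)
    assume "f \<notin> coeffs_in I"
    \<comment> \<open>One row with an entry outside \<open>I\<close> suffices; all vectors below are
      made from row \<open>i0\<close>.\<close>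
    then obtain i0 g0 j0 where nz: "lookup f (i0, g0, j0) \<notin> I" by (auto simp: coeffs_in_def)
    define Df where "Df = gparts f"
    have g0: "g0 \<in> Df"
    proof -
      have "(i0, g0, j0) \<in> keys f" using nz by (metis in_keys_iff zero_in)
      then show ?thesis unfolding Df_def gparts_def by (rule image_eqI[rotated]) simp
    qed
    \<comment> \<open>\<open>Q\<close> will contain at least N / (2 (card Df)^2) points, so with
      this many layers the family exceeds the dimension bound d n N. \<open>Df\<close> comes from
      \<open>f\<close> alone, hence \<open>k\<close> can be fixed before the larger set
      \<open>D\<close>, which depends on it.\<close>
    define k where "k = 2 * (card Df)^2 * d * n + 1"
    define a where "a = M.rpow f u"
    define b where "b = M.lpow f v"
    have ka: "keys (a l) \<subseteq> triples n ?C" for l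
      unfolding a_def by (induction l) (use kf k kc in auto)
    have kb: "keys (b l) \<subseteq> triples n ?C" for l
      unfolding b_def by (induction l) (use kf k kc in auto)
    have units: "cv (a l) (b l') - (if l = l' then f else 0) \<in> coeffs_in I" for l l'
      using M.matrix_units[OF cp, of l l'] unfolding a_def b_def f_def M.cong_mod_def .
    define D where "D = gparts f \<union> (\<Union>l<k. gparts (a l) \<union> gparts (b l))"
    have D: "finite D" "D \<subseteq> ?C" "Df \<subseteq> D"
      using kf ka kb by (auto simp: D_def Df_def gparts_def) fastforce+
    from sofic_good_points[OF G sof D(1,2)]
    obtain N and act :: "nat \<Rightarrow> 'g \<Rightarrow> nat" and P where N: "N \<ge> 1" and P: "P \<subseteq> {1..N}" "N \<le> 2 * card P"
      and act': "\<forall>g\<in>carrier G. inj (\<lambda>x. act x g) \<and> (\<forall>x\<in>{1..N}. act x g \<in> {1..N})"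
      and good': "\<forall>x\<in>P. \<forall>g\<in>D. \<forall>h\<in>D. act (act x g) h = act x (g \<otimes>\<^bsub>G\<^esub> h) \<and> (act x g = act x h \<longrightarrow> g = h)"
      by (elim exE conjE) (rule that)
    have act: "inj (\<lambda>x. act x g)" "x \<in> {1..N} \<Longrightarrow> act x g \<in> {1..N}" if "g \<in> ?C" for g x
      using act' that by blast+
    have good: "act (act x g) h = act x (?m g h)" "act x g = act x h \<Longrightarrow> g = h"
      if "x \<in> P" "g \<in> D" "h \<in> D" for x g h
      using good' that by blast+
    have finP: "finite P" using P finite_subset by blast
    have Df: "finite Df" "Df \<noteq> {}" "inj (\<lambda>x. act x g)" if "g \<in> Df" for g
      using g0 act(1) D that by (auto simp: Df_def)
    have "\<exists>Q\<subseteq>P. card P \<le> card Q * (card Df)^2 \<and>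
        (\<forall>x\<in>Q. \<forall>y\<in>Q. \<forall>g\<in>Df. \<forall>h\<in>Df. act x g = act y h \<longrightarrow> x = y)"
      using Df(1,2)[OF g0] Df(3) by (intro separated_subset finP)
    then obtain Q
      where Q: "Q \<subseteq> P" "card P \<le> card Q * (card Df)^2"
      and sep': "\<forall>x\<in>Q. \<forall>y\<in>Q. \<forall>g\<in>Df. \<forall>h\<in>Df. act x g = act y h \<longrightarrow> x = y"
      by (elim exE conjE) (rule that)
    have sep: "x = y" if "x \<in> Q" "y \<in> Q" "g \<in> Df" "h \<in> Df" "act x g = act y h" for x y g h
      using sep' that by blast
    define Y where "Y = {..<n} \<times> {1..N}"
    define Z where "Z = {w :: nat \<times> nat \<Rightarrow>\<^sub>0 'f. \<forall>y\<in>Y. lookup w y \<in> I}"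
    define L where "L r x = row i0 (act x) r" for r x
    \<comment> \<open>\<open>rank_le\<close> tests families indexed by naturals, so pairs of a point
      and a layer are encoded.\<close>
    define T where "T = prod_encode ` (Q \<times> {..<k})"
    define w where "w t = (case prod_decode t of (x, l) \<Rightarrow> L un x (a l))" for t
    have finQ: "finite Q" using Q finP finite_subset by blast
    have L_conv: "conv mul (act_op act) (L r x (a l)) (b l') = L r x (cv (a l) (b l'))"
      if "x \<in> Q" "l < k" "l' < k" for r x l l'
      unfolding L_def cv_def
    proof (rule row_conv[symmetric])
      show "keys (a l) \<subseteq> UNIV \<times> D \<times> UNIV" "keys (b l') \<subseteq> UNIV \<times> D \<times> UNIV"
        using that by (auto simp: D_def simp flip: keys_gparts)
    qed (use good that Q D in auto)
    have L_units: "conv mul (act_op act) (L r x (a l)) (b l') - (if l = l' then L r x f else 0) \<in> coeffs_in I"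
      if "x \<in> Q" "l < k" "l' < k" for r x l l'
    proof -
      let ?g = "cv (a l) (b l') - (if l = l' then f else 0)"
      have "L r x (cv (a l) (b l')) = L r x ?g + L r x (if l = l' then f else 0)"
        unfolding L_def by (simp flip: row_add)
      moreover have "L r x (if l = l' then f else 0) = (if l = l' then L r x f else 0)"
        by (simp add: L_def)
      moreover have "L r x ?g \<in> coeffs_in I"
        unfolding L_def by (rule row_coeffs_in[OF units])
      ultimately show ?thesis using that by (simp add: L_conv)
    qed
    \<comment> \<open>Separation of \<open>Q\<close> keeps rows planted at different points apart,
      and goodness keeps the group elements at one point apart, so every coefficient of row
      \<open>i0\<close> of \<open>f\<close> can be read off.\<close>
    have L_lookup: "lookup (L r x f) (j, act x' g) = (if x = x' then r \<cdot> lookup f (i0, g, j) else 0)"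
      if "x \<in> Q" "x' \<in> Q" "g \<in> Df" for r x x' g j
    proof -
      have "lookup (L r x f) (j, act x' g) =
        (\<Sum>p\<in>keys f. if p = (i0, g, j) then (if x = x' then r \<cdot> lookup f p else 0) else 0)"
        unfolding L_def lookup_row
      proof (intro sum.cong refl)
        fix p assume p: "p \<in> keys f"
        obtain i h j' where pe: "p = (i, h, j')" by (cases p)
        have h: "h \<in> Df" using p unfolding Df_def gparts_def pe by force
        have "act x h = act x' g \<longleftrightarrow> x = x' \<and> h = g"
          using sep[OF that(1,2) h that(3)] good(2)[of x h g] Q(1) that D(3) h by blast
        then show "(case p of (i, g', j') \<Rightarrow> r \<cdot> lookup f (i, g', j') when i = i0 \<and> j' = j \<and> act x g' = act x' g)
          = (if p = (i0, g, j) then (if x = x' then r \<cdot> lookup f p else 0) else 0)"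
          by (auto simp: pe when_def)
      qed
      also have "\<dots> = (if x = x' then r \<cdot> lookup f (i0, g, j) else 0)"
        by (simp add: in_keys_iff)
      finally show ?thesis .
    qed
    \<comment> \<open>The planted rows vanish outside the finite block \<open>Y\<close>; therefore
      lying in \<open>Z\<close> will be the same as having all coefficients in
      \<open>I\<close>.\<close>
    have L_out: "lookup (L r x (a l)) y = 0" if "x \<in> Q" "y \<notin> Y" for r x l y
    proof -
      obtain j z where y: "y = (j, z)" by (cases y)
      have "j' < n \<and> act x g \<in> {1..N}" if "(i, g, j') \<in> keys (a l)" for i g j'
      proof -
        have "x \<in> {1..N}" using \<open>x \<in> Q\<close> Q P by blast
        moreover have "g \<in> ?C" "j' < n" using ka[of l] that by auto
        ultimately show ?thesis using act(2) by blast
      qed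
      then have "\<not> (j' = j \<and> act x g = z)" if "(i, g, j') \<in> keys (a l)" for i g j'
        using that \<open>y \<notin> Y\<close> unfolding y Y_def by blast
      then show ?thesis
        unfolding y L_def lookup_row
        by (intro sum.neutral ballI) (simp add: when_def split: prod.split, blast)
    qed
    have L_Z: "L r x (a l) \<in> Z \<longleftrightarrow> L r x (a l) \<in> coeffs_in I" if "x \<in> Q" for r x l
    proof -
      have "lookup (L r x (a l)) y \<in> I" if "y \<notin> Y" for y
        using L_out[OF \<open>x \<in> Q\<close> that] by simp
      then show ?thesis unfolding Z_def coeffs_in_def by blast
    qed
    have w: "w (prod_encode (x, l)) = L un x (a l)" for x l by (simp add: w_def)
    have "vec.indep Z T w"
      unfolding vec.indep_def
    proof (intro conjI ballI allI impI)
      show "finite T" using finQ by (simp add: T_def)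
    next
      fix t assume "t \<in> T"
      then obtain x l where t: "t = prod_encode (x, l)" "x \<in> Q" "l < k" by (auto simp: T_def)
      show "w t \<notin> Z"
      proof
        assume "w t \<in> Z"
        then have "L un x (a l) \<in> coeffs_in I" using L_Z[OF t(2)] by (simp add: t w)
        then have "conv mul (act_op act) (L un x (a l)) (b l) \<in> coeffs_in I" by (rule coeffs_in_conv_l)
        then have "L un x f \<in> coeffs_in I"
          using coeffs_in_diff[OF _ L_units[OF t(2,3,3), of un]] by fastforce
        then have "lookup (L un x f) (j0, act x g0) \<in> I" by (simp add: coeffs_in_def)
        then show False using nz L_lookup[OF t(2,2) g0, of un j0] by simp
      qed
    next
      fix r t assume s: "(\<Sum>t\<in>T. vscale (r t) (w t)) \<in> Z" and "t \<in> T"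
      then obtain x0 l0 where t: "t = prod_encode (x0, l0)" "x0 \<in> Q" "l0 < k" by (auto simp: T_def)
      let ?r = "\<lambda>x l. r (prod_encode (x, l))"
      let ?c = "\<lambda>h. conv mul (act_op act) h (b l0)"
      have vs: "vscale s (L un x h) = L s x h" for s x h
        unfolding L_def by (rule row_vscale[symmetric])
      have sum_eq: "(\<Sum>t\<in>T. vscale (r t) (w t)) = (\<Sum>(x, l)\<in>Q \<times> {..<k}. L (?r x l) x (a l))"
        unfolding T_def
        by (subst sum.reindex) (auto simp: w vs intro!: sum.cong inj_onI split: prod.split)
      have "(\<Sum>t\<in>T. vscale (r t) (w t)) \<in> coeffs_in I"
      proof -
        have "lookup (\<Sum>t\<in>T. vscale (r t) (w t)) y \<in> I" if "y \<notin> Y" for y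
        proof -
          have "lookup (w t) y = 0" if "t \<in> T" for t
            using that L_out[OF _ \<open>y \<notin> Y\<close>] by (auto simp: T_def w)
          then show ?thesis by (auto simp: lookup_sum intro!: sum_in mul_in_r)
        qed
        then show ?thesis using s by (auto simp: Z_def coeffs_in_def)
      qed
      then have "?c (\<Sum>(x, l)\<in>Q \<times> {..<k}. L (?r x l) x (a l)) \<in> coeffs_in I"
        unfolding sum_eq by (rule coeffs_in_conv_l)
      then have 1: "(\<Sum>(x, l)\<in>Q \<times> {..<k}. ?c (L (?r x l) x (a l))) \<in> coeffs_in I"
        by (simp add: conv_sum_l split_def)
      have 2: "(\<Sum>(x, l)\<in>Q \<times> {..<k}. ?c (L (?r x l) x (a l)) - (if l = l0 then L (?r x l) x f else 0)) \<in> coeffs_in I"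
      proof (rule coeffs_in_sum)
        fix p assume "p \<in> Q \<times> {..<k}"
        then obtain x l where p: "p = (x, l)" "x \<in> Q" "l < k" by auto
        show "(case p of (x, l) \<Rightarrow> ?c (L (?r x l) x (a l)) - (if l = l0 then L (?r x l) x f else 0)) \<in> coeffs_in I"
          unfolding p(1) prod.case by (rule L_units[OF p(2,3) t(3)])
      qed
      have "(\<Sum>(x, l)\<in>Q \<times> {..<k}. (if l = l0 then L (?r x l) x f else 0)) =
        (\<Sum>(x, l)\<in>Q \<times> {..<k}. ?c (L (?r x l) x (a l))) -
        (\<Sum>(x, l)\<in>Q \<times> {..<k}. ?c (L (?r x l) x (a l)) - (if l = l0 then L (?r x l) x f else 0))"
        by (simp add: split_def sum_subtractf)
      then have 3: "(\<Sum>(x, l)\<in>Q \<times> {..<k}. (if l = l0 then L (?r x l) x f else 0)) \<in> coeffs_in I"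
        using coeffs_in_diff[OF 1 2] by simp
      have "(\<Sum>(x, l)\<in>Q \<times> {..<k}. (if l = l0 then L (?r x l) x f else 0)) = (\<Sum>x\<in>Q. L (?r x l0) x f)"
        using t(3) by (simp add: sum.cartesian_product[symmetric])
      then have S: "(\<Sum>x\<in>Q. L (?r x l0) x f) \<in> coeffs_in I" using 3 by simp
      \<comment> \<open>Reading the relation at the positions \<open>act x0 g\<close> leaves only
        the summand of \<open>x0\<close>.\<close>
      have rf: "?r x0 l0 \<cdot> lookup f (i0, g, j) \<in> I" for g j
      proof (cases "g \<in> Df")
        case True
        have "(\<Sum>x\<in>Q. lookup (L (?r x l0) x f) (j, act x0 g)) \<in> I"
          using S by (simp add: coeffs_in_def lookup_sum)
        also have "(\<Sum>x\<in>Q. lookup (L (?r x l0) x f) (j, act x0 g)) =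
          (\<Sum>x\<in>Q. if x = x0 then ?r x l0 \<cdot> lookup f (i0, g, j) else 0)"
          using True t(2) by (intro sum.cong) (auto simp: L_lookup)
        also have "\<dots> = ?r x0 l0 \<cdot> lookup f (i0, g, j)" using t(2) finQ by simp
        finally show ?thesis .
      next
        case False
        then have "(i0, g, j) \<notin> keys f" unfolding Df_def gparts_def by force
        then show ?thesis by (simp add: in_keys_iff)
      qed
      \<comment> \<open>Row \<open>i0\<close> of f u^(l+1) is row \<open>i0\<close> of f u^l times
        \<open>u\<close>, and \<open>I\<close> absorbs factors on the right.\<close>
      have ra: "lookup (a l) (i0, g, j) \<in> {z. ?r x0 l0 \<cdot> z \<in> I}" for l g j
      proof (induction l arbitrary: g j)
        case 0
        then show ?case using rf by (simp add: a_def)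
      next
        case (Suc l)
        have "a (Suc l) = cv (a l) u" by (simp add: a_def)
        then have "lookup (a (Suc l)) (i0, g, j) = (\<Sum>p\<in>keys (a l). \<Sum>q\<in>keys u.
            lookup (a l) p \<cdot> lookup u q when triple_op ?C ?m p q = Some (i0, g, j))"
          unfolding cv_def by (simp add: lookup_conv[of "keys (a l)" "keys u"])
        moreover have "?r x0 l0 \<cdot> (lookup (a l) p \<cdot> lookup u q when triple_op ?C ?m p q = Some (i0, g, j)) \<in> I"
          for p q
        proof (cases "triple_op ?C ?m p q = Some (i0, g, j)")
          case True
          then obtain g' j' where "p = (i0, g', j')"
            by (cases p; cases q) (auto simp: triple_op_def split: if_splits)
          then show ?thesis using True Suc.IH[of g' j'] by (simp add: mul_in_l flip: assoc)
        qed simp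
        ultimately show ?case by (simp add: mul_sum_r sum_in)
      qed
      have "L (?r x0 l0) x0 (a l0) \<in> coeffs_in I"
        using ra unfolding L_def coeffs_in_def
        by (auto simp: lookup_row when_def split_def intro!: sum_in)
      then show "vscale (r t) (w t) \<in> Z"
        unfolding t(1) w vs Z_def coeffs_in_def by blast
    qed
    then have "card T \<le> d * card Y"
      using rank_le_vec[OF d, of Y] unfolding vec.rank_le_def Z_def Y_def by blast
    moreover have "card T = card Q * k"
      unfolding T_def by (subst card_image) (auto intro: inj_onI simp: card_cartesian_product)
    moreover have "card Y = n * N" by (simp add: Y_def)
    ultimately have le: "card Q * k \<le> d * (n * N)" by simp
    have "N \<le> 2 * (card Q * (card Df)^2)" using P(2) Q(2) by linarith
    then have "d * (n * N) \<le> d * (n * (2 * (card Q * (card Df)^2)))"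
      by (intro mult_le_mono le_refl)
    also have "\<dots> = card Q * (k - 1)" by (simp add: k_def)
    finally have "card Q * k \<le> card Q * (k - 1)" using le by linarith
    moreover have "card Q > 0" using P(2) Q(2) N by (cases "card Q") auto
    ultimately show False by (simp add: k_def)
  qed
  then show "mat_conv mul ?C ?m v u - e \<in> coeffs_in I"
    using M.uminus_in[of f] by (simp add: f_def cv_def)
qed

end


subsection \<open>Duality\<close>

abbreviation (input) flip :: "('a \<Rightarrow> 'b \<Rightarrow> 'c) \<Rightarrow> 'b \<Rightarrow> 'a \<Rightarrow> 'c" where
  "flip f \<equiv> \<lambda>x y. f y x"

lemma mult_mod_flip: "mult_mod mul I \<Longrightarrow> mult_mod (flip mul) I"
  by (simp add: mult_mod_def)

lemma semigroup_on_flip: "semigroup_on C m \<Longrightarrow> semigroup_on C (flip m)"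
  by (simp add: semigroup_on_def)

definition tr3 :: "nat \<times> 's \<times> nat \<Rightarrow> nat \<times> 's \<times> nat" where
  "tr3 = (\<lambda>(i, s, j). (j, s, i))"

lemma tr3_tr3 [simp]: "tr3 (tr3 p) = p"
  by (simp add: tr3_def split_def)

lemma inj_tr3: "inj tr3"
  by (metis injI tr3_tr3)

definition mat_transpose :: "(nat \<times> 's \<times> nat \<Rightarrow>\<^sub>0 'f::zero) \<Rightarrow> (nat \<times> 's \<times> nat \<Rightarrow>\<^sub>0 'f)" where
  "mat_transpose f = Poly_Mapping.map_key tr3 f"

lemma lookup_mat_transpose [simp]: "lookup (mat_transpose f) p = lookup f (tr3 p)"
  by (simp add: mat_transpose_def Poly_Mapping.map_key.rep_eq inj_tr3)

lemma mat_transpose_mat_transpose [simp]: "mat_transpose (mat_transpose f) = f"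
  by (rule poly_mapping_eqI) simp

lemma mat_transpose_diff: "mat_transpose (f - g) = mat_transpose f - mat_transpose g"
  for f :: "nat \<times> 's \<times> nat \<Rightarrow>\<^sub>0 'f::ab_group_add"
  by (rule poly_mapping_eqI) (simp add: lookup_minus)

lemma mat_transpose_coeffs_in [simp]: "mat_transpose f \<in> coeffs_in I \<longleftrightarrow> f \<in> coeffs_in I"
proof -
  have "(\<forall>p. lookup f (tr3 p) \<in> I) \<longleftrightarrow> (\<forall>p. lookup f p \<in> I)"
    by (metis tr3_tr3)
  then show ?thesis by (simp only: coeffs_in_def mem_Collect_eq lookup_mat_transpose)
qed

lemma keys_mat_transpose: "keys (mat_transpose f) \<subseteq> triples n C \<longleftrightarrow> keys f \<subseteq> triples n C"
proof -
  have "keys (mat_transpose f) \<subseteq> triples n C" if "keys f \<subseteq> triples n C" for f :: "nat \<times> 'a \<times> nat \<Rightarrow>\<^sub>0 'b"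
    using that by (auto simp: in_keys_iff tr3_def subset_iff)
  from this[of f] this[of "mat_transpose f"] show ?thesis by auto
qed

text \<open>Transposition reverses products provided that coefficients and semigroup elements are
  multiplied in the opposite order as well; this exchanges left-handed and right-handed
  hypotheses.\<close>

lemma (in mult_mod) mat_conv_mat_transpose:
  "mat_transpose (mat_conv mul C m f g) = mat_conv (flip mul) C (flip m) (mat_transpose g) (mat_transpose f)"
proof (rule poly_mapping_eqI)
  fix z :: "nat \<times> 'b \<times> nat"
  interpret flip: mult_mod "flip mul" I by (rule mult_mod_flip) unfold_locales
  have k: "keys (mat_transpose h) = tr3 ` keys h" for h :: "nat \<times> 'b \<times> nat \<Rightarrow>\<^sub>0 'a"
  proof (rule Set.set_eqI)
    fix p
    have "p \<in> keys (mat_transpose h) \<longleftrightarrow> tr3 p \<in> keys h" by (simp add: in_keys_iff)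
    also have "\<dots> \<longleftrightarrow> p \<in> tr3 ` keys h" by (metis (no_types, lifting) image_iff tr3_tr3)
    finally show "p \<in> keys (mat_transpose h) \<longleftrightarrow> p \<in> tr3 ` keys h" .
  qed
  have t: "triple_op C (flip m) (tr3 q) (tr3 p) = Some z \<longleftrightarrow> triple_op C m p q = Some (tr3 z)" for p q
    by (cases p; cases q; cases z) (auto simp: triple_op_def tr3_def)
  have "lookup (mat_conv (flip mul) C (flip m) (mat_transpose g) (mat_transpose f)) z =
    (\<Sum>q\<in>keys g. \<Sum>p\<in>keys f. lookup f p \<cdot> lookup g q when triple_op C m p q = Some (tr3 z))"
    unfolding flip.lookup_conv[OF finite_keys finite_keys subset_refl subset_refl] k
    by (simp add: sum.reindex inj_on_subset[OF inj_tr3] t)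
  also have "\<dots> = lookup (mat_transpose (mat_conv mul C m f g)) z"
    by (subst sum.swap) (simp add: lookup_conv[of "keys f" "keys g"])
  finally show "lookup (mat_transpose (mat_conv mul C m f g)) z =
    lookup (mat_conv (flip mul) C (flip m) (mat_transpose g) (mat_transpose f)) z" ..
qed

text \<open>Products are reversed, so the roles of \<open>u\<close> and \<open>v\<close> are
  exchanged.\<close>

lemma corner_pair_mat_transpose:
  assumes "mult_mod mul I" "semigroup_on C m"
    and "mult_mod.corner_pair (mat_conv mul C m) (coeffs_in I) e u v"
  shows "mult_mod.corner_pair (mat_conv (flip mul) C (flip m)) (coeffs_in I)
    (mat_transpose e) (mat_transpose v) (mat_transpose u)"
proof -
  interpret M: mult_mod "mat_conv mul C m" "coeffs_in I"
    by (rule mult_mod_mat_conv[OF assms(1,2)])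
  interpret M': mult_mod "mat_conv (flip mul) C (flip m)" "coeffs_in I"
    by (rule mult_mod_mat_conv[OF mult_mod_flip[OF assms(1)] semigroup_on_flip[OF assms(2)]])
  show ?thesis
    using assms(3)
    unfolding M'.corner_pair_def M.corner_pair_def M'.cong_mod_def M.cong_mod_def
    by (simp flip: mult_mod.mat_conv_mat_transpose[OF assms(1)] mat_transpose_diff)
qed

lemma sfin_mod_flip:
  assumes "mult_mod mul I" "semigroup_on C m" "sfin_mod mul I C m"
  shows "sfin_mod (flip mul) I C (flip m)"
  unfolding sfin_mod_def
proof (intro allI impI)
  fix n e u v
  assume k: "keys e \<subseteq> triples n C" "keys u \<subseteq> triples n C" "keys v \<subseteq> triples n C"
    and c: "mult_mod.corner_pair (mat_conv (flip mul) C (flip m)) (coeffs_in I) e u v"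
  have "mult_mod.corner_pair (mat_conv mul C m) (coeffs_in I) (mat_transpose e) (mat_transpose v) (mat_transpose u)"
    using corner_pair_mat_transpose[OF mult_mod_flip[OF assms(1)] semigroup_on_flip[OF assms(2)] c] .
  then have "mat_conv mul C m (mat_transpose u) (mat_transpose v) - mat_transpose e \<in> coeffs_in I"
    using assms(3) k unfolding sfin_mod_def by (simp add: keys_mat_transpose)
  then have "mat_transpose (mat_conv mul C m (mat_transpose u) (mat_transpose v) - mat_transpose e) \<in> coeffs_in I"
    by simp
  then show "mat_conv (flip mul) C (flip m) v u - e \<in> coeffs_in I"
    by (simp add: mat_transpose_diff mult_mod.mat_conv_mat_transpose[OF assms(1)])
qed


subsection \<open>Stable semigroups\<close>

context semigroup_on
begin

definition leL where "leL s t \<longleftrightarrow> s = t \<or> (\<exists>a\<in>C. s = m a t)"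
definition leR where "leR s t \<longleftrightarrow> s = t \<or> (\<exists>a\<in>C. s = m t a)"
text \<open>Splitting the two sides into two steps avoids a case distinction on the adjoined
  identity; that the order of the steps is immaterial is the content of the swap lemmas.\<close>

definition leJ where "leJ s t \<longleftrightarrow> (\<exists>x\<in>C. leL x t \<and> leR s x)"

lemma leL_refl [simp]: "leL s s" by (simp add: leL_def)
lemma leR_refl [simp]: "leR s s" by (simp add: leR_def)

lemma leL_trans: "s \<in> C \<Longrightarrow> t \<in> C \<Longrightarrow> u \<in> C \<Longrightarrow> leL s t \<Longrightarrow> leL t u \<Longrightarrow> leL s u"
  unfolding leL_def by (metis assoc closed)

lemma leR_trans: "s \<in> C \<Longrightarrow> t \<in> C \<Longrightarrow> u \<in> C \<Longrightarrow> leR s t \<Longrightarrow> leR t u \<Longrightarrow> leR s u"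
  unfolding leR_def by (metis assoc closed)

lemma leL_mult [simp]: "a \<in> C \<Longrightarrow> leL (m a s) s"
  by (auto simp: leL_def)

lemma leR_mult [simp]: "a \<in> C \<Longrightarrow> leR (m s a) s"
  by (auto simp: leR_def)

lemma leL_mult_right: "s \<in> C \<Longrightarrow> t \<in> C \<Longrightarrow> x \<in> C \<Longrightarrow> leL s t \<Longrightarrow> leL (m s x) (m t x)"
  unfolding leL_def by (metis assoc)

lemma leR_mult_left: "s \<in> C \<Longrightarrow> t \<in> C \<Longrightarrow> x \<in> C \<Longrightarrow> leR s t \<Longrightarrow> leR (m x s) (m x t)"
  unfolding leR_def by (metis assoc)

lemma leL_leJ: "s \<in> C \<Longrightarrow> leL s t \<Longrightarrow> leJ s t"
  unfolding leJ_def using leR_refl by blast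

lemma leR_leJ: "t \<in> C \<Longrightarrow> leR s t \<Longrightarrow> leJ s t"
  unfolding leJ_def using leL_refl by blast

lemma leR_leL_swap:
  assumes "s \<in> C" "x \<in> C" "t \<in> C" "leR s x" "leL x t"
  shows "\<exists>y\<in>C. leL s y \<and> leR y t"
proof (cases "x = t")
  case True
  then show ?thesis using assms by (intro bexI[of _ s]) auto
next
  case False
  then obtain a where a: "a \<in> C" "x = m a t" using assms(5) by (auto simp: leL_def)
  show ?thesis
  proof (cases "s = x")
    case True
    then show ?thesis using assms by (intro bexI[of _ t]) auto
  next
    case False
    then obtain b where b: "b \<in> C" "s = m x b" using assms(4) by (auto simp: leR_def)
    then have "s = m a (m t b)" using a assms by (simp add: assoc)
    then show ?thesis using a b assms closed by (intro bexI[of _ "m t b"]) auto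
  qed
qed

lemma leL_leR_swap:
  assumes "s \<in> C" "x \<in> C" "t \<in> C" "leL s x" "leR x t"
  shows "\<exists>y\<in>C. leR s y \<and> leL y t"
proof (cases "x = t")
  case True
  then show ?thesis using assms by (intro bexI[of _ s]) auto
next
  case False
  then obtain a where a: "a \<in> C" "x = m t a" using assms(5) by (auto simp: leR_def)
  show ?thesis
  proof (cases "s = x")
    case True
    then show ?thesis using assms by (intro bexI[of _ t]) auto
  next
    case False
    then obtain b where b: "b \<in> C" "s = m b x" using assms(4) by (auto simp: leL_def)
    then have "s = m (m b t) a" using a assms by (simp add: assoc)
    then show ?thesis using a b assms closed by (intro bexI[of _ "m b t"]) auto
  qed
qed

lemma leJ_trans:
  assumes C: "s \<in> C" "t \<in> C" "u \<in> C" and "leJ s t" "leJ t u"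
  shows "leJ s u"
proof -
  obtain x where x: "x \<in> C" "leL x t" "leR s x" using assms by (auto simp: leJ_def)
  obtain y where y: "y \<in> C" "leL y u" "leR t y" using assms by (auto simp: leJ_def)
  obtain z where z: "z \<in> C" "leR x z" "leL z y"
    using leL_leR_swap[OF x(1) C(2) y(1) x(2) y(3)] by blast
  show ?thesis
    unfolding leJ_def using leL_trans[OF z(1) y(1) C(3) z(3) y(2)] leR_trans[OF C(1) x(1) z(1) x(3) z(2)] z(1)
    by blast
qed

lemma leJ_flip:
  assumes "s \<in> C" "t \<in> C"
  shows "semigroup_on.leJ C (flip m) s t \<longleftrightarrow> leJ s t"
proof -
  interpret op: semigroup_on C "flip m" by (rule semigroup_on_flip) unfold_locales
  have "op.leL = leR" "op.leR = leL"
    by (auto simp: fun_eq_iff op.leL_def leR_def op.leR_def leL_def)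
  then show ?thesis
    unfolding op.leJ_def leJ_def using leR_leL_swap leL_leR_swap assms by metis
qed

definition eqL where "eqL s t \<longleftrightarrow> leL s t \<and> leL t s"
definition eqR where "eqR s t \<longleftrightarrow> leR s t \<and> leR t s"
definition eqJ where "eqJ s t \<longleftrightarrow> leJ s t \<and> leJ t s"

definition H_class where "H_class e = {h \<in> C. eqL h e \<and> eqR h e}"

lemma idempotent_leR: "e \<in> C \<Longrightarrow> m e e = e \<Longrightarrow> x \<in> C \<Longrightarrow> leR x e \<Longrightarrow> m e x = x"
  unfolding leR_def by (metis assoc)

lemma idempotent_leL: "e \<in> C \<Longrightarrow> m e e = e \<Longrightarrow> x \<in> C \<Longrightarrow> leL x e \<Longrightarrow> m x e = x"
  unfolding leL_def by (metis assoc)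

lemma H_classD:
  assumes "e \<in> C" "m e e = e" "h \<in> H_class e"
  shows "h \<in> C" "leL h e" "leL e h" "leR h e" "leR e h" "m e h = h" "m h e = h"
  using assms(3) idempotent_leR[OF assms(1,2)] idempotent_leL[OF assms(1,2)]
  by (auto simp: H_class_def eqL_def eqR_def)

lemma H_class_closed:
  assumes e: "e \<in> C" "m e e = e" and g: "g \<in> H_class e" and h: "h \<in> H_class e"
  shows "m g h \<in> H_class e"
proof -
  note g = H_classD[OF e g] and h = H_classD[OF e h]
  have C: "m g h \<in> C" using g h closed by blast
  have "leL (m g h) e" using leL_trans[OF C h(1) e(1) leL_mult[OF g(1)] h(2)] .
  moreover have "leL h (m g h)"
    using leL_mult_right[OF e(1) g(1) h(1) g(3)] h(6) by simp
  then have "leL e (m g h)" using leL_trans[OF e(1) h(1) C h(3)] by blast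
  moreover have "leR (m g h) e" using leR_trans[OF C g(1) e(1) leR_mult[OF h(1)] g(4)] .
  moreover have "leR g (m g h)"
    using leR_mult_left[OF e(1) h(1) g(1) h(5)] g(7) by simp
  then have "leR e (m g h)" using leR_trans[OF e(1) g(1) C g(5)] by blast
  ultimately show ?thesis using C by (simp add: H_class_def eqL_def eqR_def)
qed

text \<open>Representatives, inside the R-class of \<open>e\<close>, of the L-classes that it meets.
  In a stable semigroup these are all the L-classes in the J-class of \<open>e\<close>.\<close>

definition L_transversal :: "'s \<Rightarrow> nat \<Rightarrow> (nat \<Rightarrow> 's) \<Rightarrow> bool" where
  "L_transversal e q r \<longleftrightarrow> (\<forall>b<q. r b \<in> C \<and> eqR (r b) e) \<and>
     (\<forall>b<q. \<forall>c<q. eqL (r b) (r c) \<longrightarrow> b = c) \<and>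
     (\<forall>y\<in>C. eqR y e \<longrightarrow> (\<exists>b<q. eqL y (r b)))"

definition R_transversal :: "'s \<Rightarrow> nat \<Rightarrow> (nat \<Rightarrow> 's) \<Rightarrow> bool" where
  "R_transversal e q r \<longleftrightarrow> (\<forall>b<q. r b \<in> C \<and> eqL (r b) e) \<and>
     (\<forall>b<q. \<forall>c<q. eqR (r b) (r c) \<longrightarrow> b = c) \<and>
     (\<forall>y\<in>C. eqL y e \<longrightarrow> (\<exists>b<q. eqR y (r b)))"

end

locale stable_on = semigroup_on C m for C :: "'s set" and m +
  assumes stable_R: "s \<in> C \<Longrightarrow> t \<in> C \<Longrightarrow> leJ s (m s t) \<Longrightarrow> leR s (m s t)"
    and stable_L: "s \<in> C \<Longrightarrow> t \<in> C \<Longrightarrow> leJ s (m t s) \<Longrightarrow> leL s (m t s)"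
begin

lemma flip_green:
  "semigroup_on.leL C (flip m) = leR" "semigroup_on.leR C (flip m) = leL"
  "semigroup_on.eqL C (flip m) = eqR" "semigroup_on.eqR C (flip m) = eqL"
  "semigroup_on.H_class C (flip m) = H_class"
  "semigroup_on.L_transversal C (flip m) = R_transversal"
proof -
  interpret op: semigroup_on C "flip m" by (rule semigroup_on_flip) unfold_locales
  show 1: "op.leL = leR" "op.leR = leL"
    by (auto simp: fun_eq_iff op.leL_def leR_def op.leR_def leL_def)
  show 2: "op.eqL = eqR" "op.eqR = eqL"
    by (auto simp: fun_eq_iff op.eqL_def eqR_def op.eqR_def eqL_def 1)
  show "op.H_class = H_class" by (auto simp: op.H_class_def H_class_def 2)
  show "op.L_transversal = R_transversal"
    by (intro ext) (simp only: op.L_transversal_def R_transversal_def 2)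
qed

lemma stable_on_flip: "stable_on C (flip m)"
proof -
  interpret op: semigroup_on C "flip m" by (rule semigroup_on_flip) unfold_locales
  show ?thesis
    by unfold_locales (use stable_L stable_R in \<open>auto simp: leJ_flip flip_green closed\<close>)
qed

lemma stable_leR: "s \<in> C \<Longrightarrow> t \<in> C \<Longrightarrow> leR t s \<Longrightarrow> leJ s t \<Longrightarrow> leR s t"
  using stable_R by (auto simp: leR_def[of t s])

lemma stable_leL: "s \<in> C \<Longrightarrow> t \<in> C \<Longrightarrow> leL t s \<Longrightarrow> leJ s t \<Longrightarrow> leL s t"
  using stable_L by (auto simp: leL_def[of t s])

text \<open>Stability gives \<open>s = m s w\<close> with \<open>w\<close> below \<open>t\<close> in
  the R-order, and the hypothesis on \<open>t\<close> keeps \<open>w\<close> in the J-class of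
  \<open>s\<close>. Stability on the other side puts \<open>w\<close> into S^1 s, so
  \<open>w\<close> inherits the absorption of \<open>w\<close> on the right.\<close>

lemma ex_idempotent:
  assumes C: "s \<in> C" "t \<in> C" and J: "leJ s (m s t)" "leJ t (m s t)"
  shows "\<exists>w\<in>C. m w w = w \<and> eqJ w s"
proof -
  have "leR s (m s t)" using stable_R C J by blast
  then obtain w where w: "w \<in> C" "s = m s w" "leR w t"
    unfolding leR_def by (metis C assoc closed)
  have sw: "leJ s w" using leL_leJ[of s w] C w leL_mult[of s w] by simp
  have wt: "leJ w t" using leR_leJ[OF C(2) w(3)] .
  have "leJ t s" using leJ_trans[OF C(2) closed[OF C] C(1) J(2) leR_leJ[OF C(1) leR_mult[OF C(2)]]] .
  then have ws: "leJ w s" using leJ_trans[OF w(1) C(2) C(1) wt] by blast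
  have "leL w (m s w)" using stable_L[OF w(1) C(1)] ws w(2) by simp
  then have "leL w s" using w(2) by simp
  then have "m w w = w" unfolding leL_def by (metis C assoc w(1,2))
  then show ?thesis using w ws sw by (auto simp: eqJ_def)
qed

text \<open>This is the coincidence of J and D in a stable semigroup: the intermediate element of
  the J-order is squeezed into the J-class, where stability upgrades both inequalities to
  equivalences.\<close>

lemma eqJ_decompose:
  assumes C: "s \<in> C" "e \<in> C" and J: "eqJ s e"
  shows "\<exists>x\<in>C. eqL s x \<and> eqR x e"
proof -
  obtain x where x: "x \<in> C" "leL x s" "leR e x"
    using J by (auto simp: eqJ_def leJ_def)
  have xs: "leJ x s" using x C leL_leJ by blast
  have ex: "leJ e x" using x C leR_leJ by blast
  have se: "leJ s e" "leJ e s" using J by (auto simp: eqJ_def)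
  have "leL s x" using stable_leL[OF C(1) x(1,2)] leJ_trans[OF C(1,2) x(1) se(1) ex] by blast
  moreover have "leR x e" using stable_leR[OF x(1) C(2) x(3)] leJ_trans[OF x(1) C(1,2) xs se(1)] by blast
  ultimately show ?thesis using x by (auto simp: eqL_def eqR_def)
qed

lemma eqR_inverse:
  assumes "e \<in> C" "m e e = e" "x \<in> C" "eqR x e"
  shows "\<exists>b\<in>C. m x b = e"
  using assms unfolding eqR_def leR_def by metis

text \<open>Choose x with s L x R e and write s = z x, x = a s, x b = e. Then \<open>m b a\<close>
  is an inner inverse, since s b a s = z x b x = z e x = s. This lets a hypothesis on regular
  J-classes be applied to the class of any idempotent.\<close>

lemma eqJ_idempotent_regular:
  assumes C: "s \<in> C" "e \<in> C" and e: "m e e = e" and J: "eqJ s e"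
  shows "\<exists>t\<in>C. m (m s t) s = s"
proof -
  obtain x where x: "x \<in> C" "eqL s x" "eqR x e" using eqJ_decompose[OF C J] by blast
  obtain b where b: "b \<in> C" "m x b = e" using eqR_inverse[OF C(2) e x(1,3)] by blast
  have ex: "m e x = x" using idempotent_leR[OF C(2) e x(1)] x(3) by (simp add: eqR_def)
  show ?thesis
  proof (cases "s = x")
    case True
    then show ?thesis using b ex by metis
  next
    case False
    then obtain z a where za: "z \<in> C" "a \<in> C" "s = m z x" "x = m a s"
      using x(2) unfolding eqL_def leL_def by metis
    have "m (m s (m b a)) s = m s (m b (m a s))"
      using za(1,2) b(1) C by (simp add: assoc closed)
    also have "\<dots> = m (m z x) (m b x)" by (simp flip: za(3,4))
    also have "\<dots> = m z (m (m x b) x)" using za(1) x(1) b(1) by (simp add: assoc closed)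
    also have "\<dots> = s" using b(2) ex za(3) by simp
    finally have "m (m s (m b a)) s = s" .
    then show ?thesis using closed b za by blast
  qed
qed

end


subsection \<open>Schuetzenberger representations\<close>

locale schuetzenberger = stable_on C m for C :: "'s set" and m +
  fixes e :: 's and q :: nat and r :: "nat \<Rightarrow> 's"
  assumes e: "e \<in> C" "m e e = e" and transversal: "L_transversal e q r"
begin

abbreviation "H \<equiv> H_class e"

lemmas H = H_classD[OF e]

lemma r: "b < q \<Longrightarrow> r b \<in> C" "b < q \<Longrightarrow> leR (r b) e" "b < q \<Longrightarrow> leR e (r b)" "b < q \<Longrightarrow> m e (r b) = r b"
  using transversal idempotent_leR[OF e]
  by (auto simp: L_transversal_def eqR_def)

lemmas H_closed = H_class_closed[OF e]

lemma semigroup_on_H: "semigroup_on H m"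
  by unfold_locales (use H_closed H(1) assoc in auto)

lemma r_inverse:
  assumes "b < q"
  shows "\<exists>x\<in>C. m (r b) x = e"
  using eqR_inverse[OF e r(1)[OF assms]] r[OF assms] by (simp add: eqR_def)

lemma H_r_eqR:
  assumes "g \<in> H" "b < q"
  shows "eqR (m g (r b)) e"
proof -
  note g = H[OF assms(1)] and b = r[OF assms(2)]
  have C: "m g (r b) \<in> C" using g b closed by blast
  have "leR g (m g (r b))"
    using leR_mult_left[OF e(1) b(1) g(1) b(3)] g(7) by simp
  then have "leR e (m g (r b))" using leR_trans[OF e(1) g(1) C g(5)] by blast
  moreover have "leR (m g (r b)) e" using leR_trans[OF C g(1) e(1) leR_mult[OF b(1)] g(4)] .
  ultimately show ?thesis by (simp add: eqR_def)
qed

text \<open>Green's lemma: if \<open>m (r b) x = e\<close>, right multiplication by \<open>x\<close>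
  carries the L-class of \<open>r b\<close> into that of \<open>e\<close> and is undone by
  \<open>r b\<close>. Together with uniqueness, the R-class of \<open>e\<close> is a free left
  \<open>H\<close>-set with basis \<open>r\<close>.\<close>

lemma decompose:
  assumes y: "y \<in> C" "eqR y e"
  shows "\<exists>g\<in>H. \<exists>b<q. m g (r b) = y"
proof -
  obtain b where b: "b < q" "eqL y (r b)" using transversal y by (auto simp: L_transversal_def)
  obtain x where x: "x \<in> C" "m (r b) x = e" using r_inverse[OF b(1)] by blast
  note rb = r[OF b(1)]
  have gr: "m (m y x) (r b) = y"
  proof (cases "y = r b")
    case True
    then show ?thesis using x rb by simp
  next
    case False
    then obtain a where a: "a \<in> C" "y = m a (r b)" using b(2) by (auto simp: eqL_def leL_def)
    then have "m (m y x) (r b) = m a (m (m (r b) x) (r b))"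
      using x rb e(1) by (simp add: assoc closed)
    then show ?thesis using x a rb by simp
  qed
  have C: "m y x \<in> C" using y x closed by blast
  have "leR y (m y x)" using leR_mult[OF rb(1), of "m y x"] gr by simp
  then have "leR e (m y x)" using leR_trans[OF e(1) y(1) C] y(2) by (simp add: eqR_def)
  moreover have "leR (m y x) e"
    using leR_trans[OF C y(1) e(1) leR_mult[OF x(1)]] y(2) by (simp add: eqR_def)
  moreover have "leL (m y x) e" "leL e (m y x)"
    using leL_mult_right[OF y(1) rb(1) x(1)] leL_mult_right[OF rb(1) y(1) x(1)] b(2) x(2)
    by (simp_all add: eqL_def)
  ultimately have "m y x \<in> H" using C by (simp add: H_class_def eqL_def eqR_def)
  then show ?thesis using gr b(1) by blast
qed

text \<open>\<open>m g (r b)\<close> is L-equivalent to \<open>r b\<close>, so the transversal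
  determines \<open>b\<close>; a right multiplier taking \<open>r b\<close> to \<open>e\<close> then
  recovers \<open>g\<close>.\<close>

lemma decompose_unique:
  assumes "g \<in> H" "g' \<in> H" "b < q" "b' < q" and eq: "m g (r b) = m g' (r b')"
  shows "g = g' \<and> b = b'"
proof -
  have L: "eqL (r c) (m h (r c))" "m h (r c) \<in> C" if "h \<in> H" "c < q" for h c
    using leL_mult_right[OF e(1) H(1)[OF that(1)] r(1)[OF that(2)] H(3)[OF that(1)]]
      r[OF that(2)] H(1)[OF that(1)] closed
    by (auto simp: eqL_def)
  have "leL (r b) (r b')"
    using leL_trans[OF r(1)[OF assms(3)] L(2)[OF assms(1,3)] r(1)[OF assms(4)]]
      L(1)[OF assms(1,3)] L(1)[OF assms(2,4)] eq by (simp add: eqL_def)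
  moreover have "leL (r b') (r b)"
    using leL_trans[OF r(1)[OF assms(4)] L(2)[OF assms(2,4)] r(1)[OF assms(3)]]
      L(1)[OF assms(1,3)] L(1)[OF assms(2,4)] eq by (simp add: eqL_def)
  ultimately have bb: "b = b'" using transversal assms by (auto simp: L_transversal_def eqL_def)
  obtain x where x: "x \<in> C" "m (r b) x = e" using r_inverse[OF assms(3)] by blast
  have "h = m (m h (r b)) x" if "h \<in> H" for h
    using x r(1)[OF assms(3)] H[OF that] by (simp add: assoc)
  from this[OF assms(1)] this[OF assms(2)] eq bb show ?thesis by simp
qed

text \<open>Row \<open>b\<close> of the right Schuetzenberger matrix of \<open>s\<close>. It has at
  most one nonzero entry \<open>g\<close>, in the column \<open>c\<close> with r b s = g r c;
  \<open>None\<close> records that the product has left the R-class.\<close>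

definition rho :: "nat \<Rightarrow> 's \<Rightarrow> ('s \<times> nat) option" where
  "rho b s = (if b < q \<and> s \<in> C \<and> eqR (m (r b) s) e
     then Some (SOME gb. fst gb \<in> H \<and> snd gb < q \<and> m (fst gb) (r (snd gb)) = m (r b) s) else None)"

lemma rho_Some_iff:
  assumes "b < q" "s \<in> C"
  shows "rho b s = Some (g, c) \<longleftrightarrow> g \<in> H \<and> c < q \<and> m g (r c) = m (r b) s"
proof
  let ?P = "\<lambda>gb. fst gb \<in> H \<and> snd gb < q \<and> m (fst gb) (r (snd gb)) = m (r b) s"
  assume "rho b s = Some (g, c)"
  then have R: "eqR (m (r b) s) e" and eq: "(SOME gb. ?P gb) = (g, c)"
    by (auto simp: rho_def split: if_splits)
  have ex: "\<exists>gb. ?P gb" using decompose[OF closed[OF r(1)[OF assms(1)] assms(2)] R] by auto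
  have "?P (g, c)" by (rule back_subst[of ?P, OF someI_ex[OF ex] eq])
  then show "g \<in> H \<and> c < q \<and> m g (r c) = m (r b) s" by simp
next
  let ?P = "\<lambda>gb. fst gb \<in> H \<and> snd gb < q \<and> m (fst gb) (r (snd gb)) = m (r b) s"
  assume a: "g \<in> H \<and> c < q \<and> m g (r c) = m (r b) s"
  then have R: "eqR (m (r b) s) e" using H_r_eqR by metis
  define gb where "gb = (SOME gb. ?P gb)"
  have "?P gb" unfolding gb_def by (rule someI[of ?P "(g, c)"]) (use a in simp)
  then have "fst gb = g \<and> snd gb = c"
    using decompose_unique[of "fst gb" g "snd gb" c] a by (simp del: fst_conv)
  then have "gb = (g, c)" by (simp add: prod_eq_iff)
  then show "rho b s = Some (g, c)" using R assms by (simp add: rho_def gb_def)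
qed

lemma rho_eqR: "b < q \<Longrightarrow> s \<in> C \<Longrightarrow> rho b s \<noteq> None \<longleftrightarrow> eqR (m (r b) s) e"
  by (simp add: rho_def)

text \<open>By stability, a right multiple of \<open>r b\<close> that is still above
  \<open>e\<close> in the J-order cannot have dropped below the R-class.\<close>

lemma eqR_translate:
  assumes "b < q" "t \<in> C" "leJ e (m (r b) t)"
  shows "eqR (m (r b) t) e"
proof -
  note rb = r[OF assms(1)]
  have C: "m (r b) t \<in> C" using rb assms closed by blast
  have "leJ (r b) (m (r b) t)"
    using leJ_trans[OF rb(1) e(1) C leR_leJ[OF e(1) rb(2)] assms(3)] .
  then have "leR (r b) (m (r b) t)" using stable_R rb assms by blast
  then show ?thesis
    using leR_trans[OF e(1) rb(1) C rb(3)] leR_trans[OF C rb(1) e(1) leR_mult[OF assms(2)] rb(2)]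
    by (simp add: eqR_def)
qed

text \<open>Right multiplication only descends in the R-order, so a product that has left the
  R-class never returns; and \<open>m g (m (r c) t)\<close> is in the R-class of \<open>e\<close>
  only if \<open>m (r c) t\<close> is, by \<open>eqR_translate\<close>. In the remaining case the
  defining equations compose.\<close>

lemma rho_mult:
  assumes b: "b < q" and s: "s \<in> C" and t: "t \<in> C"
  shows "rho b (m s t) = (case rho b s of None \<Rightarrow> None | Some (g, c) \<Rightarrow>
    (case rho c t of None \<Rightarrow> None | Some (h, d) \<Rightarrow> Some (m g h, d)))"
proof (cases "rho b s")
  case None
  note rb = r[OF b]
  have "\<not> eqR (m (r b) (m s t)) e"
  proof
    assume R: "eqR (m (r b) (m s t)) e"
    have C: "m (r b) s \<in> C" "m (r b) (m s t) \<in> C" using closed rb s t by blast+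
    have "leR (m (r b) (m s t)) (m (r b) s)"
      using leR_mult[OF t, of "m (r b) s"] rb s t by (simp add: assoc)
    then have "leR e (m (r b) s)" using leR_trans[OF e(1) C(2,1)] R by (simp add: eqR_def)
    moreover have "leR (m (r b) s) e" using leR_trans[OF C(1) rb(1) e(1) leR_mult[OF s] rb(2)] .
    ultimately have "eqR (m (r b) s) e" by (simp add: eqR_def)
    then show False using None rho_eqR[OF b s] by blast
  qed
  then have "rho b (m s t) = None" using rho_eqR[OF b closed[OF s t]] by blast
  then show ?thesis using None by simp
next
  case (Some gc)
  obtain g c where gc: "gc = (g, c)" by (cases gc)
  have g: "g \<in> H" "c < q" "m g (r c) = m (r b) s" using Some gc rho_Some_iff[OF b s] by auto
  note gH = H[OF g(1)] and rc = r[OF g(2)] and rb = r[OF b]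
  have st: "m (r b) (m s t) = m g (m (r c) t)"
    using g(3) gH rc rb s t by (metis assoc)
  show ?thesis
  proof (cases "rho c t")
    case None
    have "\<not> eqR (m (r b) (m s t)) e"
    proof
      assume R: "eqR (m (r b) (m s t)) e"
      have C: "m (r c) t \<in> C" "m g (m (r c) t) \<in> C" using closed rc gH t by blast+
      have "leJ e (m g (m (r c) t))" using R C leR_leJ by (simp add: eqR_def st)
      then have "leJ e (m (r c) t)"
        using leJ_trans[OF e(1) C(2,1)] leL_leJ[OF C(2) leL_mult[OF gH(1)]] by blast
      then show False using eqR_translate[OF g(2) t] None rho_eqR[OF g(2) t] by blast
    qed
    then have "rho b (m s t) = None" using rho_eqR[OF b closed[OF s t]] by blast
    then show ?thesis using None Some gc by simp
  next
    case (Some hd)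
    obtain h d where hd: "hd = (h, d)" by (cases hd)
    have h: "h \<in> H" "d < q" "m h (r d) = m (r c) t" using Some hd rho_Some_iff[OF g(2) t] by auto
    have "m (m g h) (r d) = m (r b) (m s t)"
      using st h gH H(1)[OF h(1)] r(1)[OF h(2)] by (simp add: assoc)
    then have "rho b (m s t) = Some (m g h, d)"
      using rho_Some_iff[OF b closed[OF s t]] H_closed[OF g(1) h(1)] h(2) by blast
    then show ?thesis using Some \<open>rho b s = _\<close> gc hd by simp
  qed
qed

definition rho_term :: "nat \<Rightarrow> nat \<times> 's \<times> nat \<Rightarrow> 'f \<Rightarrow> (nat \<times> 's \<times> nat \<Rightarrow>\<^sub>0 'f::ab_group_add)" where
  "rho_term b p a = (case p of (i, s, j) \<Rightarrow>
     (case rho b s of None \<Rightarrow> 0 | Some (g, c) \<Rightarrow> single (i * q + b, g, j * q + c) a))"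

text \<open>Each entry of an n by n matrix is replaced by its q by q Schuetzenberger matrix;
  \<open>i * q + b\<close> numbers position \<open>b\<close> of block \<open>i\<close>.\<close>

definition phi :: "(nat \<times> 's \<times> nat \<Rightarrow>\<^sub>0 'f) \<Rightarrow> (nat \<times> 's \<times> nat \<Rightarrow>\<^sub>0 'f::ab_group_add)" where
  "phi = additive_ext (\<lambda>p a. \<Sum>b<q. rho_term b p a)"

lemma rho_term_add: "rho_term b p (a + a') = rho_term b p a + rho_term b p a'"
  by (auto simp: rho_term_def single_add split: prod.split option.split)

lemma phi_add: "phi (f + g) = phi f + phi g"
  unfolding phi_def by (rule additive_ext_add) (simp add: rho_term_add sum.distrib)

lemma phi_0 [simp]: "phi 0 = 0"
  by (simp add: phi_def)

lemma phi_diff: "phi (f - g) = phi f - phi g"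
  using phi_add[of "f - g" g] by (simp add: eq_diff_eq)

lemma phi_single: "phi (single p a) = (\<Sum>b<q. rho_term b p a)"
  unfolding phi_def
  by (rule additive_ext_single) (auto simp: rho_term_def intro!: sum.neutral split: option.split)

lemma index_eq_iff: "b < q \<Longrightarrow> c < q \<Longrightarrow> i * q + b = j * q + c \<longleftrightarrow> i = j \<and> b = c"
  by (metis add.commute div_mult_self3 mod_mult_self3 div_eq_0_iff add_0_right add_cancel_left_right
      mod_less div_less not_less_zero)

lemma lookup_rho_term:
  assumes "b < q" "c < q" "b' < q"
  shows "lookup (rho_term b' (i', s, j') a) (i * q + b, g, j * q + c) =
    (if b' = b then (a when i' = i \<and> j' = j \<and> rho b s = Some (g, c)) else 0)"
proof (cases "rho b' s")
  case (Some hd)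
  then obtain h d where hd: "rho b' s = Some (h, d)" by (cases hd) auto
  then have "s \<in> C" by (simp add: rho_def split: if_splits)
  then have "d < q" using rho_Some_iff[OF assms(3)] hd by blast
  then show ?thesis
    using assms hd by (auto simp: rho_term_def lookup_single when_def index_eq_iff)
qed (auto simp: rho_term_def)

lemma lookup_phi:
  assumes "b < q" "c < q"
  shows "lookup (phi f) (i * q + b, g, j * q + c) =
    (\<Sum>(i', s, j')\<in>keys f. lookup f (i', s, j') when i' = i \<and> j' = j \<and> rho b s = Some (g, c))"
  unfolding phi_def additive_ext_def lookup_sum
proof (intro sum.cong refl)
  fix p assume "p \<in> keys f"
  obtain i' s j' where p: "p = (i', s, j')" by (cases p)
  show "(\<Sum>b'<q. lookup (rho_term b' p (lookup f p)) (i * q + b, g, j * q + c)) =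
    (case p of (i', s, j') \<Rightarrow> lookup f (i', s, j') when i' = i \<and> j' = j \<and> rho b s = Some (g, c))"
    using assms by (simp add: p lookup_rho_term)
qed

lemma keys_phi:
  assumes "keys f \<subseteq> triples n C"
  shows "keys (phi f) \<subseteq> triples (n * q) H"
proof -
  have "keys (rho_term b p a) \<subseteq> triples (n * q) H" if "b < q" "p \<in> triples n C" for b p and a :: 'a
  proof -
    obtain i s j where p_eq: "p = (i, s, j)" by (cases p)
    with that have p: "p = (i, s, j)" "i < n" "j < n" "s \<in> C" by auto
    have bound: "k * q + c < n * q" if "k < n" "c < q" for k c
    proof -
      have "k * q + c < (k + 1) * q" using that by simp
      also have "\<dots> \<le> n * q" using that by (intro mult_le_mono1) simp
      finally show ?thesis .
    qed
    show ?thesis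
      using p that bound rho_Some_iff[OF that(1) p(4)]
      by (auto simp: rho_term_def split: option.split)
  qed
  then have "keys (\<Sum>b<q. rho_term b p (lookup f p)) \<subseteq> triples (n * q) H" if "p \<in> keys f" for p
    using that assms by (intro order_trans[OF Poly_Mapping.keys_sum]) blast
  then show ?thesis
    unfolding phi_def additive_ext_def by (intro order_trans[OF Poly_Mapping.keys_sum]) blast
qed

end

context mult_mod
begin

text \<open>Row \<open>b\<close> of the first factor has one entry at most, so a single row of the
  second factor contributes and the matrix product reduces to \<open>rho_mult\<close>.\<close>

lemma phi_conv:
  assumes "schuetzenberger C m e q r"
    and k: "keys f \<subseteq> triples n C" "keys g \<subseteq> triples n C"
  shows "schuetzenberger.phi C m e q r (mat_conv mul C m f g) =
    mat_conv mul (semigroup_on.H_class C m e) m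
      (schuetzenberger.phi C m e q r f) (schuetzenberger.phi C m e q r g)"
proof -
  interpret schuetzenberger C m e q r by (rule assms(1))
  show ?thesis
  proof (rule conv_hom[where \<phi> = phi and \<psi> = phi and \<theta> = phi, OF _ _ _ _ k])
    fix p p' a a' assume pp': "p \<in> triples n C" "p' \<in> triples n C"
    then obtain i s j k t l where p: "p = (i, s, j)" "s \<in> C" "p' = (k, t, l)" "t \<in> C" by auto
    let ?cv = "mat_conv mul H m"
    have 1: "(\<Sum>c<q. ?cv (rho_term b p a) (rho_term c p' a')) =
        (if j = k then rho_term b (i, m s t, l) (a \<cdot> a') else 0)" if b: "b < q" for b
    proof (cases "rho b s")
      case None
      then show ?thesis by (simp add: rho_term_def p rho_mult[OF b p(2,4)])
    next
      case (Some gd)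
      then obtain g d where gd: "rho b s = Some (g, d)" by (cases gd) auto
      then have d: "d < q" "g \<in> H" using rho_Some_iff[OF b p(2)] by auto
      have "?cv (rho_term b p a) (rho_term c p' a') =
          (if c = d then (if j = k then rho_term b (i, m s t, l) (a \<cdot> a') else 0) else 0)" if c: "c < q" for c
      proof (cases "rho c t")
        case None
        then show ?thesis by (auto simp: rho_term_def p rho_mult[OF b p(2,4)] gd)
      next
        case (Some hd')
        then obtain h d' where hd: "rho c t = Some (h, d')" by (cases hd') auto
        then have h: "h \<in> H" using rho_Some_iff[OF c p(4)] by auto
        have "?cv (rho_term b p a) (rho_term c p' a') =
          (if j = k \<and> d = c then single (i * q + b, m g h, l * q + d') (a \<cdot> a') else 0)"
          using h d c index_eq_iff[OF d(1) c, of j k]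
          by (simp add: rho_term_def p gd hd conv_single triple_op_def)
        then show ?thesis
          using hd gd by (cases "c = d"; cases "j = k") (simp_all add: rho_term_def p rho_mult[OF b p(2,4)])
      qed
      then show ?thesis using d by simp
    qed
    have "?cv (phi (single p a)) (phi (single p' a')) =
        (\<Sum>b<q. if j = k then rho_term b (i, m s t, l) (a \<cdot> a') else 0)"
      unfolding phi_single conv_sum_l unfolding conv_sum_r by (simp add: 1)
    also have "\<dots> = phi (mat_conv mul C m (single p a) (single p' a'))"
      using p by (auto simp: conv_single triple_op_def phi_single)
    finally show "phi (mat_conv mul C m (single p a) (single p' a')) =
      ?cv (phi (single p a)) (phi (single p' a'))" ..
  qed (auto simp: phi_add)
qed

end


text \<open>
  If \<open>f \<equiv> f * f\<close> is killed by \<open>phi\<close>, then so is its top \<open>\<J>\<close>-part: in the Rees coordinates of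
  the \<open>\<J>\<close>-class, \<open>phi\<close> is \<open>X \<mapsto> PX\<close> and the product is \<open>XPX\<close>.
\<close>

lemma (in mult_mod) vanish_on_J_class:
  fixes C :: "'s set"
  assumes sch: "schuetzenberger C m e q r"
    and kf: "keys f \<subseteq> triples n C"
    and idem: "mat_conv mul C m f f - f \<in> coeffs_in I"
    and zero: "schuetzenberger.phi C m e q r f \<in> coeffs_in I"
    and max: "\<And>i s j. lookup f (i, s, j) \<notin> I \<Longrightarrow> semigroup_on.leJ C m e s \<Longrightarrow> semigroup_on.leJ C m s e"
    and x: "x \<in> C" "semigroup_on.leJ C m e x"
  shows "lookup f (i, x, j) \<in> I"
proof -
  interpret schuetzenberger C m e q r by (rule sch)
  let ?c = "\<lambda>p p'. triple_op C m p p' = Some (i, x, j)"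
  \<comment> \<open>For a fixed left factor, the matching right coefficients are grouped so that
    each group sums to an entry of \<open>phi f\<close>, that is, of PX; all of these lie in
    \<open>I\<close>.\<close>
  have inner: "(\<Sum>p'\<in>{p' \<in> keys f. ?c p p'}. lookup f p') \<in> I"
    if p: "p \<in> keys f" "lookup f p \<notin> I" for p
  proof (cases "{p' \<in> keys f. ?c p p'} = {}")
    case False
    then obtain p' where p': "p' \<in> keys f" "?c p p'" by blast
    obtain k s t0 where s: "p = (i, s, k)" "p' = (k, t0, j)" "m s t0 = x"
      using p'(2) by (cases p; cases p') (auto simp: triple_op_def split: if_splits)
    have sC: "s \<in> C" "t0 \<in> C" using kf p s p' by auto
    have "leJ x s" using leR_leJ[OF sC(1) leR_mult[OF sC(2)]] s(3) by simp
    then have es: "leJ e s" using leJ_trans[OF e(1) x(1) sC(1) x(2)] by blast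
    \<comment> \<open>Maximality places \<open>s\<close> in the J-class of \<open>e\<close>, so
      \<open>s\<close> is L-equivalent to some representative \<open>r b\<close>.\<close>
    moreover have "leJ s e" using max[of i s k] p(2) es s(1) by simp
    ultimately obtain y where y: "y \<in> C" "eqL s y" "eqR y e"
      using eqJ_decompose[OF sC(1) e(1)] by (auto simp: eqJ_def)
    obtain b where b: "b < q" "eqL y (r b)" using transversal y by (auto simp: L_transversal_def)
    note rb = r[OF b(1)]
    have "leL s (r b)" using leL_trans[OF sC(1) y(1) rb(1)] y(2) b(2) by (simp add: eqL_def)
    \<comment> \<open>Left multiplication carrying \<open>r b\<close> to \<open>s\<close>, or the
      identity map when they coincide; through it \<open>m s t\<close> depends only on
      \<open>m (r b) t\<close>.\<close>
    then obtain A where A: "\<And>z. z \<in> C \<Longrightarrow> m s z = A (m (r b) z)" "\<And>z. z \<in> C \<Longrightarrow> leL (A z) z"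
    proof -
      assume that: "\<And>A. (\<And>z. z \<in> C \<Longrightarrow> m s z = A (m (r b) z)) \<Longrightarrow> (\<And>z. z \<in> C \<Longrightarrow> leL (A z) z) \<Longrightarrow> thesis"
      show thesis
      proof (cases "s = r b")
        case True
        then show ?thesis by (intro that[of "\<lambda>z. z"]) auto
      next
        case False
        then obtain a where "a \<in> C" "s = m a (r b)" using \<open>leL s (r b)\<close> by (auto simp: leL_def)
        then show ?thesis using rb by (intro that[of "m a"]) (auto simp: assoc)
      qed
    qed
    let ?S = "{p' \<in> keys f. ?c p p'}"
    define \<rho> where "\<rho> = (\<lambda>(k' :: nat, t, j' :: nat). rho b t)"
    have mem: "(k', t, j') \<in> ?S \<longleftrightarrow> (k', t, j') \<in> keys f \<and> k' = k \<and> j' = j \<and> m s t = x" for k' t j'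
      using kf sC by (auto simp: s triple_op_def)
    have rho_some: "\<exists>g c. rho b t = Some (g, c)" if "(k', t, j') \<in> ?S" for k' t j'
    proof -
      have t: "t \<in> C" "m s t = x" using that kf mem by auto
      have C: "m (r b) t \<in> C" using rb t closed by blast
      have "leL x (m (r b) t)" using A t C by metis
      then have "leJ e (m (r b) t)"
        using leJ_trans[OF e(1) x(1) C x(2)] leL_leJ[OF x(1)] by blast
      then have "rho b t \<noteq> None" using eqR_translate[OF b(1) t(1)] rho_eqR[OF b(1) t(1)] by blast
      then show ?thesis by auto
    qed
    have "(\<Sum>p'\<in>?S. lookup f p') = (\<Sum>w\<in>\<rho> ` ?S. \<Sum>p'\<in>{p' \<in> ?S. \<rho> p' = w}. lookup f p')"
      by (rule sum.group[symmetric]) auto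
    also have "\<dots> \<in> I"
    proof (rule sum_in)
      fix w assume "w \<in> \<rho> ` ?S"
      then obtain k1 t1 j1 where t1: "(k1, t1, j1) \<in> ?S" "w = rho b t1" by (auto simp: \<rho>_def)
      obtain g c where gc: "rho b t1 = Some (g, c)" using rho_some[OF t1(1)] by blast
      have t1': "m s t1 = x" "t1 \<in> C" using t1(1) mem kf by auto
      have c: "c < q" "m g (r c) = m (r b) t1" using rho_Some_iff[OF b(1) t1'(2)] gc by auto
      \<comment> \<open>The condition \<open>m s t = x\<close> follows from
        \<open>rho b t = Some (g, c)\<close>, because \<open>m (r b) t\<close> already determines
        \<open>m s t\<close>. The group is thus the full set of terms that make up one entry of
        \<open>phi f\<close>.\<close>
      have "{p' \<in> ?S. \<rho> p' = w} = {p' \<in> keys f. case p' of (k', t, j') \<Rightarrow> k' = k \<and> j' = j \<and> rho b t = Some (g, c)}"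
      proof (rule Set.set_eqI)
        fix p' :: "nat \<times> 's \<times> nat"
        obtain k' t j' where pe: "p' = (k', t, j')" by (cases p')
        have "m s t = x" if "p' \<in> keys f" "rho b t = Some (g, c)"
        proof -
          have "t \<in> C" using that kf pe by auto
          moreover from this have "m g (r c) = m (r b) t" using rho_Some_iff[OF b(1)] that by blast
          ultimately show ?thesis using A(1) t1' c by metis
        qed
        then show "p' \<in> {p' \<in> ?S. \<rho> p' = w} \<longleftrightarrow>
          p' \<in> {p' \<in> keys f. case p' of (k', t, j') \<Rightarrow> k' = k \<and> j' = j \<and> rho b t = Some (g, c)}"
          using mem[of k' t j'] by (auto simp: pe \<rho>_def t1(2) gc)
      qed
      then have "(\<Sum>p'\<in>{p' \<in> ?S. \<rho> p' = w}. lookup f p') =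
          (\<Sum>p'\<in>keys f. if (case p' of (k', t, j') \<Rightarrow> k' = k \<and> j' = j \<and> rho b t = Some (g, c)) then lookup f p' else 0)"
        by (simp add: sum.inter_filter)
      also have "\<dots> = lookup (phi f) (k * q + b, g, j * q + c)"
        unfolding lookup_phi[OF b(1) c(1)]
        by (intro sum.cong refl) (simp only: when_def split_def prod.collapse)
      also have "\<dots> \<in> I" using zero by (simp add: coeffs_in_def)
      finally show "(\<Sum>p'\<in>{p' \<in> ?S. \<rho> p' = w}. lookup f p') \<in> I" .
    qed
    finally show ?thesis .
  next
    case True
    then show ?thesis by (simp only: sum.empty zero_in)
  qed
  have "lookup (mat_conv mul C m f f) (i, x, j) =
    (\<Sum>p\<in>keys f. \<Sum>p'\<in>keys f. lookup f p \<cdot> lookup f p' when ?c p p')"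
    by (simp add: lookup_conv[of "keys f" "keys f"])
  also have "\<dots> = (\<Sum>p\<in>keys f. lookup f p \<cdot> (\<Sum>p'\<in>{p' \<in> keys f. ?c p p'}. lookup f p'))"
    by (intro sum.cong refl)
      (auto simp: mul_sum_r when_def sum.inter_filter intro!: sum.cong)
  also have "\<dots> \<in> I"
  proof (rule sum_in)
    fix p assume "p \<in> keys f"
    then show "lookup f p \<cdot> (\<Sum>p'\<in>{p' \<in> keys f. ?c p p'}. lookup f p') \<in> I"
      using mul_in_l mul_in_r[OF inner] by (cases "lookup f p \<in> I") blast+
  qed
  finally have "lookup (mat_conv mul C m f f) (i, x, j) \<in> I" .
  moreover have "lookup (mat_conv mul C m f f) (i, x, j) - lookup f (i, x, j) \<in> I"
    using idem by (simp add: coeffs_in_def lookup_minus)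
  ultimately show ?thesis using cong_in cong_mod_def by blast
qed

text \<open>\<open>phi\<close> is additive and multiplicative and respects the ideal, hence carries
  the corner pair to one over the group; stable finiteness there kills the image of the defect,
  which is what \<open>vanish_on_J_class\<close> requires.\<close>

lemma (in mult_mod) defect_vanishes_on_J_class:
  assumes sch: "schuetzenberger C m e q r"
    and k: "keys E \<subseteq> triples n C" "keys u \<subseteq> triples n C" "keys v \<subseteq> triples n C"
    and cp: "mult_mod.corner_pair (mat_conv mul C m) (coeffs_in I) E u v"
    and sf: "sfin_mod mul I (semigroup_on.H_class C m e) m"
    and f: "f = E - mat_conv mul C m v u"
    and max: "\<And>i s j. lookup f (i, s, j) \<notin> I \<Longrightarrow> semigroup_on.leJ C m e s \<Longrightarrow> semigroup_on.leJ C m s e"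
    and x: "x \<in> C" "semigroup_on.leJ C m e x"
  shows "lookup f (i, x, j) \<in> I"
proof (rule vanish_on_J_class[OF sch _ _ _ max x])
  interpret schuetzenberger C m e q r by (rule sch)
  have sg: "semigroup_on C m" by unfold_locales
  interpret M: mult_mod "mat_conv mul C m" "coeffs_in I"
    by (rule mult_mod_mat_conv[OF mult_mod_axioms sg])
  interpret N: mult_mod "mat_conv mul H m" "coeffs_in I"
    by (rule mult_mod_mat_conv[OF mult_mod_axioms semigroup_on_H])
  note kc = keys_mat_conv[OF mult_mod_axioms sg]
  show "keys f \<subseteq> triples n C" unfolding f by (intro keys_diff_subset kc k)
  show "mat_conv mul C m f f - f \<in> coeffs_in I"
    using M.corner_defect(1)[OF cp] unfolding f M.cong_mod_def .
  note hom = phi_conv[OF sch, where n = n]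
  have phi_in: "phi h \<in> coeffs_in I" if "h \<in> coeffs_in I" for h
  proof -
    have "rho_term b p (lookup h p) \<in> coeffs_in I" for b p
    proof -
      have "lookup h p \<in> I" using that unfolding coeffs_in_def by blast
      then show ?thesis
        by (auto simp: rho_term_def coeffs_in_def lookup_single when_def split: prod.split option.split)
    qed
    then show ?thesis
      unfolding phi_def additive_ext_def by (intro coeffs_in_sum)
  qed
  have cong: "N.cong_mod (phi g) (phi h)" if "M.cong_mod g h" for g h
    using phi_in[of "g - h"] that by (simp add: M.cong_mod_def N.cong_mod_def phi_diff)
  note c = M.corner_pairD[OF cp]
  have "N.corner_pair (phi E) (phi u) (phi v)"
    unfolding N.corner_pair_def using c[THEN cong] k by (simp add: hom)
  then have "mat_conv mul H m (phi v) (phi u) - phi E \<in> coeffs_in I"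
    using sfin_modD[OF sf keys_phi[OF k(1)] keys_phi[OF k(2)] keys_phi[OF k(3)]] by blast
  then have "- (mat_conv mul H m (phi v) (phi u) - phi E) \<in> coeffs_in I" by (rule N.uminus_in)
  then show "phi f \<in> coeffs_in I"
    by (simp add: f phi_diff hom[OF k(3,2)])
qed

lemma finite_preorder_maximal:
  assumes "finite A" "A \<noteq> {}"
    and trans: "\<And>x y z. x \<in> A \<Longrightarrow> y \<in> A \<Longrightarrow> z \<in> A \<Longrightarrow> below x y \<Longrightarrow> below y z \<Longrightarrow> below x z"
  shows "\<exists>x\<in>A. \<forall>y\<in>A. below x y \<longrightarrow> below y x"
  using assms
proof (induction A rule: finite_ne_induct)
  case (insert a A)
  have "\<exists>x\<in>A. \<forall>y\<in>A. below x y \<longrightarrow> below y x"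
    by (rule insert.IH) (use insert.prems in blast)
  then obtain x where x: "x \<in> A" "\<forall>y\<in>A. below x y \<longrightarrow> below y x" by blast
  show ?case
  proof (cases "below x a")
    case True
    show ?thesis
    proof (intro bexI[of _ a] ballI impI)
      fix y assume y: "y \<in> insert a A" "below a y"
      show "below y a"
      proof (cases "y = a")
        case False
        then have "below x y" using insert.prems[of x a y] True x y by blast
        then have "below y x" using x False y by blast
        then show ?thesis using insert.prems[of y x a] True x False y by blast
      qed (use y in auto)
    qed simp
  next
    case False
    then show ?thesis using x by (intro bexI[of _ x]) auto
  qed
qed simp

text \<open>A single maximal J-class of the support yields the contradiction, without induction over
  J-classes. Being hit by the square of \<open>f\<close>, this class contains a product of two of
  its own elements, hence an idempotent to which the representation can be attached.\<close>

theorem (in stable_on) sfin_mod_of_subgroups: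
  assumes mm: "mult_mod mul I"
    and transv: "\<And>e. e \<in> C \<Longrightarrow> m e e = e \<Longrightarrow> (\<exists>q r. L_transversal e q r) \<or> (\<exists>q r. R_transversal e q r)"
    and sub: "\<And>e. e \<in> C \<Longrightarrow> m e e = e \<Longrightarrow> sfin_mod mul I (H_class e) m"
  shows "sfin_mod mul I C m"
  unfolding sfin_mod_def
proof (intro allI impI)
  fix n E u v
  assume k: "keys E \<subseteq> triples n C" "keys u \<subseteq> triples n C" "keys v \<subseteq> triples n C"
    and cp: "mult_mod.corner_pair (mat_conv mul C m) (coeffs_in I) E u v"
  interpret mult_mod mul I by (rule mm)
  have sg: "semigroup_on C m" by unfold_locales
  interpret M: mult_mod "mat_conv mul C m" "coeffs_in I"
    by (rule mult_mod_mat_conv[OF mm sg])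
  define f where "f = E - mat_conv mul C m v u"
  have kf: "keys f \<subseteq> triples n C"
    unfolding f_def by (intro keys_diff_subset keys_mat_conv[OF mm sg] k)
  have idem: "mat_conv mul C m f f - f \<in> coeffs_in I"
    using M.corner_defect(1)[OF cp] unfolding f_def M.cong_mod_def .
  \<comment> \<open>The support of \<open>f\<close> modulo \<open>I\<close>; \<open>keys f\<close>
    may also contain coefficients that vanish in the quotient.\<close>
  define A where "A = {s. \<exists>i j. lookup f (i, s, j) \<notin> I}"
  have A_keys: "(i, s, j) \<in> keys f" if "lookup f (i, s, j) \<notin> I" for i s j
    using that by (metis in_keys_iff zero_in)
  have "A \<subseteq> (\<lambda>(i, s, j). s) ` keys f"
    unfolding A_def using A_keys by force
  then have A: "finite A" "A \<subseteq> C"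
    using kf by (auto intro: finite_subset)
  have "f \<in> coeffs_in I"
  proof (rule ccontr)
    assume "f \<notin> coeffs_in I"
    then have "A \<noteq> {}" by (auto simp: A_def coeffs_in_def)
    then obtain x where x: "x \<in> A" and x_max: "\<forall>y\<in>A. leJ x y \<longrightarrow> leJ y x"
      using finite_preorder_maximal[of A leJ] A leJ_trans by (metis subsetD)
    then obtain i j where ij: "lookup f (i, x, j) \<notin> I" by (auto simp: A_def)
    have xC: "x \<in> C" using x A by blast
    \<comment> \<open>Because \<open>f\<close> is congruent to its square, each element of its
      support is a product of two elements of the support.\<close>
    have "\<exists>s\<in>A. \<exists>t\<in>A. m s t = x"
    proof (rule ccontr)
      assume neg: "\<not> ?thesis"
      have "lookup (mat_conv mul C m f f) (i, x, j) =
        (\<Sum>p\<in>keys f. \<Sum>p'\<in>keys f. mul (lookup f p) (lookup f p') when triple_op C m p p' = Some (i, x, j))"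
        by (simp add: lookup_conv[of "keys f" "keys f"])
      also have "\<dots> \<in> I"
      proof (intro sum_in)
        fix p p'
        show "(mul (lookup f p) (lookup f p') when triple_op C m p p' = Some (i, x, j)) \<in> I"
        proof (cases "triple_op C m p p' = Some (i, x, j)")
          case True
          then obtain s t k where st: "p = (i, s, k)" "p' = (k, t, j)" "m s t = x"
            by (cases p; cases p') (auto simp: triple_op_def split: if_splits)
          then have "lookup f p \<in> I \<or> lookup f p' \<in> I" using neg unfolding A_def by blast
          then show ?thesis using True mul_in_l mul_in_r by auto
        qed simp
      qed
      finally have "lookup (mat_conv mul C m f f) (i, x, j) \<in> I" .
      moreover have "lookup (mat_conv mul C m f f) (i, x, j) - lookup f (i, x, j) \<in> I"
        using idem by (simp add: coeffs_in_def lookup_minus)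
      ultimately show False using ij cong_in cong_mod_def by blast
    qed
    then obtain s t where st: "s \<in> A" "t \<in> A" "m s t = x" by blast
    then have C: "s \<in> C" "t \<in> C" using A by auto
    have "leJ x s" "leJ x t"
      using st(3) leR_leJ[OF C(1) leR_mult[OF C(2)]] leL_leJ[OF closed[OF C] leL_mult[OF C(1)]] by auto
    then have "leJ s x" "leJ t x" using x_max st by auto
    then obtain e where e: "e \<in> C" "m e e = e" "eqJ e s"
      using ex_idempotent[OF C] st(3) by auto
    have es: "leJ e s" "leJ s e" using e(3) by (simp_all add: eqJ_def)
    have ex: "leJ e x" "leJ x e"
      using leJ_trans[OF e(1) C(1) xC es(1) \<open>leJ s x\<close>] leJ_trans[OF xC C(1) e(1) \<open>leJ x s\<close> es(2)] .
    have max: "leJ s' e" if "lookup f (i', s', j') \<notin> I" "leJ e s'" for i' s' j'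
    proof -
      have s': "s' \<in> A" using that by (auto simp: A_def)
      then have "s' \<in> C" using A by blast
      then have "leJ x s'" using leJ_trans[OF xC e(1) _ ex(2) that(2)] by blast
      then have "leJ s' x" using x_max s' by blast
      then show ?thesis using leJ_trans[OF \<open>s' \<in> C\<close> xC e(1) _ ex(2)] by blast
    qed
    from transv[OF e(1,2)] show False
    proof
      assume "\<exists>q r. L_transversal e q r"
      then obtain q r where "L_transversal e q r" by blast
      then have "schuetzenberger C m e q r"
        using e by unfold_locales
      then have "lookup f (i, x, j) \<in> I"
        by (rule defect_vanishes_on_J_class[OF _ k cp sub[OF e(1,2)] f_def _ xC ex(1)]) (rule max)
      then show False using ij by blast
    next
      assume "\<exists>q r. R_transversal e q r"
      then obtain q r where R: "R_transversal e q r" by blast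
      \<comment> \<open>A transversal for R-classes is one for L-classes of the opposite semigroup,
        so the preceding argument applies to the transposed defect.\<close>
      interpret op: stable_on C "flip m" by (rule stable_on_flip)
      interpret opm: mult_mod "flip mul" I by (rule mult_mod_flip[OF mm])
      have sch: "schuetzenberger C (flip m) e q r"
        using e R by unfold_locales (simp_all add: flip_green)
      have sf: "sfin_mod (flip mul) I (op.H_class e) (flip m)"
      proof -
        have "semigroup_on (H_class e) m"
          using schuetzenberger.semigroup_on_H[OF sch] by (simp add: flip_green semigroup_on_def)
        then show ?thesis
          using sfin_mod_flip[OF mm _ sub[OF e(1,2)]] by (simp add: flip_green)
      qed
      have tf: "mat_transpose f = mat_transpose E - mat_conv (flip mul) C (flip m) (mat_transpose u) (mat_transpose v)"
        by (simp add: f_def mat_transpose_diff mat_conv_mat_transpose)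
      have max': "op.leJ s e" if "lookup (mat_transpose f) (i, s, j) \<notin> I" "op.leJ e s" for i s j
      proof -
        have f: "lookup f (j, s, i) \<notin> I" using that by (simp add: tr3_def)
        then have "s \<in> C" using A_keys kf by auto
        then show ?thesis using max[OF f] that e(1) by (simp add: leJ_flip)
      qed
      have "op.leJ e x" using ex xC e(1) by (simp add: leJ_flip)
      have "lookup (mat_transpose f) (j, x, i) \<in> I"
      proof (rule opm.defect_vanishes_on_J_class[OF sch _ _ _ corner_pair_mat_transpose[OF mm sg cp] sf tf _ xC \<open>op.leJ e x\<close>])
        show "keys (mat_transpose E) \<subseteq> triples n C" "keys (mat_transpose v) \<subseteq> triples n C"
          "keys (mat_transpose u) \<subseteq> triples n C"
          using k by (simp_all add: keys_mat_transpose)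
      qed (rule max')
      then show False using ij by (simp add: tr3_def)
    qed
  qed
  then show "mat_conv mul C m v u - E \<in> coeffs_in I"
    using M.uminus_in[of f] by (simp add: f_def)
qed


subsection \<open>Green's relations of a semigroup record\<close>

context semigroup_on
begin

lemma eqL_equiv: "s \<in> C \<Longrightarrow> t \<in> C \<Longrightarrow> eqL s t \<longleftrightarrow> (\<forall>x\<in>C. leL x s \<longleftrightarrow> leL x t)"
  unfolding eqL_def using leL_trans leL_refl by meson

lemma eqR_equiv: "s \<in> C \<Longrightarrow> t \<in> C \<Longrightarrow> eqR s t \<longleftrightarrow> (\<forall>x\<in>C. leR x s \<longleftrightarrow> leR x t)"
  unfolding eqR_def using leR_trans leR_refl by meson

lemma leJ_refl: "s \<in> C \<Longrightarrow> leJ s s"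
  using leL_leJ by simp

lemma eqJ_equiv: "s \<in> C \<Longrightarrow> t \<in> C \<Longrightarrow> eqJ s t \<longleftrightarrow> (\<forall>x\<in>C. leJ x s \<longleftrightarrow> leJ x t)"
  unfolding eqJ_def using leJ_trans leJ_refl by meson

lemma ex_L_transversal:
  assumes fin: "finite ((\<lambda>y. {z \<in> C. eqL y z}) ` {y \<in> C. eqR y e})"
  shows "\<exists>q r. L_transversal e q r"
proof -
  let ?cl = "\<lambda>y. {z \<in> C. eqL y z}" and ?Y = "{y \<in> C. eqR y e}"
  obtain h q where h: "bij_betw h {..<q :: nat} (?cl ` ?Y)"
    using ex_bij_betw_nat_finite[OF fin] by (auto simp: atLeast0LessThan)
  have "\<exists>y. y \<in> ?Y \<and> ?cl y = h b" if "b < q" for b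
    using bij_betwE[OF h] that by (metis (no_types, lifting) image_iff lessThan_iff)
  then obtain r where r: "\<And>b. b < q \<Longrightarrow> r b \<in> ?Y" "\<And>b. b < q \<Longrightarrow> ?cl (r b) = h b"
    by metis
  have self: "y \<in> ?cl y" if "y \<in> C" for y using that by (simp add: eqL_def)
  have "L_transversal e q r"
    unfolding L_transversal_def
  proof (intro conjI allI ballI impI)
    fix b c assume b: "b < q" and c: "c < q" and "eqL (r b) (r c)"
    then have "\<forall>z\<in>C. eqL (r b) z \<longleftrightarrow> eqL (r c) z"
      using r(1)[OF b] r(1)[OF c] eqL_equiv by (metis (no_types, lifting) mem_Collect_eq)
    then have "h b = h c" using r(2)[OF b] r(2)[OF c] by auto
    then show "b = c" using h b c by (auto simp: bij_betw_def inj_on_def)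
  next
    fix y assume y: "y \<in> C" "eqR y e"
    then have "?cl y \<in> h ` {..<q}" using h by (auto simp: bij_betw_def)
    then obtain b where b: "b < q" "?cl y = h b" by auto
    have "r b \<in> ?cl y" using self[of "r b"] r[OF b(1)] b(2) by auto
    then show "\<exists>b<q. eqL y (r b)" using b(1) by blast
  qed (use r in auto)
  then show ?thesis by blast
qed

end

locale semigroup_record = semigroup_struct S + semigroup_on "carrier S" "monoid.mult S" for S (structure)

lemma semigroup_record_iff: "semigroup_record S \<longleftrightarrow> semigroup_struct S"
  by (simp add: semigroup_record_def semigroup_on_iff)

context semigroup_record
begin

abbreviation "C \<equiv> carrier S"

lemma mem_principal_left: "z \<in> principal_left S s \<longleftrightarrow> (\<exists>x. z = Some x \<and> leL x s)"
  by (auto simp: principal_left_def r_coset_def adjoin_one_def leL_def)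

lemma mem_principal_right: "z \<in> principal_right S s \<longleftrightarrow> (\<exists>x. z = Some x \<and> leR x s)"
  by (auto simp: principal_right_def l_coset_def adjoin_one_def leR_def)

lemma leL_closed: "s \<in> C \<Longrightarrow> leL x s \<Longrightarrow> x \<in> C"
  by (auto simp: leL_def closed)

lemma leR_closed: "s \<in> C \<Longrightarrow> leR x s \<Longrightarrow> x \<in> C"
  by (auto simp: leR_def closed)

lemma leJ_closed: "leJ x s \<Longrightarrow> x \<in> C"
  by (auto simp: leJ_def leR_closed)

lemma mem_principal_two_sided:
  assumes "s \<in> C"
  shows "z \<in> principal_two_sided S s \<longleftrightarrow> (\<exists>x. z = Some x \<and> leJ x s)"
proof -
  have "principal_two_sided S s = (\<Union>h\<in>principal_left S s. h <#\<^bsub>adjoin_one S\<^esub> carrier (adjoin_one S))"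
    by (auto simp: principal_two_sided_def set_mult_def l_coset_def)
  also have "\<dots> = (\<Union>y\<in>{y. leL y s}. principal_right S y)"
    unfolding principal_right_def set_eq_iff UN_iff Bex_def mem_principal_left by blast
  finally show ?thesis
    using leL_closed[OF assms] by (auto simp: mem_principal_right leJ_def) blast
qed

lemma green_L_iff: "(s, t) \<in> green_L S \<longleftrightarrow> s \<in> C \<and> t \<in> C \<and> eqL s t"
proof (cases "s \<in> C \<and> t \<in> C")
  case True
  have "principal_left S s = principal_left S t \<longleftrightarrow> (\<forall>x. leL x s \<longleftrightarrow> leL x t)"
    by (auto simp: set_eq_iff mem_principal_left)
  also have "\<dots> \<longleftrightarrow> eqL s t"
    using True leL_closed by (auto simp: eqL_equiv)
  finally show ?thesis using True by (simp add: green_L_def)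
qed (auto simp: green_L_def)

lemma green_R_iff: "(s, t) \<in> green_R S \<longleftrightarrow> s \<in> C \<and> t \<in> C \<and> eqR s t"
proof (cases "s \<in> C \<and> t \<in> C")
  case True
  have "principal_right S s = principal_right S t \<longleftrightarrow> (\<forall>x. leR x s \<longleftrightarrow> leR x t)"
    by (auto simp: set_eq_iff mem_principal_right)
  also have "\<dots> \<longleftrightarrow> eqR s t"
    using True leR_closed by (auto simp: eqR_equiv)
  finally show ?thesis using True by (simp add: green_R_def)
qed (auto simp: green_R_def)

lemma green_J_iff: "(s, t) \<in> green_J S \<longleftrightarrow> s \<in> C \<and> t \<in> C \<and> eqJ s t"
proof (cases "s \<in> C \<and> t \<in> C")
  case True
  have "principal_two_sided S s = principal_two_sided S t \<longleftrightarrow> (\<forall>x. leJ x s \<longleftrightarrow> leJ x t)"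
    using True by (auto simp: set_eq_iff mem_principal_two_sided)
  also have "\<dots> \<longleftrightarrow> eqJ s t"
    using True leJ_closed by (auto simp: eqJ_equiv)
  finally show ?thesis using True by (simp add: green_J_def)
qed (auto simp: green_J_def)

lemma green_H_class:
  assumes "e \<in> C"
  shows "green_H S `` {e} = H_class e"
  using assms by (auto simp: green_H_def green_L_iff green_R_iff H_class_def eqL_def eqR_def)

lemma stable_on:
  assumes "stable_semigroup S"
  shows "stable_on C (monoid.mult S)"
proof
  fix s t assume C: "s \<in> C" "t \<in> C"
  note st = assms[unfolded stable_semigroup_def, rule_format, OF C]
  have J: "leJ (s \<otimes> t) s" "leJ (t \<otimes> s) s"
    using C leR_leJ[OF C(1) leR_mult[OF C(2)]] leL_leJ[OF closed[OF C(2,1)] leL_mult[OF C(2)]] by auto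
  show "leR s (s \<otimes> t)" if "leJ s (s \<otimes> t)"
    using st C J that closed by (simp add: green_J_iff green_R_iff eqJ_def eqR_def)
  show "leL s (t \<otimes> s)" if "leJ s (t \<otimes> s)"
    using st C J that closed by (simp add: green_J_iff green_L_iff eqJ_def eqL_def)
qed

text \<open>The J-class of an idempotent is regular, so the finiteness hypothesis covers it; the
  L-classes met by the R-class of \<open>e\<close>, and dually, lie inside that J-class.\<close>

lemma ex_transversal:
  assumes stable: "stable_semigroup S" and e: "e \<in> C" "e \<otimes> e = e"
    and fin: "\<And>J. J \<in> regular_J_classes S \<Longrightarrow>
      finite {L \<in> C // green_L S. L \<subseteq> J} \<or> finite {K \<in> C // green_R S. K \<subseteq> J}"
  shows "(\<exists>q r. L_transversal e q r) \<or> (\<exists>q r. R_transversal e q r)"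
proof -
  interpret stable_on C "monoid.mult S" by (rule stable_on[OF stable])
  interpret op: stable_on C "flip (monoid.mult S)" by (rule stable_on_flip)
  let ?J = "green_J S `` {e}"
  have "regular_element S s" if "s \<in> ?J" for s
    using eqJ_idempotent_regular[of s e] that e
    by (auto simp: green_J_iff regular_element_def eqJ_def)
  then have "?J \<in> regular_J_classes S"
    using e by (auto simp: regular_J_classes_def intro: quotientI)
  then consider "finite {L \<in> C // green_L S. L \<subseteq> ?J}" | "finite {K \<in> C // green_R S. K \<subseteq> ?J}"
    using fin by blast
  then show ?thesis
  proof cases
    case 1
    have "(\<lambda>y. {z \<in> C. eqL y z}) ` {y \<in> C. eqR y e} \<subseteq> {L \<in> C // green_L S. L \<subseteq> ?J}"
    proof
      fix L assume "L \<in> (\<lambda>y. {z \<in> C. eqL y z}) ` {y \<in> C. eqR y e}"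
      then obtain y where y: "y \<in> C" "eqR y e" "L = {z \<in> C. eqL y z}" by blast
      then have L: "L = green_L S `` {y}" by (auto simp: green_L_iff)
      have "eqJ e z" if "z \<in> C" "eqL y z" for z
        using that y e leJ_trans[of e y z] leJ_trans[of z y e] leL_leJ leR_leJ
        by (auto simp: eqJ_def eqL_def eqR_def)
      then have "L \<subseteq> ?J" using y e by (auto simp: green_J_iff)
      then show "L \<in> {L \<in> C // green_L S. L \<subseteq> ?J}" using L y by (auto intro: quotientI)
    qed
    then show ?thesis using ex_L_transversal finite_subset[OF _ 1] by blast
  next
    case 2
    have "(\<lambda>y. {z \<in> C. eqR y z}) ` {y \<in> C. eqL y e} \<subseteq> {L \<in> C // green_R S. L \<subseteq> ?J}"
    proof
      fix L assume "L \<in> (\<lambda>y. {z \<in> C. eqR y z}) ` {y \<in> C. eqL y e}"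
      then obtain y where y: "y \<in> C" "eqL y e" "L = {z \<in> C. eqR y z}" by blast
      then have L: "L = green_R S `` {y}" by (auto simp: green_R_iff)
      have "eqJ e z" if "z \<in> C" "eqR y z" for z
        using that y e leJ_trans[of e y z] leJ_trans[of z y e] leL_leJ leR_leJ
        by (auto simp: eqJ_def eqL_def eqR_def)
      then have "L \<subseteq> ?J" using y e by (auto simp: green_J_iff)
      then show "L \<in> {L \<in> C // green_R S. L \<subseteq> ?J}" using L y by (auto intro: quotientI)
    qed
    then show ?thesis using op.ex_L_transversal[of e] finite_subset[OF _ 2] by (simp add: flip_green)
  qed
qed

lemma maximal_subgroups_cases:
  assumes "G \<in> maximal_subgroups S"
  obtains e where "e \<in> C" "e \<otimes> e = e" "carrier G = H_class e" "monoid.mult G = monoid.mult S"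
    "\<one>\<^bsub>G\<^esub> = e" "group G"
proof -
  obtain e where e: "e \<in> C" "e \<otimes> e = e" and G: "G = S\<lparr>carrier := green_H S `` {e}, one := e\<rparr>"
    using assms by (auto simp: maximal_subgroups_def)
  have GH: "carrier G = H_class e" "monoid.mult G = monoid.mult S" "\<one>\<^bsub>G\<^esub> = e"
    using green_H_class[OF e(1)] by (simp_all add: G)
  note H = H_classD[OF e]
  have "group G"
  proof (rule groupI)
    show "\<one>\<^bsub>G\<^esub> \<in> carrier G" using e by (simp add: GH H_class_def eqL_def eqR_def)
    fix h assume h: "h \<in> carrier G"
    then have hH: "h \<in> H_class e" by (simp add: GH)
    note h = H[OF hH]
    obtain a where a: "a \<in> C" "a \<otimes> h = e"
      using h(3) e unfolding leL_def by metis
    \<comment> \<open>Compressing the left inverse \<open>a\<close> by \<open>e\<close> keeps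
      \<open>y \<otimes> h = e\<close> and moves it into eSe, where it is also a right inverse and
      so belongs to the H-class.\<close>
    define y where "y = e \<otimes> (a \<otimes> e)"
    have yC: "y \<in> C" using a e closed by (simp add: y_def)
    have "a \<otimes> (e \<otimes> h) = e" using a h(6) by simp
    then have yh: "y \<otimes> h = e"
      using a e h(1) by (simp add: y_def assoc closed)
    have ey: "e \<otimes> y = y" "y \<otimes> e = y"
      using a e assoc[of e e "a \<otimes> e"] by (simp_all add: y_def assoc closed)
    have "leR y e" "leL y e" using yC ey leR_mult[OF yC, of e] leL_mult[OF yC, of e] by simp_all
    moreover have "leR e y" using leR_mult[OF h(1), of y] yh by simp
    moreover have "leL e y"
    proof -
      obtain b where b: "b \<in> C" "h \<otimes> b = e" using h(5) e unfolding leR_def by metis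
      have "y = y \<otimes> (h \<otimes> b)" using b ey by simp
      also have "\<dots> = e \<otimes> b" using yC h(1) b(1) yh assoc[of y h b] by simp
      finally have "h \<otimes> y = (h \<otimes> e) \<otimes> b" using h(1) e b by (simp add: assoc)
      then have "h \<otimes> y = e" using b h(7) by simp
      then show ?thesis using leL_mult[OF h(1), of y] by simp
    qed
    ultimately have "y \<in> H_class e" using yC by (simp add: H_class_def eqL_def eqR_def)
    then show "\<exists>y\<in>carrier G. y \<otimes>\<^bsub>G\<^esub> h = \<one>\<^bsub>G\<^esub>" using yh by (auto simp: GH)
  qed (use H_class_closed[OF e] H assoc in \<open>auto simp: GH\<close>)
  then show thesis using that e GH by blast
qed

lemma ex_maximal_subgroup:
  assumes "e \<in> C" "e \<otimes> e = e"
  shows "\<exists>G\<in>maximal_subgroups S. carrier G = H_class e \<and> monoid.mult G = monoid.mult S"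
  using assms green_H_class[OF assms(1)]
  by (auto simp: maximal_subgroups_def intro!: exI[of _ e])

end

section \<open>Restriction to subsemigroups and the equivalence with maximal subgroups\<close>

text \<open>Dedekind finiteness is tested in corners, so a subring with a different identity, or
  with none, causes no difficulty; products of matrices over \<open>D\<close> are the same when
  computed over \<open>C\<close>.\<close>

lemma sfin_mod_subset:
  assumes "mult_mod mul I" "semigroup_on C m" "semigroup_on D m" "D \<subseteq> C" "sfin_mod mul I C m"
  shows "sfin_mod mul I D m"
  unfolding sfin_mod_def
proof (intro allI impI)
  interpret mult_mod mul I by (rule assms(1))
  interpret M: mult_mod "mat_conv mul C m" "coeffs_in I" by (rule mult_mod_mat_conv[OF assms(1,2)])
  interpret N: mult_mod "mat_conv mul D m" "coeffs_in I" by (rule mult_mod_mat_conv[OF assms(1,3)])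
  fix n e u v
  assume k: "keys e \<subseteq> triples n D" "keys u \<subseteq> triples n D" "keys v \<subseteq> triples n D"
    and cp: "N.corner_pair e u v"
  have eq: "mat_conv mul D m f g = mat_conv mul C m f g" if "keys f \<subseteq> triples n D" "keys g \<subseteq> triples n D" for f g
  proof (rule conv_hom[where \<phi> = "\<lambda>x. x" and \<psi> = "\<lambda>x. x" and \<theta> = "\<lambda>x. x", OF _ _ _ _ that])
    fix p q a b assume "p \<in> triples n D" "q \<in> triples n D"
    then have "triple_op D m p q = triple_op C m p q"
      using assms(4) by (auto simp: triple_op_def)
    then show "mat_conv mul D m (single p a) (single q b) = mat_conv mul C m (single p a) (single q b)"
      by (simp add: conv_single)
  qed auto
  have "M.corner_pair e u v"
    using cp k by (simp add: M.corner_pair_def N.corner_pair_def M.cong_mod_def N.cong_mod_def eq)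
  then have "mat_conv mul C m v u - e \<in> coeffs_in I"
    using k assms(4) by (intro sfin_modD[OF assms(5)]) auto
  then show "mat_conv mul D m v u - e \<in> coeffs_in I" using eq k by simp
qed

theorem (in ring) stably_finite_semigroup_ring_iff:
  fixes S :: "('s, 'm) monoid_scheme"
  assumes S: "semigroup_struct S" and stable: "stable_semigroup S"
    and fin: "\<And>J. J \<in> regular_J_classes S \<Longrightarrow>
      finite {L \<in> carrier S // green_L S. L \<subseteq> J} \<or> finite {K \<in> carrier S // green_R S. K \<subseteq> J}"
  shows "stably_finite (semigroup_ring R S) \<longleftrightarrow>
    (\<forall>G\<in>maximal_subgroups S. stably_finite (semigroup_ring R G))"
proof -
  interpret cov: ring_cover R "zeval word_eval" by (rule word_cover)
  interpret S: semigroup_record S using S by (simp add: semigroup_record_iff)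
  interpret stable_on "carrier S" "monoid.mult S" by (rule S.stable_on[OF stable])
  have sg: "semigroup_on (carrier S) (monoid.mult S)" by unfold_locales
  have group_struct: "semigroup_struct G" if "group G" for G :: "('s, 'm) monoid_scheme"
  proof -
    interpret group G by (rule that)
    show ?thesis by unfold_locales (auto simp: m_assoc)
  qed
  show ?thesis
  proof (intro iffI ballI)
    fix G assume sf: "stably_finite (semigroup_ring R S)" and G: "G \<in> maximal_subgroups S"
    from G obtain e where GH: "carrier G = S.H_class e" "monoid.mult G = monoid.mult S" "group G"
      by (rule S.maximal_subgroups_cases) blast
    have gs: "semigroup_struct G" using group_struct GH(3) .
    have "sfin_mod (*) cov.ker (carrier S) (monoid.mult S)"
      using sf cov.stably_finite_iff_sfin_mod[OF S] by blast
    then have "sfin_mod (*) cov.ker (carrier G) (monoid.mult G)"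
      using sfin_mod_subset[OF cov.mult_mod_axioms sg] gs[unfolded semigroup_on_iff]
      by (simp add: GH(1,2) S.H_class_def)
    then show "stably_finite (semigroup_ring R G)"
      using cov.stably_finite_iff_sfin_mod[OF gs] by blast
  next
    assume all: "\<forall>G\<in>maximal_subgroups S. stably_finite (semigroup_ring R G)"
    have "sfin_mod (*) cov.ker (S.H_class e) (monoid.mult S)" if e: "e \<in> carrier S" "e \<otimes>\<^bsub>S\<^esub> e = e" for e
    proof -
      obtain G where G: "G \<in> maximal_subgroups S" "carrier G = S.H_class e" "monoid.mult G = monoid.mult S"
        using S.ex_maximal_subgroup[OF e] by blast
      have "group G" using G(1) by (rule S.maximal_subgroups_cases)
      then show ?thesis
        using all G cov.stably_finite_iff_sfin_mod[OF group_struct[of G]] by simp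
    qed
    then have "sfin_mod (*) cov.ker (carrier S) (monoid.mult S)"
      using sfin_mod_of_subgroups[OF cov.mult_mod_axioms S.ex_transversal[OF stable _ _ fin]] by blast
    then show "stably_finite (semigroup_ring R S)"
      using cov.stably_finite_iff_sfin_mod[OF S] by blast
  qed
qed


subsection \<open>Idempotents in traced star algebras\<close>

text \<open>The features of matrices over a complex group ring that stand in for its von Neumann
  algebra: a faithful positive trace, and right multiplications that are bounded in the norm it
  defines. The bound is a natural number so that the corresponding multiple of \<open>un\<close> can
  be formed by repeated addition.\<close>

locale traced_star_algebra =
  fixes mul :: "'a::ab_group_add \<Rightarrow> 'a \<Rightarrow> 'a" (infixl \<open>\<star>\<close> 70) and st :: "'a \<Rightarrow> 'a"
    and tr :: "'a \<Rightarrow> complex" and A :: "'a set" and un :: 'a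
  assumes distl: "(x + y) \<star> z = x \<star> z + y \<star> z"
    and distr: "x \<star> (y + z) = x \<star> y + x \<star> z"
    and assoc: "(x \<star> y) \<star> z = x \<star> (y \<star> z)"
    and A_un: "un \<in> A" and A_diff: "x \<in> A \<Longrightarrow> y \<in> A \<Longrightarrow> x - y \<in> A"
    and A_mul: "x \<in> A \<Longrightarrow> y \<in> A \<Longrightarrow> x \<star> y \<in> A" and A_st: "x \<in> A \<Longrightarrow> st x \<in> A"
    and un_l: "x \<in> A \<Longrightarrow> un \<star> x = x" and un_r: "x \<in> A \<Longrightarrow> x \<star> un = x"
    and st_add: "st (x + y) = st x + st y" and st_mul: "x \<in> A \<Longrightarrow> y \<in> A \<Longrightarrow> st (x \<star> y) = st y \<star> st x"
    and st_st: "x \<in> A \<Longrightarrow> st (st x) = x" and st_un: "st un = un"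
    and tr_add: "tr (x + y) = tr x + tr y" and tr_comm: "x \<in> A \<Longrightarrow> y \<in> A \<Longrightarrow> tr (x \<star> y) = tr (y \<star> x)"
    and tr_pos: "x \<in> A \<Longrightarrow> Re (tr (x \<star> st x)) \<ge> 0"
    and tr_faithful: "x \<in> A \<Longrightarrow> Re (tr (x \<star> st x)) = 0 \<Longrightarrow> x = 0"
    and Cauchy_Schwarz: "x \<in> A \<Longrightarrow> y \<in> A \<Longrightarrow>
      (Re (tr (x \<star> st y)))\<^sup>2 \<le> Re (tr (x \<star> st x)) * Re (tr (y \<star> st y))"
    and bounded: "h \<in> A \<Longrightarrow> \<exists>M::nat. \<forall>y\<in>A. Re (tr ((y \<star> h) \<star> st (y \<star> h))) \<le> M * Re (tr (y \<star> st y))"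
begin

sublocale mult_mod mul "{0}"
  by unfold_locales (auto simp: distl distr assoc, use distl distr in \<open>metis add_cancel_right_right\<close>,
      use distl distr in \<open>metis add_cancel_right_right\<close>)

lemma st_0: "st 0 = 0"
  using st_add[of 0 0] by simp

lemma st_diff: "st (x - y) = st x - st y"
  using st_add[of "x - y" y] by (simp add: eq_diff_eq)

lemma tr_0: "tr 0 = 0"
  using tr_add[of 0 0] by simp

lemma tr_diff: "tr (x - y) = tr x - tr y"
  using tr_add[of "x - y" y] by (simp add: eq_diff_eq)

lemma A_0: "0 \<in> A"
  using A_diff[OF A_un A_un] by simp

lemma A_add: "x \<in> A \<Longrightarrow> y \<in> A \<Longrightarrow> x + y \<in> A"
  using A_diff[OF _ A_diff[OF A_0]] by force

definition nun :: "nat \<Rightarrow> 'a" where "nun M = ((+) un ^^ M) 0"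

lemma nun_simps: "nun 0 = 0" "nun (Suc M) = un + nun M"
  by (simp_all add: nun_def)

lemma nun_in: "nun M \<in> A"
  by (induction M) (auto simp: nun_simps A_0 A_add A_un)

lemma nun_comm: "x \<in> A \<Longrightarrow> nun M \<star> x = x \<star> nun M"
  by (induction M) (auto simp: nun_simps distl distr un_l un_r)

lemma st_nun: "st (nun M) = nun M"
  by (induction M) (auto simp: nun_simps st_add st_un st_0)

lemma tr_nun: "x \<in> A \<Longrightarrow> tr (nun M \<star> x) = of_nat M * tr x"
  by (induction M) (auto simp: nun_simps distl un_l tr_add tr_0 algebra_simps)

lemma Re_tr_nun: "x \<in> A \<Longrightarrow> Re (tr (nun M \<star> x)) = M * Re (tr x)"
  by (simp add: tr_nun)

text \<open>
  With \<open>h = f - f\<^sup>*\<close> and \<open>z = 1 + hh\<^sup>*\<close> one has \<open>fz = ff\<^sup>*f = zf\<close>, so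
  formally \<open>tr f = tr (ff\<^sup>*z\<inverse>) > 0\<close>. To avoid the inverse, put \<open>c = M - z\<close> with \<open>0 \<le> c \<le> M - 1\<close>
  and compare \<open>tr (fc\<^sup>k)\<close>, which is driven away from zero like \<open>M\<^sup>k\<close>, with the smaller
  Cauchy-Schwarz bound.
\<close>

theorem idempotent_trace_zero:
  assumes f: "f \<in> A" "f \<star> f = f" and tr0: "tr f = 0"
  shows "f = 0"
proof (rule ccontr)
  assume "f \<noteq> 0"
  define h where "h = f - st f"
  have h: "h \<in> A" unfolding h_def by (intro A_diff A_st f)
  have sth: "st h = st f - f" using f by (simp add: h_def st_diff st_st)
  obtain M0 :: nat where M0: "\<And>y. y \<in> A \<Longrightarrow> Re (tr ((y \<star> h) \<star> st (y \<star> h))) \<le> M0 * Re (tr (y \<star> st y))"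
    using bounded[OF h] by blast
  \<comment> \<open>\<open>M0\<close> bounds \<open>h \<star> st h\<close>, so \<open>c\<close>,
    which is M - 1 minus this element, is positive; \<open>M \<ge> 2\<close> makes the constant
    \<open>?q\<close> below positive.\<close>
  define M where "M = M0 + 2"
  define z where "z = un + h \<star> st h"
  define c where "c = nun M - z"
  have hh: "h \<star> st h \<in> A" using A_mul h A_st by blast
  have z: "z \<in> A" unfolding z_def by (intro A_add A_un hh)
  have c: "c \<in> A" unfolding c_def by (intro A_diff nun_in z)
  have stz: "st z = z" using h by (simp add: z_def st_add st_un st_mul A_st st_st)
  have stc: "st c = c" by (simp add: c_def st_diff st_nun stz)
  have sff: "st f \<star> st f = st f" using f st_mul[OF f(1) f(1)] by simp
  have hsh: "h \<star> st h = (f - st f) \<star> (st f - f)"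
    unfolding sth unfolding h_def ..
  have st1: "st f \<star> (st f \<star> x) = st f \<star> x" for x
    using sff assoc by metis
  have f1: "f \<star> (f \<star> x) = f \<star> x" for x
    using f(2) assoc by metis
  have fz: "f \<star> z = f \<star> (st f \<star> f)"
  proof -
    have "f \<star> (h \<star> st h) = f \<star> (st f \<star> f) - f"
      unfolding hsh using f(2) sff by (simp add: mul_diff_l mul_diff_r assoc st1 f1)
    then show ?thesis using f by (simp add: z_def distr un_r)
  qed
  have zf: "z \<star> f = f \<star> (st f \<star> f)"
  proof -
    have "(h \<star> st h) \<star> f = f \<star> (st f \<star> f) - f"
      unfolding hsh using f(2) sff by (simp add: mul_diff_l mul_diff_r assoc st1 f1)
    then show ?thesis using f by (simp add: z_def distl un_l)
  qed
  have cf: "c \<star> f = f \<star> c"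
    using nun_comm[OF f(1)] fz zf by (simp add: c_def mul_diff_l mul_diff_r)
  have cz: "c \<star> z = z \<star> c"
    using nun_comm[OF z] by (simp add: c_def mul_diff_l mul_diff_r)
  have cplusz: "c + z = nun M" by (simp add: c_def)
  define pw where "pw k = ((\<star>) c ^^ k) un" for k
  have pw_0: "pw 0 = un" and pw_Suc: "pw (Suc k) = c \<star> pw k" for k by (simp_all add: pw_def)
  have pw: "pw k \<in> A" for k by (induction k) (auto simp: pw_0 pw_Suc A_un A_mul c)
  have pw_comm: "pw k \<star> x = x \<star> pw k" if "x \<in> A" "c \<star> x = x \<star> c" for k x
    using that
  proof (induction k)
    case (Suc k)
    then show ?case by (simp add: pw_Suc assoc) (metis assoc)
  qed (simp add: pw_0 un_l un_r)
  have pw_c: "pw k \<star> c = c \<star> pw k" for k using pw_comm[OF c] by simp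
  have pw_add: "pw (j + k) = pw j \<star> pw k" for j k
    by (induction j) (simp_all add: pw_0 pw_Suc un_l pw assoc)
  have st_pw: "st (pw k) = pw k" for k
    by (induction k) (simp_all add: pw_0 pw_Suc st_un st_mul c pw stc pw_c)
  define N where "N x = Re (tr (x \<star> st x))" for x
  have N: "N x \<ge> 0" if "x \<in> A" for x using tr_pos that by (simp add: N_def)
  have Pz: "Re (tr (w \<star> (z \<star> st w))) = N w + N (w \<star> h)" if w: "w \<in> A" for w
  proof -
    have "w \<star> (z \<star> st w) = w \<star> st w + (w \<star> h) \<star> st (w \<star> h)"
      using w h by (simp add: z_def distl distr un_l A_st st_mul assoc)
    then show ?thesis by (simp add: tr_add N_def)
  qed
  have Pz_ge: "Re (tr (w \<star> (z \<star> st w))) \<ge> N w" if w: "w \<in> A" for w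
    using Pz[OF w] N[OF A_mul[OF w h]] by simp
  have Pc: "Re (tr (w \<star> (c \<star> st w))) \<ge> 0" if w: "w \<in> A" for w
  proof -
    have "w \<star> (c \<star> st w) = nun M \<star> (w \<star> st w) - w \<star> (z \<star> st w)"
      using nun_comm[OF w] by (simp add: c_def mul_diff_l mul_diff_r flip: assoc)
    then have "Re (tr (w \<star> (c \<star> st w))) = M * N w - (N w + N (w \<star> h))"
      using Pz[OF w] w by (simp add: tr_diff tr_nun A_mul A_st N_def)
    moreover have "N (w \<star> h) \<le> M0 * N w" using M0[OF w] by (simp add: N_def)
    ultimately show ?thesis using N[OF w] by (simp add: M_def algebra_simps)
  qed
  \<comment> \<open>Nonnegative for the following reason: move \<open>f\<close> to the end under the
    trace and split c^k into equal halves, with one factor \<open>c\<close> left in the middle when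
    \<open>k\<close> is odd.\<close>
  define mk where "mk k = Re (tr (f \<star> (st f \<star> pw k)))" for k
  have mk_ge: "mk k \<ge> 0" for k
  proof -
    define j where "j = k div 2"
    define w where "w = st f \<star> pw j"
    have w: "w \<in> A" "st w = pw j \<star> f" using f by (simp_all add: w_def A_mul A_st pw st_mul st_pw st_st)
    show ?thesis
    proof (cases "even k")
      case True
      then have k: "k = j + j" by (auto simp: j_def)
      have "tr (f \<star> (st f \<star> pw k)) = tr ((st f \<star> pw k) \<star> f)"
        by (rule tr_comm) (auto intro: f A_mul A_st pw)
      also have "(st f \<star> pw k) \<star> f = w \<star> st w" 
        by (simp only: k pw_add w(2)) (simp add: w_def assoc)
      finally show ?thesis using N[OF w(1)] by (simp add: mk_def N_def)
    next
      case False
      then have k: "k = j + Suc j" unfolding j_def by presburger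
      have "tr (f \<star> (st f \<star> pw k)) = tr ((st f \<star> pw k) \<star> f)"
        by (rule tr_comm) (auto intro: f A_mul A_st pw)
      also have "(st f \<star> pw k) \<star> f = w \<star> (c \<star> st w)" 
        by (simp only: k pw_add pw_Suc w(2)) (simp add: w_def assoc)
      finally show ?thesis using Pc[OF w(1)] by (simp add: mk_def)
    qed
  qed
  \<comment> \<open>Writing c = M - z in one factor and using the formula for
    \<open>f \<star> z\<close> gives T (k+1) = M T k - mk k. As T 0 = tr f = 0, the next value is -
    N f, and each further step multiplies by \<open>M\<close> and subtracts something
    nonnegative.\<close>
  define T where "T k = Re (tr (f \<star> pw k))" for k
  have T_rec: "T (Suc k) = M * T k - mk k" for k
  proof -
    have fp: "pw k \<star> f = f \<star> pw k" using pw_comm[OF f(1) cf] .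
    have zp: "pw k \<star> z = z \<star> pw k" using pw_comm[OF z cz] .
    have "f \<star> pw (Suc k) = f \<star> (nun M \<star> pw k) - f \<star> (z \<star> pw k)"
      by (simp add: pw_Suc c_def mul_diff_l mul_diff_r)
    also have "f \<star> (nun M \<star> pw k) = nun M \<star> (f \<star> pw k)"
      using nun_comm[OF f(1)] by (simp flip: assoc)
    finally have "tr (f \<star> pw (Suc k)) = M * tr (f \<star> pw k) - tr (f \<star> (z \<star> pw k))"
      using f pw by (simp add: tr_diff tr_nun A_mul)
    moreover have "f \<star> (z \<star> pw k) = (f \<star> (st f \<star> pw k)) \<star> f"
      using fz fp by (metis assoc)
    moreover have "tr ((f \<star> (st f \<star> pw k)) \<star> f) = tr (f \<star> (f \<star> (st f \<star> pw k)))"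
      by (rule tr_comm) (auto intro: f A_mul A_st pw)
    moreover have "f \<star> (f \<star> (st f \<star> pw k)) = f \<star> (st f \<star> pw k)"
      using f(2) by (metis assoc)
    ultimately show ?thesis by (simp add: T_def mk_def)
  qed
  have mk0: "mk 0 = N f" using f by (simp add: mk_def pw_0 un_r A_st N_def)
  have Nf: "N f > 0" using tr_faithful[OF f(1)] \<open>f \<noteq> 0\<close> N[OF f(1)] by (force simp: N_def)
  have T_le: "T (Suc k) \<le> - (real M ^ k * N f)" for k
  proof (induction k)
    case 0
    have "T 0 = 0" using f tr0 by (simp add: T_def pw_0 un_r)
    then show ?case using T_rec[of 0] mk0 by simp
  next
    case (Suc k)
    have "T (Suc (Suc k)) \<le> real M * T (Suc k)" using T_rec[of "Suc k"] mk_ge[of "Suc k"] by simp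
    also have "\<dots> \<le> real M * (- (real M ^ k * N f))" using Suc by (intro mult_left_mono) auto
    finally show ?case by simp
  qed
  \<comment> \<open>In operator terms M^2 - c^2 = M z + z c is at least \<open>M\<close>, because z
    is at least 1 and the commuting positive elements z and c have a positive product.\<close>
  have s_rec: "N (pw (Suc k)) \<le> (real M * real M - real M) * N (pw k)" for k
  proof -
    define y where "y = pw k"
    have y: "y \<in> A" "st y = y" "c \<star> y = y \<star> c" by (simp_all add: y_def pw st_pw pw_c)
    have zy: "z \<star> y = y \<star> z" using pw_comm[OF z cz] by (simp add: y_def)
    \<comment> \<open>Positivity of the product of z and c without square roots: multiplying
      \<open>a\<close> by M = c + z splits it into two expressions of the form
      \<open>w \<star> (z \<star> st w)\<close> and
      \<open>w \<star> (c \<star> st w)\<close>.\<close>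
    define a where "a = c \<star> (z \<star> (y \<star> y))"
    have a: "a \<in> A" unfolding a_def by (intro A_mul c z y)
    have "nun M \<star> a = c \<star> a + z \<star> a" by (simp add: distl flip: cplusz)
    moreover have "c \<star> a = (y \<star> c) \<star> (z \<star> st (y \<star> c))"
    proof -
      have "(y \<star> c) \<star> (z \<star> st (y \<star> c)) = (c \<star> y) \<star> (z \<star> (c \<star> y))"
        using y c stc by (simp add: st_mul)
      also have "\<dots> = c \<star> (c \<star> (z \<star> (y \<star> y)))"
        using cz zy y(3) by (metis assoc)
      finally show ?thesis by (simp add: a_def)
    qed
    moreover have "z \<star> a = (y \<star> z) \<star> (c \<star> st (y \<star> z))"
    proof -
      have "(y \<star> z) \<star> (c \<star> st (y \<star> z)) = (z \<star> y) \<star> (c \<star> (z \<star> y))"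
        using y z stz zy by (simp add: st_mul)
      also have "\<dots> = z \<star> (c \<star> (z \<star> (y \<star> y)))"
        using cz zy y(3) by (metis assoc)
      finally show ?thesis by (simp add: a_def)
    qed
    ultimately have "real M * Re (tr a) = Re (tr ((y \<star> c) \<star> (z \<star> st (y \<star> c)))) + Re (tr ((y \<star> z) \<star> (c \<star> st (y \<star> z))))"
      using Re_tr_nun[OF a, of M] by (simp add: tr_add)
    also have "\<dots> \<ge> 0"
      using Pz_ge[OF A_mul[OF y(1) c]] Pc[OF A_mul[OF y(1) z]] N[OF A_mul[OF y(1) c]] by linarith
    finally have a_pos: "Re (tr a) \<ge> 0" by (simp add: zero_le_mult_iff M_def)
    have "nun M \<star> (nun M \<star> (y \<star> y)) = nun M \<star> (z \<star> (y \<star> y)) + (nun M \<star> (c \<star> (y \<star> y)))"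
      by (subst (2) cplusz[symmetric]) (simp add: distl distr add.commute)
    also have "nun M \<star> (c \<star> (y \<star> y)) = a + c \<star> (c \<star> (y \<star> y))"
      using nun_comm[OF c] by (metis (no_types, lifting) a_def add.commute assoc cplusz distl distr)
    finally have "nun M \<star> (nun M \<star> (y \<star> y)) =
      nun M \<star> (z \<star> (y \<star> y)) + (a + c \<star> (c \<star> (y \<star> y)))" .
    then have "Re (tr (nun M \<star> (nun M \<star> (y \<star> y)))) =
      Re (tr (nun M \<star> (z \<star> (y \<star> y)))) + (Re (tr a) + Re (tr (c \<star> (c \<star> (y \<star> y)))))"
      by (simp add: tr_add)
    then have "M * (M * Re (tr (y \<star> y))) = M * Re (tr (z \<star> (y \<star> y))) + (Re (tr a) + Re (tr (c \<star> (c \<star> (y \<star> y)))))"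
      using y c z by (simp only: Re_tr_nun A_mul nun_in)
    moreover have "c \<star> (c \<star> (y \<star> y)) = pw (Suc k) \<star> st (pw (Suc k))"
    proof -
      have "pw (Suc k) \<star> st (pw (Suc k)) = (c \<star> y) \<star> (c \<star> y)"
        unfolding st_pw by (simp only: pw_Suc y_def)
      also have "\<dots> = c \<star> (c \<star> (y \<star> y))" using y(3) by (metis assoc)
      finally show ?thesis ..
    qed
    moreover have "z \<star> (y \<star> y) = y \<star> (z \<star> st y)" using zy y(2) by (metis assoc)
    ultimately have eq: "M * (M * N y) = M * Re (tr (y \<star> (z \<star> st y))) + (Re (tr a) + N (pw (Suc k)))"
      using y(2) by (simp add: N_def)
    have "real M * N y \<le> M * Re (tr (y \<star> (z \<star> st y)))"
      using Pz_ge[OF y(1)] by (intro mult_left_mono) auto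
    then show ?thesis using eq a_pos by (simp add: y_def algebra_simps)
  qed
  let ?q = "real M * real M - real M"
  have M2: "real M \<ge> 2" by (simp add: M_def)
  have "real M * (real M - 1) > 0" using M2 by (intro mult_pos_pos) auto
  then have q: "?q > 0" "?q < real M * real M" using M2 by (simp_all add: right_diff_distrib)
  have s_le: "N (pw k) \<le> ?q ^ k * N un" for k
  proof (induction k)
    case (Suc k)
    have "N (pw (Suc k)) \<le> ?q * N (pw k)" by (rule s_rec)
    also have "\<dots> \<le> ?q * (?q ^ k * N un)" using Suc q by (intro mult_left_mono) auto
    finally show ?case by simp
  qed (simp add: pw_0)
  have bound: "(real M * real M) ^ k * (N f)\<^sup>2 \<le> ?q ^ k * (N f * ?q * N un)" for k
  proof -
    have "real M ^ k * N f \<le> - T (Suc k)" using T_le[of k] by simp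
    then have "(real M ^ k * N f)\<^sup>2 \<le> (T (Suc k))\<^sup>2"
      using Nf by (metis power2_minus power_mono zero_le_mult_iff less_imp_le of_nat_0_le_iff zero_le_power)
    also have "\<dots> \<le> N f * N (pw (Suc k))"
      using Cauchy_Schwarz[OF f(1) pw[of "Suc k"]] by (simp add: T_def N_def st_pw)
    also have "\<dots> \<le> N f * (?q ^ Suc k * N un)" using s_le[of "Suc k"] Nf by (intro mult_left_mono) auto
    finally show ?thesis by (simp add: power_mult_distrib power2_eq_square algebra_simps)
  qed
  \<comment> \<open>The squared lower bound grows like M^(2k), the Cauchy-Schwarz bound only like
    (M^2 - M)^k; \<open>x\<close> is the ratio of the two bases.\<close>
  define x where "x = real M * real M / ?q"
  have "x > 1" using q by (simp add: x_def)
  then obtain k where k: "x ^ k > N f * ?q * N un / (N f)\<^sup>2" using real_arch_pow by blast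
  have "x ^ k * (N f)\<^sup>2 \<le> N f * ?q * N un"
    using bound[of k] q by (simp add: x_def power_divide divide_simps) (simp add: mult.commute)
  then show False using k Nf by (simp add: divide_simps)
qed

end


subsection \<open>Complex group rings\<close>

interpretation cpx: mult_mod "(*) :: complex \<Rightarrow> complex \<Rightarrow> complex" "{0}"
  by unfold_locales (auto simp: algebra_simps)

definition norm2 :: "('p \<Rightarrow>\<^sub>0 complex) \<Rightarrow> real" where
  "norm2 f = (\<Sum>p\<in>keys f. (cmod (lookup f p))\<^sup>2)"

lemma norm2_superset:
  assumes "finite A" "keys f \<subseteq> A"
  shows "norm2 f = (\<Sum>p\<in>A. (cmod (lookup f p))\<^sup>2)"
  unfolding norm2_def using assms by (intro sum.mono_neutral_left) (auto simp: in_keys_iff)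

text \<open>Lagrange's identity: the nonnegative double sum of (a i b j - a j b i)^2 is twice the
  difference of the two sides.\<close>

lemma Cauchy_Schwarz_sum:
  fixes a b :: "'p \<Rightarrow> real"
  shows "(\<Sum>i\<in>A. a i * b i)\<^sup>2 \<le> (\<Sum>i\<in>A. (a i)\<^sup>2) * (\<Sum>i\<in>A. (b i)\<^sup>2)"
proof -
  have "0 \<le> (\<Sum>i\<in>A. \<Sum>j\<in>A. (a i * b j - a j * b i)\<^sup>2)" by (intro sum_nonneg) auto
  also have "\<dots> = (\<Sum>i\<in>A. \<Sum>j\<in>A. (a i)\<^sup>2 * (b j)\<^sup>2) + (\<Sum>i\<in>A. \<Sum>j\<in>A. (a j)\<^sup>2 * (b i)\<^sup>2)
      - 2 * (\<Sum>i\<in>A. \<Sum>j\<in>A. (a i * b i) * (a j * b j))"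
    unfolding sum_distrib_left sum.distrib[symmetric] sum_subtractf[symmetric]
    by (intro sum.cong refl) (simp add: power2_diff power_mult_distrib algebra_simps)
  also have "(\<Sum>i\<in>A. \<Sum>j\<in>A. (a j)\<^sup>2 * (b i)\<^sup>2) = (\<Sum>i\<in>A. \<Sum>j\<in>A. (a i)\<^sup>2 * (b j)\<^sup>2)"
    by (rule sum.swap)
  finally show ?thesis by (simp add: sum_product power2_eq_square)
qed

lemma norm2_nonneg: "norm2 f \<ge> 0"
  by (simp add: norm2_def sum_nonneg)

lemma norm2_eq_0: "norm2 f = 0 \<Longrightarrow> f = 0"
proof (rule poly_mapping_eqI)
  fix p assume "norm2 f = 0"
  then show "lookup f p = lookup 0 p"
    by (cases "p \<in> keys f") (auto simp: norm2_def sum_nonneg_eq_0_iff in_keys_iff)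
qed

lemma norm2_add: "norm2 (f + g) \<le> 2 * norm2 f + 2 * norm2 g"
proof -
  let ?A = "keys f \<union> keys g"
  have par: "(cmod (a + b))\<^sup>2 \<le> 2 * (cmod a)\<^sup>2 + 2 * (cmod b)\<^sup>2" for a b :: complex
  proof -
    have "(cmod (a + b))\<^sup>2 \<le> (cmod a + cmod b)\<^sup>2" by (intro power_mono norm_triangle_ineq) auto
    also have "\<dots> \<le> 2 * (cmod a)\<^sup>2 + 2 * (cmod b)\<^sup>2"
      using zero_le_power2[of "cmod a - cmod b"] by (simp add: power2_sum power2_diff)
    finally show ?thesis .
  qed
  have "norm2 (f + g) = (\<Sum>p\<in>?A. (cmod (lookup f p + lookup g p))\<^sup>2)"
    using Poly_Mapping.keys_add[of f g] by (subst norm2_superset[of ?A]) (auto simp: lookup_add)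
  also have "\<dots> \<le> (\<Sum>p\<in>?A. 2 * (cmod (lookup f p))\<^sup>2 + 2 * (cmod (lookup g p))\<^sup>2)"
    by (intro sum_mono par)
  also have "\<dots> = 2 * norm2 f + 2 * norm2 g"
    by (simp add: norm2_superset[of ?A] sum.distrib sum_distrib_left)
  finally show ?thesis .
qed

context group
begin

abbreviation (input) "\<G> \<equiv> carrier G"
abbreviation "gcv \<equiv> mat_conv ((*) :: complex \<Rightarrow> complex \<Rightarrow> complex) (carrier G) (monoid.mult G)"

definition star_op :: "(nat \<times> 'a \<times> nat \<Rightarrow>\<^sub>0 complex) \<Rightarrow> (nat \<times> 'a \<times> nat \<Rightarrow>\<^sub>0 complex)" where
  "star_op = additive_ext (\<lambda>(i, g, j) c. single (j, inv g, i) (cnj c))"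

text \<open>Kaplansky's trace on matrices over the group ring.\<close>

definition trace :: "(nat \<times> 'a \<times> nat \<Rightarrow>\<^sub>0 complex) \<Rightarrow> complex" where
  "trace = additive_ext (\<lambda>(i, g, j) c. if i = j \<and> g = \<one> then c else 0)"

definition gun :: "nat \<Rightarrow> (nat \<times> 'a \<times> nat \<Rightarrow>\<^sub>0 complex)" where
  "gun n = (\<Sum>i<n. single (i, \<one>, i) 1)"

lemma star_op_add: "star_op (f + g) = star_op f + star_op g"
  unfolding star_op_def by (rule additive_ext_add) (auto simp: single_add split: prod.split)

lemma star_op_0 [simp]: "star_op 0 = 0"
  by (simp add: star_op_def)

lemma star_op_single: "star_op (single (i, g, j) c) = single (j, inv g, i) (cnj c)"
  unfolding star_op_def by (subst additive_ext_single) auto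

lemma trace_add: "trace (f + g) = trace f + trace g"
  unfolding trace_def by (rule additive_ext_add) (auto split: prod.split)

lemma trace_0 [simp]: "trace 0 = 0"
  by (simp add: trace_def)

lemma trace_single: "trace (single (i, g, j) c) = (if i = j \<and> g = \<one> then c else 0)"
  unfolding trace_def by (subst additive_ext_single) auto

lemma gcv_single:
  "s \<in> \<G> \<Longrightarrow> t \<in> \<G> \<Longrightarrow> gcv (single (i, s, j) a) (single (k, t, l) b) =
    (if j = k then single (i, s \<otimes> t, l) (a * b) else 0)"
  by (simp add: cpx.conv_single triple_op_def)

lemma star_op_gcv:
  assumes "keys f \<subseteq> triples n \<G>" "keys g \<subseteq> triples n \<G>"
  shows "star_op (gcv f g) = gcv (star_op g) (star_op f)"
  using assms(1)
proof (induction f rule: poly_mapping_additive_induct)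
  case (single p a)
  show ?case
    using assms(2)
  proof (induction g rule: poly_mapping_additive_induct)
    case (single q b)
    then show ?case
      using \<open>p \<in> _\<close>
      by (cases p; cases q) (auto simp: gcv_single star_op_single inv_mult_group mult.commute)
  qed (auto simp: cpx.conv_add_r cpx.conv_add_l star_op_add)
qed (auto simp: cpx.conv_add_r cpx.conv_add_l star_op_add)

lemma star_op_star_op:
  assumes "keys f \<subseteq> triples n \<G>"
  shows "star_op (star_op f) = f"
  using assms
  by (induction f rule: poly_mapping_additive_induct) (auto simp: star_op_add star_op_single)

lemma keys_star_op:
  assumes "keys f \<subseteq> triples n \<G>"
  shows "keys (star_op f) \<subseteq> triples n \<G>"
  using assms
proof (induction f rule: poly_mapping_additive_induct)
  case (add f g)
  then show ?case by (simp add: star_op_add keys_add_subset)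
next
  case (single p a)
  then show ?case by (cases p) (auto simp: star_op_single)
qed simp

lemma trace_comm:
  assumes "keys f \<subseteq> triples n \<G>" "keys g \<subseteq> triples n \<G>"
  shows "trace (gcv f g) = trace (gcv g f)"
  using assms(1)
proof (induction f rule: poly_mapping_additive_induct)
  case (single p a)
  show ?case
    using assms(2)
  proof (induction g rule: poly_mapping_additive_induct)
    case (single q b)
    obtain i s j where p: "p = (i, s, j)" "s \<in> \<G>" using \<open>p \<in> _\<close> by (cases p) auto
    obtain k t l where q: "q = (k, t, l)" "t \<in> \<G>" using \<open>q \<in> _\<close> by (cases q) auto
    have "s \<otimes> t = \<one> \<longleftrightarrow> t \<otimes> s = \<one>" using p q by (metis inv_equality r_inv l_inv inv_inv)
    then show ?case using p q by (auto simp: gcv_single trace_single)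
  qed (auto simp: cpx.conv_add_r cpx.conv_add_l trace_add)
qed (auto simp: cpx.conv_add_r cpx.conv_add_l trace_add)

text \<open>Only pairs of equal indices produce the identity element on the diagonal, so the trace
  form is the standard Hermitian inner product. \<open>A\<close> may exceed the support of
  \<open>f\<close>, which allows one index set for two functions.\<close>

lemma trace_star:
  assumes f: "keys f \<subseteq> triples n \<G>" and g: "keys g \<subseteq> triples n \<G>" and A: "finite A" "keys f \<subseteq> A"
  shows "trace (gcv f (star_op g)) = (\<Sum>p\<in>A. lookup f p * cnj (lookup g p))"
proof -
  have fin: "finite A" by fact
  have "\<And>A. finite A \<Longrightarrow> keys f \<subseteq> A \<Longrightarrow> trace (gcv f (star_op g)) = (\<Sum>p\<in>A. lookup f p * cnj (lookup g p))"
    if "A = keys f" for A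
    using g
  proof (induction g rule: poly_mapping_additive_induct)
    case (single q b)
    obtain k t l where q: "q = (k, t, l)" "t \<in> \<G>" using \<open>q \<in> _\<close> by (cases q) auto
    have "trace (gcv f (star_op (single q b))) = lookup f q * cnj b"
      using f
    proof (induction f rule: poly_mapping_additive_induct)
      case (single p a)
      obtain i s j where p: "p = (i, s, j)" "s \<in> \<G>" using \<open>p \<in> _\<close> by (cases p) auto
      have "s \<otimes> inv t = \<one> \<longleftrightarrow> s = t" using p q by (metis inv_equality inv_inv inv_closed r_inv)
      then show ?case
        using p q by (auto simp: star_op_single gcv_single trace_single lookup_single when_def)
    qed (auto simp: cpx.conv_add_l trace_add lookup_add algebra_simps)
    also have "\<dots> = (\<Sum>p\<in>A. lookup f p * cnj (lookup (single q b) p))"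
    proof (cases "q \<in> A")
      case True
      have "(\<Sum>p\<in>A. lookup f p * cnj (lookup (single q b) p)) = (\<Sum>p\<in>A. if p = q then lookup f p * cnj b else 0)"
        by (intro sum.cong) (auto simp: lookup_single when_def)
      then show ?thesis using True \<open>finite A\<close> by simp
    next
      case False
      then have "lookup f q = 0" using \<open>keys f \<subseteq> A\<close> by (auto simp: in_keys_iff)
      moreover have "(\<Sum>p\<in>A. lookup f p * cnj (lookup (single q b) p)) = 0"
        using False by (intro sum.neutral) (auto simp: lookup_single when_def)
      ultimately show ?thesis by simp
    qed
    finally show ?case .
  qed (auto simp: cpx.conv_add_r trace_add star_op_add lookup_add algebra_simps sum.distrib)
  then have "trace (gcv f (star_op g)) = (\<Sum>p\<in>keys f. lookup f p * cnj (lookup g p))" by simp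
  also have "\<dots> = (\<Sum>p\<in>A. lookup f p * cnj (lookup g p))"
    using A by (intro sum.mono_neutral_left) (auto simp: in_keys_iff)
  finally show ?thesis .
qed

lemma trace_star_self:
  assumes "keys f \<subseteq> triples n \<G>"
  shows "trace (gcv f (star_op f)) = of_real (norm2 f)"
  using trace_star[OF assms assms finite_keys subset_refl]
  by (simp only: norm2_def of_real_sum complex_norm_square)

lemma gun_l:
  assumes "keys f \<subseteq> triples n \<G>"
  shows "gcv (gun n) f = f"
  using assms
proof (induction f rule: poly_mapping_additive_induct)
  case (single p a)
  obtain i s j where p: "p = (i, s, j)" "s \<in> \<G>" "i < n" using \<open>p \<in> _\<close> by (cases p) auto
  then have "gcv (gun n) (single p a) = (\<Sum>k<n. if k = i then single p a else 0)"
    unfolding gun_def cpx.conv_sum_l by (intro sum.cong) (auto simp: gcv_single)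
  then show ?case using p by simp
qed (auto simp: cpx.conv_add_r)

lemma gun_r:
  assumes "keys f \<subseteq> triples n \<G>"
  shows "gcv f (gun n) = f"
  using assms
proof (induction f rule: poly_mapping_additive_induct)
  case (single p a)
  obtain i s j where p: "p = (i, s, j)" "s \<in> \<G>" "j < n" using \<open>p \<in> _\<close> by (cases p) auto
  then have "gcv (single p a) (gun n) = (\<Sum>k<n. if k = j then single p a else 0)"
    unfolding gun_def cpx.conv_sum_r by (intro sum.cong) (auto simp: gcv_single)
  then show ?case using p by simp
qed (auto simp: cpx.conv_add_l)

lemma keys_gun: "keys (gun n) \<subseteq> triples n \<G>"
  unfolding gun_def by (rule order_trans[OF Poly_Mapping.keys_sum]) auto

lemma star_gun: "star_op (gun n) = gun n"
proof -
  have "star_op (\<Sum>i\<in>K. single (i, \<one>, i) 1) = (\<Sum>i\<in>K. single (i, \<one>, i) 1)" for K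
    by (induction K rule: infinite_finite_induct) (auto simp: star_op_add star_op_single)
  then show ?thesis by (simp add: gun_def)
qed

text \<open>Right translation by a group element moves indices injectively, so a single term
  multiplies the squared norm by at most the squared modulus of its coefficient; sums are handled by
  \<open>norm2_add\<close> at the cost of a factor 2.\<close>

lemma bounded_right_mult:
  assumes "keys h \<subseteq> triples n \<G>"
  shows "\<exists>M::nat. \<forall>y. keys y \<subseteq> triples n \<G> \<longrightarrow> norm2 (gcv y h) \<le> M * norm2 y"
  using assms
proof (induction h rule: poly_mapping_additive_induct)
  case zero
  then show ?case using norm2_nonneg by (intro exI[of _ 0]) (simp add: norm2_def)
next
  case (add f g)
  then obtain M1 M2 :: nat where M: "\<And>y. keys y \<subseteq> triples n \<G> \<Longrightarrow> norm2 (gcv y f) \<le> M1 * norm2 y"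
    "\<And>y. keys y \<subseteq> triples n \<G> \<Longrightarrow> norm2 (gcv y g) \<le> M2 * norm2 y" by blast
  have "norm2 (gcv y (f + g)) \<le> (2 * M1 + 2 * M2 :: nat) * norm2 y" if "keys y \<subseteq> triples n \<G>" for y
    using norm2_add[of "gcv y f" "gcv y g"] M[OF that] by (simp add: cpx.conv_add_r algebra_simps)
  then show ?case by blast
next
  case (single q b)
  obtain k t l where q: "q = (k, t, l)" "t \<in> \<G>" using \<open>q \<in> _\<close> by (cases q) auto
  obtain M :: nat where M: "(cmod b)\<^sup>2 \<le> real M" using real_arch_simple by blast
  have "norm2 (gcv y (single q b)) \<le> M * norm2 y" if y: "keys y \<subseteq> triples n \<G>" for y
  proof -
    let ?D = "{p \<in> keys y. snd (snd p) = k}" and ?f = "\<lambda>p :: nat \<times> 'a \<times> nat. (fst p, fst (snd p) \<otimes> t, l)"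
    have inj: "inj_on ?f ?D"
    proof (rule inj_onI)
      fix p p' assume p: "p \<in> ?D" "p' \<in> ?D" and eq: "?f p = ?f p'"
      obtain i g j i' g' j' where pe: "p = (i, g, j)" "p' = (i', g', j')" by (cases p; cases p')
      then have "g \<in> \<G>" "g' \<in> \<G>" using p y by auto
      then show "p = p'" using p eq q(2) by (simp add: pe)
    qed
    have l: "lookup (gcv y (single q b)) z = (\<Sum>p\<in>?D. if ?f p = z then lookup y p * b else 0)" for z
    proof -
      have "lookup (gcv y (single q b)) z = (\<Sum>p\<in>keys y. lookup y p * b when triple_op \<G> (\<otimes>) p q = Some z)"
        by (subst cpx.lookup_conv[of "keys y" "{q}"]) auto
      also have "\<dots> = (\<Sum>p\<in>keys y. if snd (snd p) = k then if ?f p = z then lookup y p * b else 0 else 0)"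
        using y q by (intro sum.cong refl) (auto simp: triple_op_def when_def split: if_splits)
      finally show ?thesis by (simp add: sum.inter_filter)
    qed
    have lf: "lookup (gcv y (single q b)) (?f p) = lookup y p * b" if "p \<in> ?D" for p
    proof -
      have "lookup (gcv y (single q b)) (?f p) = (\<Sum>p'\<in>?D. if p' = p then lookup y p' * b else 0)"
        unfolding l
      proof (intro sum.cong refl)
        fix p' assume "p' \<in> ?D"
        from inj_on_eq_iff[OF inj this that]
        show "(if ?f p' = ?f p then lookup y p' * b else 0) = (if p' = p then lookup y p' * b else 0)"
          by (rule if_cong) (rule refl)+
      qed
      then show ?thesis using that by simp
    qed
    have "keys (gcv y (single q b)) \<subseteq> ?f ` ?D"
    proof
      fix z assume z: "z \<in> keys (gcv y (single q b))"
      show "z \<in> ?f ` ?D"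
      proof (rule ccontr)
        assume nin: "z \<notin> ?f ` ?D"
        have "lookup (gcv y (single q b)) z = 0"
          unfolding l
        proof (intro sum.neutral ballI)
          fix p assume "p \<in> ?D"
          then have "?f p \<in> ?f ` ?D" by (rule imageI)
          then have "?f p \<noteq> z" using nin by blast
          then show "(if ?f p = z then lookup y p * b else 0) = 0" by (rule if_not_P)
        qed
        then show False using z by (simp add: in_keys_iff)
      qed
    qed
    then have "norm2 (gcv y (single q b)) = (\<Sum>z\<in>?f ` ?D. (cmod (lookup (gcv y (single q b)) z))\<^sup>2)"
      by (intro norm2_superset) auto
    also have "\<dots> = (\<Sum>p\<in>?D. (cmod (lookup (gcv y (single q b)) (?f p)))\<^sup>2)"
      by (rule sum.reindex_cong[OF inj]) auto
    also have "\<dots> = (\<Sum>p\<in>?D. (cmod (lookup y p))\<^sup>2 * (cmod b)\<^sup>2)"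
      using lf by (intro sum.cong refl) (simp add: norm_mult power_mult_distrib)
    also have "\<dots> = (\<Sum>p\<in>?D. (cmod (lookup y p))\<^sup>2) * (cmod b)\<^sup>2" by (simp add: sum_distrib_right)
    also have "\<dots> \<le> norm2 y * (cmod b)\<^sup>2"
      unfolding norm2_def by (intro mult_right_mono sum_mono2) auto
    also have "\<dots> \<le> norm2 y * M" using M norm2_nonneg by (intro mult_left_mono) auto
    finally show ?thesis by (simp add: mult.commute)
  qed
  then show ?case by blast
qed

lemma semigroup_on_carrier: "semigroup_on \<G> (\<otimes>)"
  by unfold_locales (auto simp: m_assoc)

lemma Cauchy_Schwarz_trace:
  assumes f: "keys f \<subseteq> triples n \<G>" and g: "keys g \<subseteq> triples n \<G>"
  shows "(Re (trace (gcv f (star_op g))))\<^sup>2 \<le> norm2 f * norm2 g"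
proof -
  let ?A = "keys f \<union> keys g"
  have "\<bar>Re (trace (gcv f (star_op g)))\<bar> \<le> cmod (\<Sum>p\<in>?A. lookup f p * cnj (lookup g p))"
    using trace_star[OF f g, of ?A] abs_Re_le_cmod[of "\<Sum>p\<in>?A. lookup f p * cnj (lookup g p)"]
    by (simp del: Re_sum)
  also have "\<dots> \<le> (\<Sum>p\<in>?A. cmod (lookup f p) * cmod (lookup g p))"
    by (rule order_trans[OF norm_sum]) (simp add: norm_mult)
  finally have "(Re (trace (gcv f (star_op g))))\<^sup>2 \<le> (\<Sum>p\<in>?A. cmod (lookup f p) * cmod (lookup g p))\<^sup>2"
    using power_mono[of "\<bar>Re (trace (gcv f (star_op g)))\<bar>" _ 2] by simp
  also have "\<dots> \<le> (\<Sum>p\<in>?A. (cmod (lookup f p))\<^sup>2) * (\<Sum>p\<in>?A. (cmod (lookup g p))\<^sup>2)"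
    by (rule Cauchy_Schwarz_sum)
  also have "\<dots> = norm2 f * norm2 g" by (simp add: norm2_superset[of ?A])
  finally show ?thesis .
qed

lemma traced_star_algebra_gcv:
  "traced_star_algebra gcv star_op trace {f. keys f \<subseteq> triples n \<G>} (gun n)"
proof -
  interpret M: mult_mod gcv "coeffs_in {0}"
    by (rule mult_mod_mat_conv[OF cpx.mult_mod_axioms semigroup_on_carrier])
  note kc = keys_mat_conv[OF cpx.mult_mod_axioms semigroup_on_carrier]
  define A where "A = {f :: nat \<times> 'a \<times> nat \<Rightarrow>\<^sub>0 complex. keys f \<subseteq> triples n \<G>}"
  have A: "gun n \<in> A" "\<And>x y. x \<in> A \<Longrightarrow> y \<in> A \<Longrightarrow> x - y \<in> A"
    "\<And>x y. x \<in> A \<Longrightarrow> y \<in> A \<Longrightarrow> gcv x y \<in> A" "\<And>x. x \<in> A \<Longrightarrow> star_op x \<in> A"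
    by (simp_all add: A_def keys_gun keys_diff_subset kc keys_star_op)
  have tr: "trace (gcv x (star_op x)) = of_real (norm2 x)" if "x \<in> A" for x
    using that by (simp add: A_def trace_star_self)
  show ?thesis
    unfolding A_def[symmetric]
  proof
    fix x y assume x: "x \<in> A" and y: "y \<in> A"
    then show "(Re (trace (gcv x (star_op y))))\<^sup>2 \<le> Re (trace (gcv x (star_op x))) * Re (trace (gcv y (star_op y)))"
      using Cauchy_Schwarz_trace[of x n y] by (simp add: tr) (simp add: A_def)
    show "star_op (gcv x y) = gcv (star_op y) (star_op x)" "trace (gcv x y) = trace (gcv y x)"
      using x y by (simp_all add: A_def star_op_gcv trace_comm)
  next
    fix h assume "h \<in> A"
    then obtain M :: nat where M: "\<And>y. y \<in> A \<Longrightarrow> norm2 (gcv y h) \<le> M * norm2 y"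
      using bounded_right_mult[of h n] unfolding A_def by blast
    then show "\<exists>M::nat. \<forall>y\<in>A. Re (trace (gcv (gcv y h) (star_op (gcv y h)))) \<le> M * Re (trace (gcv y (star_op y)))"
      using A(3) \<open>h \<in> A\<close> by (intro exI[of _ M] ballI) (simp add: tr)
  next
    fix x assume x: "x \<in> A"
    show "gcv (gun n) x = x" "gcv x (gun n) = x" "star_op (star_op x) = x"
      using x by (simp_all add: A_def gun_l gun_r star_op_star_op)
    show "Re (trace (gcv x (star_op x))) \<ge> 0" using x by (simp add: tr norm2_nonneg)
    show "Re (trace (gcv x (star_op x))) = 0 \<Longrightarrow> x = 0" using x by (simp add: tr norm2_eq_0)
  qed (simp_all add: A M.distl M.distr M.assoc star_gun star_op_add trace_add)
qed

theorem sfin_mod_complex: "sfin_mod ((*) :: complex \<Rightarrow> complex \<Rightarrow> complex) {0} \<G> (\<otimes>)"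
  unfolding sfin_mod_def
proof (intro allI impI)
  fix n e u v
  assume k: "keys e \<subseteq> triples n \<G>" "keys u \<subseteq> triples n \<G>" "keys v \<subseteq> triples n \<G>"
    and cp: "mult_mod.corner_pair gcv (coeffs_in {0}) e u v"
  interpret M: mult_mod gcv "coeffs_in {0}"
    by (rule mult_mod_mat_conv[OF cpx.mult_mod_axioms semigroup_on_carrier])
  interpret T: traced_star_algebra gcv star_op trace "{f. keys f \<subseteq> triples n \<G>}" "gun n"
    by (rule traced_star_algebra_gcv)
  have c0: "coeffs_in {0} = ({0} :: (nat \<times> 'a \<times> nat \<Rightarrow>\<^sub>0 complex) set)"
    by (auto simp: coeffs_in_def intro!: poly_mapping_eqI)
  have cong: "M.cong_mod f g \<longleftrightarrow> f = g" for f g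
    by (simp only: M.cong_mod_def) (simp add: c0)
  let ?f = "e - gcv v u"
  have "keys ?f \<subseteq> triples n \<G>"
    by (intro keys_diff_subset k keys_mat_conv[OF cpx.mult_mod_axioms semigroup_on_carrier])
  moreover have "gcv ?f ?f = ?f" using M.corner_defect(1)[OF cp] cong by simp
  moreover have "trace ?f = 0"
    using M.corner_pairD(2)[OF cp] trace_comm[OF k(2,3)] cong T.tr_diff by simp
  ultimately have "?f = 0" by (intro T.idempotent_trace_zero) auto
  then show "gcv v u - e \<in> coeffs_in {0}" by (simp add: coeffs_in_def)
qed

end


subsection \<open>Homomorphisms from finitely generated domains to the complex numbers\<close>

definition subring_on :: "'f::comm_ring_1 set \<Rightarrow> bool" where
  "subring_on A \<longleftrightarrow> 1 \<in> A \<and> (\<forall>x\<in>A. \<forall>y\<in>A. x - y \<in> A \<and> x * y \<in> A)"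

lemma subring_onD:
  assumes "subring_on A"
  shows "1 \<in> A" "0 \<in> A" "x \<in> A \<Longrightarrow> y \<in> A \<Longrightarrow> x - y \<in> A" "x \<in> A \<Longrightarrow> y \<in> A \<Longrightarrow> x * y \<in> A"
    "x \<in> A \<Longrightarrow> y \<in> A \<Longrightarrow> x + y \<in> A" "x \<in> A \<Longrightarrow> x ^ n \<in> A"
proof -
  show 1: "1 \<in> A" "x \<in> A \<Longrightarrow> y \<in> A \<Longrightarrow> x - y \<in> A" "x \<in> A \<Longrightarrow> y \<in> A \<Longrightarrow> x * y \<in> A" for x y
    using assms by (auto simp: subring_on_def)
  show 0: "0 \<in> A" using 1(2)[OF 1(1,1)] by simp
  show "x \<in> A \<Longrightarrow> y \<in> A \<Longrightarrow> x + y \<in> A" using 1(2)[of x "0 - y"] 1(2)[OF 0, of y] by simp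
  show "x \<in> A \<Longrightarrow> x ^ n \<in> A" by (induction n) (auto intro: 1)
qed

lemma subring_on_sum: "subring_on A \<Longrightarrow> (\<And>i. i \<in> K \<Longrightarrow> f i \<in> A) \<Longrightarrow> sum f K \<in> A"
  by (induction K rule: infinite_finite_induct) (auto intro: subring_onD)

definition polys_over :: "'f::comm_ring_1 set \<Rightarrow> 'f poly set" where
  "polys_over A = {q. \<forall>i. coeff q i \<in> A}"

lemma polys_over:
  assumes A: "subring_on A"
  shows "p \<in> polys_over A \<Longrightarrow> q \<in> polys_over A \<Longrightarrow> p - q \<in> polys_over A"
    "p \<in> polys_over A \<Longrightarrow> q \<in> polys_over A \<Longrightarrow> p + q \<in> polys_over A"
    "p \<in> polys_over A \<Longrightarrow> q \<in> polys_over A \<Longrightarrow> p * q \<in> polys_over A"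
    "a \<in> A \<Longrightarrow> monom a n \<in> polys_over A"
    "a \<in> A \<Longrightarrow> p \<in> polys_over A \<Longrightarrow> smult a p \<in> polys_over A"
    "0 \<in> polys_over A" "1 \<in> polys_over A"
  using subring_onD[OF A]
  by (auto simp: polys_over_def coeff_mult coeff_1 intro!: subring_on_sum[OF A])

definition adjoin :: "'f::comm_ring_1 set \<Rightarrow> 'f \<Rightarrow> 'f set" where
  "adjoin A x = (\<lambda>q. poly q x) ` polys_over A"

lemma subring_on_adjoin:
  assumes "subring_on A"
  shows "subring_on (adjoin A x)"
proof -
  note P = polys_over[OF assms]
  have "1 \<in> adjoin A x" unfolding adjoin_def by (rule image_eqI[OF _ P(7)]) simp
  moreover have "poly p x - poly q x \<in> adjoin A x" "poly p x * poly q x \<in> adjoin A x"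
    if "p \<in> polys_over A" "q \<in> polys_over A" for p q
    unfolding adjoin_def
    using image_eqI[OF _ P(1)[OF that], of _ "\<lambda>q. poly q x"] image_eqI[OF _ P(3)[OF that], of _ "\<lambda>q. poly q x"]
    by simp_all
  ultimately show ?thesis by (auto simp: subring_on_def adjoin_def)
qed

lemma adjoin_base:
  assumes "subring_on A" "a \<in> A"
  shows "a \<in> adjoin A x"
  unfolding adjoin_def by (rule image_eqI[OF _ polys_over(4)[OF assms, of 0]]) (simp add: poly_monom)

lemma adjoin_generator:
  assumes "subring_on A"
  shows "x \<in> adjoin A x"
  unfolding adjoin_def
  by (rule image_eqI[OF _ polys_over(4)[OF assms subring_onD(1)[OF assms], of 1]]) (simp add: poly_monom)

text \<open>Adjoining the generators one at a time makes induction on them available, both for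
  extending homomorphisms and for the basis theorem.\<close>

primrec gen_subring :: "'f::comm_ring_1 list \<Rightarrow> 'f set" where
  "gen_subring [] = range of_int"
| "gen_subring (x # xs) = adjoin (gen_subring xs) x"

lemma subring_on_gen_subring: "subring_on (gen_subring xs)"
proof (induction xs)
  case Nil
  have "1 = (of_int 1 :: 'a)" by simp
  then show ?case
    by (auto simp: subring_on_def simp flip: of_int_diff of_int_mult)
      (metis of_int_1 rangeI)
qed (simp add: subring_on_adjoin)

lemma gen_subring_generators: "set xs \<subseteq> gen_subring xs"
proof (induction xs)
  case (Cons x xs)
  then show ?case
    using adjoin_generator[OF subring_on_gen_subring[of xs], of x] adjoin_base[OF subring_on_gen_subring[of xs]]
    by auto
qed simp

text \<open>One step of pseudo-division: cross-multiplying with the leading coefficients avoids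
  division. \<open>degree f > 0\<close> excludes two constants, for which the degree would stay
  0.\<close>

lemma degree_reduce:
  fixes f g :: "'f::comm_ring_1 poly"
  assumes "degree g \<le> degree f" "degree f > 0"
  shows "degree (smult (lead_coeff g) f - monom (lead_coeff f) (degree f - degree g) * g) < degree f"
proof -
  let ?h = "smult (lead_coeff g) f - monom (lead_coeff f) (degree f - degree g) * g"
  have "coeff ?h i = 0" if "i \<ge> degree f" for i
  proof (cases "i = degree f")
    case True
    then show ?thesis using assms by (simp add: coeff_monom_mult mult.commute[of "lead_coeff g"])
  next
    case False
    then have "i > degree f" using that by simp
    then have "coeff f i = 0" "coeff g (i - (degree f - degree g)) = 0"
      using assms by (auto intro!: coeff_eq_0)
    then show ?thesis using that by (simp add: coeff_monom_mult)
  qed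
  then have "degree ?h \<le> degree f - 1"
    using assms(2) by (intro degree_le) auto
  then show ?thesis using assms(2) by simp
qed

lemma pseudo_division_over:
  assumes A: "subring_on A" and g: "g \<in> polys_over A" "degree g > 0" and f: "f \<in> polys_over A"
  shows "\<exists>N. \<exists>h\<in>polys_over A. \<exists>r\<in>polys_over A.
    smult (lead_coeff g ^ N) f = g * h + r \<and> degree r < degree g"
  using f
proof (induction "degree f" arbitrary: f rule: less_induct)
  case less
  note P = polys_over[OF A]
  have b: "lead_coeff g \<in> A" "lead_coeff f \<in> A" using g less.prems by (auto simp: polys_over_def)
  show ?case
  proof (cases "degree f < degree g")
    case True
    then show ?thesis using less.prems P(6) by (intro exI[of _ 0] bexI[of _ 0] bexI[of _ f]) auto
  next
    case False
    let ?m = "monom (lead_coeff f) (degree f - degree g)"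
    let ?f = "smult (lead_coeff g) f - ?m * g"
    have "degree ?f < degree f" using False g by (intro degree_reduce) auto
    moreover have "?f \<in> polys_over A" using b g less.prems by (intro P) auto
    ultimately obtain N h r where IH: "h \<in> polys_over A" "r \<in> polys_over A"
      "smult (lead_coeff g ^ N) ?f = g * h + r" "degree r < degree g"
      using less.hyps by blast
    have "smult (lead_coeff g ^ Suc N) f = g * (h + smult (lead_coeff g ^ N) ?m) + r"
      using IH(3) by (simp add: smult_diff_right algebra_simps mult_smult_right)
    moreover have "h + smult (lead_coeff g ^ N) ?m \<in> polys_over A"
      using IH b subring_onD(6)[OF A] by (intro P) auto
    ultimately show ?thesis using IH by blast
  qed
qed

locale prime_ideal_on =
  fixes P :: "'f::comm_ring_1 set"
  assumes zero_P: "0 \<in> P" and diff_P: "x \<in> P \<Longrightarrow> y \<in> P \<Longrightarrow> x - y \<in> P"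
    and mult_P: "x \<in> P \<Longrightarrow> x * y \<in> P" and one_P: "1 \<notin> P"
    and prime_P: "x * y \<in> P \<Longrightarrow> x \<in> P \<or> y \<in> P"
begin

lemma mult_P': "y \<in> P \<Longrightarrow> x * y \<in> P"
  using mult_P[of y x] by (simp add: mult.commute)

sublocale mult_mod "(*)" P
  by unfold_locales (auto simp: algebra_simps zero_P diff_P mult_P mult_P')

lemma power_P: "x ^ n \<in> P \<Longrightarrow> x \<in> P"
  by (induction n) (use one_P prime_P in auto)

text \<open>A homomorphism to the complex numbers of the image of \<open>A\<close> in the domain
  modulo \<open>P\<close>, described on representatives.\<close>

definition hom_on :: "'f set \<Rightarrow> ('f \<Rightarrow> complex) \<Rightarrow> bool" where
  "hom_on A \<psi> \<longleftrightarrow> (\<forall>x\<in>A. \<forall>y\<in>A. \<psi> (x + y) = \<psi> x + \<psi> y \<and> \<psi> (x * y) = \<psi> x * \<psi> y) \<and>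
     \<psi> 1 = 1 \<and> (\<forall>x\<in>A \<inter> P. \<psi> x = 0)"

lemma hom_onD:
  assumes "hom_on A \<psi>" "subring_on A"
  shows "x \<in> A \<Longrightarrow> y \<in> A \<Longrightarrow> \<psi> (x + y) = \<psi> x + \<psi> y" "x \<in> A \<Longrightarrow> y \<in> A \<Longrightarrow> \<psi> (x * y) = \<psi> x * \<psi> y"
    "\<psi> 1 = 1" "x \<in> A \<Longrightarrow> x \<in> P \<Longrightarrow> \<psi> x = 0" "\<psi> 0 = 0"
    "x \<in> A \<Longrightarrow> y \<in> A \<Longrightarrow> \<psi> (x - y) = \<psi> x - \<psi> y"
proof -
  show *: "x \<in> A \<Longrightarrow> y \<in> A \<Longrightarrow> \<psi> (x + y) = \<psi> x + \<psi> y" "x \<in> A \<Longrightarrow> y \<in> A \<Longrightarrow> \<psi> (x * y) = \<psi> x * \<psi> y"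
    "\<psi> 1 = 1" "x \<in> A \<Longrightarrow> x \<in> P \<Longrightarrow> \<psi> x = 0" for x y
    using assms(1) by (auto simp: hom_on_def)
  show "\<psi> 0 = 0" using *(4)[OF subring_onD(2)[OF assms(2)] zero_P] .
  show "x \<in> A \<Longrightarrow> y \<in> A \<Longrightarrow> \<psi> (x - y) = \<psi> x - \<psi> y"
    using *(1)[of "x - y" y] subring_onD(3)[OF assms(2), of x y] by simp
qed

lemma hom_on_sum:
  assumes "hom_on A \<psi>" "subring_on A" "\<And>i. i \<in> K \<Longrightarrow> f i \<in> A"
  shows "\<psi> (sum f K) = (\<Sum>i\<in>K. \<psi> (f i))"
  using assms(3)
  by (induction K rule: infinite_finite_induct)
    (auto simp: hom_onD[OF assms(1,2)] subring_on_sum[OF assms(2)])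

definition evl :: "('f \<Rightarrow> complex) \<Rightarrow> complex \<Rightarrow> 'f poly \<Rightarrow> complex" where
  "evl \<psi> \<xi> q = poly (map_poly \<psi> q) \<xi>"

context
  fixes A and \<psi> :: "'f \<Rightarrow> complex"
  assumes hom: "hom_on A \<psi>" and A: "subring_on A"
begin

lemma coeff_map_psi: "coeff (map_poly \<psi> q) i = \<psi> (coeff q i)"
  by (simp add: coeff_map_poly hom_onD(5)[OF hom A])

lemma evl_hom:
  assumes p: "p \<in> polys_over A" and q: "q \<in> polys_over A"
  shows "evl \<psi> \<xi> (p + q) = evl \<psi> \<xi> p + evl \<psi> \<xi> q" "evl \<psi> \<xi> (p * q) = evl \<psi> \<xi> p * evl \<psi> \<xi> q"
    "evl \<psi> \<xi> (p - q) = evl \<psi> \<xi> p - evl \<psi> \<xi> q"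
proof -
  have c: "coeff p i \<in> A" "coeff q i \<in> A" for i using p q by (auto simp: polys_over_def)
  have "map_poly \<psi> (p + q) = map_poly \<psi> p + map_poly \<psi> q"
    by (rule poly_eqI) (simp add: coeff_map_psi hom_onD[OF hom A] c)
  moreover have "map_poly \<psi> (p - q) = map_poly \<psi> p - map_poly \<psi> q"
    by (rule poly_eqI) (simp add: coeff_map_psi hom_onD[OF hom A] c)
  moreover have "map_poly \<psi> (p * q) = map_poly \<psi> p * map_poly \<psi> q"
    by (rule poly_eqI)
      (simp add: coeff_map_psi coeff_mult hom_on_sum[OF hom A] hom_onD[OF hom A] c subring_onD[OF A])
  ultimately show "evl \<psi> \<xi> (p + q) = evl \<psi> \<xi> p + evl \<psi> \<xi> q" "evl \<psi> \<xi> (p * q) = evl \<psi> \<xi> p * evl \<psi> \<xi> q"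
    "evl \<psi> \<xi> (p - q) = evl \<psi> \<xi> p - evl \<psi> \<xi> q"
    by (simp_all add: evl_def)
qed

lemma evl_monom: "evl \<psi> \<xi> (monom a n) = \<psi> a * \<xi> ^ n"
  by (simp add: evl_def map_poly_monom hom_onD[OF hom A] poly_monom)

lemma evl_smult:
  assumes "a \<in> A" "q \<in> polys_over A"
  shows "evl \<psi> \<xi> (smult a q) = \<psi> a * evl \<psi> \<xi> q"
  using evl_hom(2)[OF polys_over(4)[OF A assms(1), of 0] assms(2), of \<xi>]
    evl_monom[of \<xi> a 0]
  by (simp add: monom_0)

lemma evl_coeffs_in_P:
  assumes "q \<in> polys_over A" "\<And>i. coeff q i \<in> P"
  shows "evl \<psi> \<xi> q = 0"
proof -
  have "map_poly \<psi> q = 0"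
    using assms by (intro poly_eqI) (auto simp: coeff_map_psi polys_over_def hom_onD[OF hom A])
  then show ?thesis by (simp add: evl_def)
qed

text \<open>The hypothesis makes the value at \<open>\<xi>\<close> independent of the polynomial
  that represents an element of \<open>adjoin A x\<close>, so \<open>x\<close> may be sent to
  \<open>\<xi>\<close>.\<close>

lemma hom_on_adjoin:
  assumes wd: "\<And>q. q \<in> polys_over A \<Longrightarrow> poly q x \<in> P \<Longrightarrow> evl \<psi> \<xi> q = 0"
  shows "\<exists>\<psi>'. hom_on (adjoin A x) \<psi>' \<and> (\<forall>q\<in>polys_over A. \<psi>' (poly q x) = evl \<psi> \<xi> q)"
proof -
  note PA = polys_over[OF A]
  define \<psi>' where "\<psi>' b = evl \<psi> \<xi> (SOME q. q \<in> polys_over A \<and> poly q x = b)" for b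
  have val: "\<psi>' (poly q x) = evl \<psi> \<xi> q" if q: "q \<in> polys_over A" for q
  proof -
    let ?q = "SOME q'. q' \<in> polys_over A \<and> poly q' x = poly q x"
    have s: "?q \<in> polys_over A" "poly ?q x = poly q x"
      using someI[of "\<lambda>q'. q' \<in> polys_over A \<and> poly q' x = poly q x" q] q by auto
    have "poly (?q - q) x \<in> P" by (simp add: s zero_P)
    then have "evl \<psi> \<xi> (?q - q) = 0" by (intro wd PA(1) s q)
    then show ?thesis by (simp add: \<psi>'_def evl_hom(3)[OF s(1) q])
  qed
  have "hom_on (adjoin A x) \<psi>'"
    unfolding hom_on_def
  proof (intro conjI ballI)
    fix b c assume "b \<in> adjoin A x" "c \<in> adjoin A x"
    then obtain p q where pq: "p \<in> polys_over A" "q \<in> polys_over A" "b = poly p x" "c = poly q x"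
      by (auto simp: adjoin_def)
    show "\<psi>' (b + c) = \<psi>' b + \<psi>' c" "\<psi>' (b * c) = \<psi>' b * \<psi>' c"
      using val[OF PA(2)[OF pq(1,2)]] val[OF PA(3)[OF pq(1,2)]] pq
      by (simp_all add: val evl_hom)
  next
    have "\<psi>' (poly 1 x) = evl \<psi> \<xi> 1" by (rule val[OF PA(7)])
    then show "\<psi>' 1 = 1" by (simp add: evl_def map_poly_1' hom_onD[OF hom A])
  next
    fix b assume "b \<in> adjoin A x \<inter> P"
    then show "\<psi>' b = 0" using val wd by (auto simp: adjoin_def)
  qed
  with val show ?thesis by blast
qed

end

text \<open>Deleting the coefficients in \<open>P\<close> normalizes a polynomial over the quotient
  domain: its leading coefficient is nonzero there, and degrees have their usual meaning.\<close>

definition strip :: "'f poly \<Rightarrow> 'f poly" where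
  "strip q = map_poly (\<lambda>c. if c \<in> P then 0 else c) q"

lemma coeff_strip: "coeff (strip q) i = (if coeff q i \<in> P then 0 else coeff q i)"
  by (simp add: strip_def coeff_map_poly)

lemma strip_over: "subring_on A \<Longrightarrow> q \<in> polys_over A \<Longrightarrow> strip q \<in> polys_over A"
  using subring_onD(2) by (auto simp: polys_over_def coeff_strip)

lemma lead_coeff_strip: "strip q \<noteq> 0 \<Longrightarrow> lead_coeff (strip q) \<notin> P"
  using coeff_strip[of q "degree (strip q)"] by (auto split: if_splits)

lemma degree_strip: "degree (strip q) \<le> degree q"
  by (rule degree_le) (auto simp: coeff_strip coeff_eq_0)

lemma coeff_diff_strip: "coeff (q - strip q) i \<in> P"
  by (simp add: coeff_strip zero_P)

lemma poly_coeffs_in_P: "(\<And>i. coeff q i \<in> P) \<Longrightarrow> poly q x \<in> P"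
  unfolding poly_altdef by (intro sum_in mult_P) auto

lemma poly_strip: "poly q x \<in> P \<longleftrightarrow> poly (strip q) x \<in> P"
proof -
  have "poly q x - poly (strip q) x \<in> P"
    using poly_coeffs_in_P[of "q - strip q" x] coeff_diff_strip by simp
  then show ?thesis using cong_in cong_mod_def by blast
qed

lemma strip_eq_0: "strip q = 0 \<longleftrightarrow> (\<forall>i. coeff q i \<in> P)"
  by (auto simp: poly_eq_iff coeff_strip zero_P split: if_splits)

text \<open>If \<open>x\<close> is transcendental over \<open>A\<close> modulo \<open>P\<close>,
  take for \<open>u\<close> a coefficient of a polynomial representing \<open>v\<close>;
  \<open>\<xi>\<close> only has to avoid finitely many roots. If \<open>x\<close> is algebraic, some
  multiple of \<open>v\<close> is a nonzero constant \<open>c\<close>; with \<open>a\<close> the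
  leading coefficient of a polynomial \<open>p\<close> of least degree vanishing at
  \<open>x\<close>, take \<open>u = a * c\<close> and for \<open>\<xi>\<close> a root of the image
  of \<open>p\<close>.\<close>

lemma extend_hom:
  assumes A: "subring_on A" and v: "v \<in> adjoin A x" "v \<notin> P"
  shows "\<exists>u\<in>A. u \<notin> P \<and> (\<forall>\<psi>. hom_on A \<psi> \<and> \<psi> u \<noteq> 0 \<longrightarrow> (\<exists>\<psi>'. hom_on (adjoin A x) \<psi>' \<and> \<psi>' v \<noteq> 0))"
proof -
  note PA = polys_over[OF A]
  from v obtain q0 where q0: "q0 \<in> polys_over A" "v = poly q0 x" by (auto simp: adjoin_def)
  define Q where "Q d \<longleftrightarrow> (\<exists>p\<in>polys_over A. degree p = d \<and> lead_coeff p \<notin> P \<and> poly p x \<in> P)" for d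
  show ?thesis
  proof (cases "\<exists>d. Q d")
    case False
    have all: "coeff q i \<in> P" if q: "q \<in> polys_over A" "poly q x \<in> P" for q i
    proof (rule ccontr)
      assume "coeff q i \<notin> P"
      then have "strip q \<noteq> 0" by (auto simp: strip_eq_0)
      then have "Q (degree (strip q))"
        unfolding Q_def using strip_over[OF A q(1)] lead_coeff_strip q(2) poly_strip by blast
      then show False using False by blast
    qed
    have "\<exists>i. coeff q0 i \<notin> P" using poly_coeffs_in_P[of q0 x] v q0 by blast
    then obtain i where i: "coeff q0 i \<notin> P" by blast
    show ?thesis
    proof (intro bexI[of _ "coeff q0 i"] conjI allI impI i)
      show "coeff q0 i \<in> A" using q0 by (auto simp: polys_over_def)
      fix \<psi> assume \<psi>: "hom_on A \<psi> \<and> \<psi> (coeff q0 i) \<noteq> 0"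
      then have hom: "hom_on A \<psi>" by blast
      have "map_poly \<psi> q0 \<noteq> 0" using \<psi> coeff_map_psi[OF hom A, of q0 i] by auto
      then have "finite {z. poly (map_poly \<psi> q0) z = 0}" by (rule poly_roots_finite)
      then have "{z. poly (map_poly \<psi> q0) z = 0} \<noteq> UNIV" using infinite_UNIV_char_0 by metis
      then obtain \<xi> where \<xi>: "evl \<psi> \<xi> q0 \<noteq> 0" by (auto simp: evl_def)
      have "evl \<psi> \<xi> q = 0" if "q \<in> polys_over A" "poly q x \<in> P" for q
        using evl_coeffs_in_P[OF hom A that(1)] all[OF that] by blast
      then show "\<exists>\<psi>'. hom_on (adjoin A x) \<psi>' \<and> \<psi>' v \<noteq> 0"
        using hom_on_adjoin[OF hom A, of x \<xi>] \<xi> q0 by auto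
    qed
  next
    case True
    define d where "d = (LEAST d. Q d)"
    have "Q d" unfolding d_def using True by (rule LeastI_ex)
    then obtain p where p: "p \<in> polys_over A" "degree p = d" "lead_coeff p \<notin> P" "poly p x \<in> P"
      by (auto simp: Q_def)
    define a where "a = lead_coeff p"
    have aA: "a \<in> A" using p by (auto simp: a_def polys_over_def)
    have min: "d \<le> degree q" if "q \<in> polys_over A" "lead_coeff q \<notin> P" "poly q x \<in> P" for q
      unfolding d_def using that by (intro Least_le) (auto simp: Q_def)
    have d: "d > 0"
    proof (rule ccontr)
      assume "\<not> d > 0"
      then have "p = [:coeff p 0:]" using degree_0_id[of p] p(2) by simp
      then have "poly p x = coeff p 0" by (metis poly_const_conv)
      then show False using p \<open>\<not> d > 0\<close> by simp
    qed
    have small: "coeff q i \<in> P" if q: "q \<in> polys_over A" "poly q x \<in> P" "degree q < d" for q i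
    proof (rule ccontr)
      assume "coeff q i \<notin> P"
      then have "strip q \<noteq> 0" by (auto simp: strip_eq_0)
      then have "d \<le> degree (strip q)"
        using q(2) poly_strip by (intro min strip_over[OF A q(1)] lead_coeff_strip) auto
      then show False using q(3) degree_strip[of q] by simp
    qed
    \<comment> \<open>\<open>S q\<close> says that the value of \<open>q\<close> at \<open>x\<close>
      is a nonzero multiple of \<open>v\<close> modulo \<open>P\<close>. The aim is such a
      \<open>q\<close> of degree 0, which amounts to inverting \<open>v\<close> up to a
      constant.\<close>
    define S where "S q \<longleftrightarrow> q \<in> polys_over A \<and> poly q x \<notin> P \<and> (\<exists>h\<in>polys_over A. v * poly h x - poly q x \<in> P)" for q
    have "S q0" unfolding S_def using q0 v PA(7) zero_P by (auto intro!: bexI[of _ 1])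
    then obtain q1' where q1': "S q1'" and q1_min': "\<And>q. S q \<Longrightarrow> degree q1' \<le> degree q"
      using ex_has_least_nat[of S q0 degree] by blast
    define q1 where "q1 = strip q1'"
    have q1: "q1 \<in> polys_over A" "poly q1 x \<notin> P"
      using q1' strip_over[OF A] poly_strip by (auto simp: S_def q1_def)
    then have "q1 \<noteq> 0" using zero_P by auto
    define b where "b = lead_coeff q1"
    have b: "b \<notin> P" "b \<in> A"
      using lead_coeff_strip[of q1'] \<open>q1 \<noteq> 0\<close> q1 by (auto simp: b_def q1_def polys_over_def)
    obtain h1 where h1: "h1 \<in> polys_over A" "v * poly h1 x - poly q1 x \<in> P"
    proof -
      obtain h where h: "h \<in> polys_over A" "v * poly h x - poly q1' x \<in> P" using q1' by (auto simp: S_def)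
      have "poly (q1' - q1) x \<in> P" unfolding q1_def by (intro poly_coeffs_in_P coeff_diff_strip)
      then have "v * poly h x - poly q1 x \<in> P" using add_in[OF h(2), of "poly (q1' - q1) x"] by simp
      with h that show thesis by blast
    qed
    have q1_min: "degree q1 \<le> degree q" if "S q" for q
      using q1_min'[OF that] degree_strip[of q1'] by (simp add: q1_def)
    \<comment> \<open>Otherwise \<open>q1\<close>, whose degree is below that of \<open>p\<close>,
      is pseudo-divided into \<open>p\<close>. By minimality of \<open>q1\<close> the remainder
      vanishes at \<open>x\<close>, hence is zero modulo \<open>P\<close>; then the quotient
      \<open>h\<close> vanishes at \<open>x\<close>, so by minimality of \<open>p\<close> the
      product of \<open>q1\<close> and \<open>h\<close> has too large a degree.\<close>
    have "degree q1 = 0"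
    proof (rule ccontr)
      assume e: "degree q1 \<noteq> 0"
      have ed: "degree q1 < d"
      proof (rule ccontr)
        assume "\<not> degree q1 < d"
        then have le: "degree p \<le> degree q1" using p by simp
        let ?q = "smult a q1 - monom b (degree q1 - degree p) * p"
        have dq: "degree ?q < degree q1"
          unfolding a_def b_def by (rule degree_reduce[OF le]) (use e in simp)
        have qA: "?q \<in> polys_over A" using aA b q1 p by (intro PA) auto
        have val: "poly ?q x = a * poly q1 x - b * x ^ (degree q1 - degree p) * poly p x"
          by (simp add: poly_monom)
        have "S ?q"
          unfolding S_def
        proof (intro conjI qA)
          have "b * x ^ (degree q1 - degree p) * poly p x \<in> P" using p(4) by (rule mul_in_r)
          then have c: "a * poly q1 x - poly ?q x \<in> P" unfolding val by simp
          have "a * poly q1 x \<notin> P" using prime_P p(3) q1(2) by (auto simp: a_def)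
          then show "poly ?q x \<notin> P" using c cong_in cong_mod_def by blast
          have "a * (v * poly h1 x - poly q1 x) \<in> P" using h1(2) by (rule mul_in_r)
          then have "v * poly (smult a h1) x - poly ?q x \<in> P"
            using add_in[OF _ c] by (fastforce simp: algebra_simps)
          then show "\<exists>h\<in>polys_over A. v * poly h x - poly ?q x \<in> P" using PA(5)[OF aA h1(1)] by blast
        qed
        then show False using q1_min dq by fastforce
      qed
      obtain N h r where div: "h \<in> polys_over A" "r \<in> polys_over A"
        "smult (b ^ N) p = q1 * h + r" "degree r < degree q1"
        using pseudo_division_over[OF A q1(1) _ p(1)] e unfolding b_def by auto
      have bN: "b ^ N \<notin> P" using power_P b by blast
      have "poly (smult (b ^ N) p) x \<in> P" using p(4) by (simp add: mul_in_r)
      then have qhr: "poly q1 x * poly h x + poly r x \<in> P" by (simp add: div)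
      have "poly r x \<in> P"
      proof (rule ccontr)
        assume r: "poly r x \<notin> P"
        \<comment> \<open>Modulo \<open>P\<close> one has v h1 = q1 and q1 h + r = 0 at
          \<open>x\<close>, so r is the multiple of \<open>v\<close> by - h1 h, against the
          minimality of \<open>q1\<close>.\<close>
        have "(v * poly h1 x - poly q1 x) * poly h x \<in> P" using h1(2) by (rule mult_P)
        then have "(v * poly h1 x - poly q1 x) * poly h x + (poly q1 x * poly h x + poly r x) \<in> P"
          using qhr by (rule add_in)
        then have "- ((v * poly h1 x - poly q1 x) * poly h x + (poly q1 x * poly h x + poly r x)) \<in> P"
          by (rule uminus_in)
        moreover have "- ((v * poly h1 x - poly q1 x) * poly h x + (poly q1 x * poly h x + poly r x)) =
          v * poly (0 - h1 * h) x - poly r x"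
          by (simp add: algebra_simps)
        ultimately have "v * poly (0 - h1 * h) x - poly r x \<in> P" by (simp only:)
        then have "S r" unfolding S_def using r div(2) PA(1)[OF PA(6) PA(3)[OF h1(1) div(1)]] by blast
        then show False using q1_min div(4) by fastforce
      qed
      then have rP: "coeff r i \<in> P" for i using small div ed by simp
      have "poly q1 x * poly h x \<in> P" using diff_P[OF qhr \<open>poly r x \<in> P\<close>] by simp
      then have hP: "poly h x \<in> P" using prime_P q1(2) by blast
      have coeff_p: "b ^ N * coeff p i - coeff (q1 * strip h) i \<in> P" for i
      proof -
        have "coeff (q1 * (h - strip h)) i \<in> P"
          unfolding coeff_mult by (intro sum_in mul_in_r coeff_diff_strip)
        moreover have "b ^ N * coeff p i = coeff (q1 * h) i + coeff r i"
          using arg_cong[OF div(3), of "\<lambda>q. coeff q i"] by simp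
        ultimately show ?thesis using add_in[OF _ rP[of i]] by (fastforce simp: algebra_simps)
      qed
      show False
      proof (cases "strip h = 0")
        case True
        then have "b ^ N * a \<in> P" using coeff_p[of "degree p"] by (simp add: a_def)
        then show False using prime_P bN p(3) by (auto simp: a_def)
      next
        case False
        have dh: "d \<le> degree (strip h)"
          using hP poly_strip by (intro min strip_over[OF A div(1)] lead_coeff_strip[OF False]) auto
        \<comment> \<open>This index exceeds the degree of \<open>p\<close>, yet the product of
          leading coefficients found there is outside the prime ideal.\<close>
        let ?i = "degree q1 + degree (strip h)"
        have "coeff p ?i = 0" using p(2) dh e by (intro coeff_eq_0) simp
        moreover have "coeff (q1 * strip h) ?i = b * lead_coeff (strip h)"
          by (simp add: coeff_mult_degree_sum b_def)
        ultimately have "- (b * lead_coeff (strip h)) \<in> P" using coeff_p[of ?i] by simp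
        then have "b * lead_coeff (strip h) \<in> P" using uminus_in by fastforce
        then show False using prime_P b lead_coeff_strip[OF False] by blast
      qed
    qed
    define c where "c = coeff q1 0"
    have q1c: "q1 = [:c:]" using degree_0_id[OF \<open>degree q1 = 0\<close>] by (simp add: c_def)
    have val: "poly q1 x = c" by (subst q1c) simp
    have c: "c \<in> A" "c \<notin> P"
      using q1 val by (auto simp: polys_over_def c_def)
    show ?thesis
    proof (intro bexI[of _ "a * c"] conjI allI impI)
      show "a * c \<in> A" using aA c subring_onD(4)[OF A] by blast
      show "a * c \<notin> P" using prime_P p(3) c(2) by (auto simp: a_def)
      fix \<psi> assume \<psi>: "hom_on A \<psi> \<and> \<psi> (a * c) \<noteq> 0"
      then have hom: "hom_on A \<psi>" by blast
      note H = hom_onD[OF hom A]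
      have ac: "\<psi> a \<noteq> 0" "\<psi> c \<noteq> 0" using \<psi> H(2)[OF aA c(1)] by auto
      \<comment> \<open>As \<open>\<psi> a\<close> is nonzero, the image of \<open>p\<close> stays
        nonconstant and has a complex root.\<close>
      have "coeff (map_poly \<psi> p) d \<noteq> 0" using ac p(2) by (simp add: coeff_map_psi[OF hom A] a_def)
      then have "degree (map_poly \<psi> p) \<noteq> 0" using d le_degree by fastforce
      then have "\<not> constant (poly (map_poly \<psi> p))" by (simp add: constant_degree)
      then obtain \<xi> where \<xi>: "evl \<psi> \<xi> p = 0" using fundamental_theorem_of_algebra by (auto simp: evl_def)
      \<comment> \<open>Reduction modulo \<open>p\<close>: once stripped, a nonzero polynomial
        vanishing at \<open>x\<close> has degree at least that of \<open>p\<close>, and a step of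
        pseudo-division lowers it. The factor introduced is \<open>\<psi> a\<close>, which can be
        cancelled.\<close>
      have wd: "evl \<psi> \<xi> q = 0" if "q \<in> polys_over A" "poly q x \<in> P" for q
        using that
      proof (induction "degree q" arbitrary: q rule: less_induct)
        case less
        have sA: "strip q \<in> polys_over A" using strip_over[OF A less.prems(1)] .
        have "evl \<psi> \<xi> (q - strip q) = 0"
          using evl_coeffs_in_P[OF hom A PA(1)[OF less.prems(1) sA] coeff_diff_strip] .
        then have eq: "evl \<psi> \<xi> q = evl \<psi> \<xi> (strip q)"
          using evl_hom(3)[OF hom A less.prems(1) sA] by simp
        show ?case
        proof (cases "strip q = 0")
          case True
          then show ?thesis using eq by (simp add: evl_def)
        next
          case False
          define s where "s = strip q"
          have s: "s \<in> polys_over A" "poly s x \<in> P" "lead_coeff s \<notin> P" "degree s \<le> degree q"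
            using sA less.prems(2) poly_strip lead_coeff_strip[OF False] degree_strip by (auto simp: s_def)
          have le: "degree p \<le> degree s" using min[OF s(1,3,2)] p by simp
          let ?m = "monom (lead_coeff s) (degree s - degree p)"
          let ?q = "smult (lead_coeff p) s - ?m * p"
          have lA: "lead_coeff s \<in> A" using s by (auto simp: polys_over_def)
          have "degree ?q < degree q"
            using degree_reduce[OF le] le d p s(4) by simp
          moreover have "?q \<in> polys_over A" using aA lA s p by (intro PA) (auto simp: a_def)
          moreover have "poly ?q x \<in> P" using s(2) p(4) by (simp add: diff_P mul_in_r)
          ultimately have "evl \<psi> \<xi> ?q = 0" by (rule less.hyps)
          moreover have "evl \<psi> \<xi> ?q = \<psi> a * evl \<psi> \<xi> s - evl \<psi> \<xi> ?m * evl \<psi> \<xi> p"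
            using evl_hom[OF hom A] evl_smult[OF hom A aA s(1)] PA(5)[OF aA s(1)]
              PA(3)[OF PA(4)[OF lA] p(1)] PA(4)[OF lA] p(1)
            by (simp add: a_def)
          ultimately show ?thesis using ac \<xi> eq by (simp add: s_def)
        qed
      qed
      obtain \<psi>' where \<psi>': "hom_on (adjoin A x) \<psi>'" "\<And>q. q \<in> polys_over A \<Longrightarrow> \<psi>' (poly q x) = evl \<psi> \<xi> q"
        using hom_on_adjoin[OF hom A wd] by blast
      note SB = subring_on_adjoin[OF A, of x]
      note H' = hom_onD[OF \<psi>'(1) SB]
      have mem: "poly q x \<in> adjoin A x" if "q \<in> polys_over A" for q using that by (auto simp: adjoin_def)
      have m2: "v * poly h1 x \<in> adjoin A x" using subring_onD(4)[OF SB v(1) mem[OF h1(1)]] .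
      have "\<psi>' (v * poly h1 x - poly q1 x) = 0"
        using H'(4)[OF _ h1(2)] subring_onD(3)[OF SB m2 mem[OF q1(1)]] by blast
      then have "\<psi>' v * \<psi>' (poly h1 x) = \<psi>' (poly q1 x)"
        using H'(6)[OF m2 mem[OF q1(1)]] H'(2)[OF v(1) mem[OF h1(1)]] by simp
      also have "\<dots> = \<psi> c"
        using \<psi>'(2)[OF q1(1)] evl_monom[OF hom A, of \<xi> c 0] q1c by (simp add: monom_0)
      finally have "\<psi>' v \<noteq> 0" using ac by auto
      then show "\<exists>\<psi>'. hom_on (adjoin A x) \<psi>' \<and> \<psi>' v \<noteq> 0" using \<psi>'(1) by blast
    qed
  qed
qed

text \<open>Induction on the generators, with the witness \<open>u\<close> of
  \<open>extend_hom\<close> as the element to be kept nonzero one stage earlier. The start is the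
  embedding of the integers, where characteristic zero enters.\<close>

theorem ex_complex_hom:
  assumes char0: "\<And>n::nat. n > 0 \<Longrightarrow> of_nat n \<notin> P"
    and v: "v \<in> gen_subring xs" "v \<notin> P"
  shows "\<exists>\<psi>. hom_on (gen_subring xs) \<psi> \<and> \<psi> v \<noteq> 0"
  using v
proof (induction xs arbitrary: v)
  case Nil
  have zero: "k = 0" if "of_int k \<in> P" for k :: int
  proof (rule ccontr)
    assume "k \<noteq> 0"
    then have "of_nat (nat \<bar>k\<bar>) \<notin> P" by (intro char0) auto
    then show False using that uminus_in[OF that] by (cases "k \<ge> 0") auto
  qed
  have inj: "k = l" if "of_int k = (of_int l :: 'f)" for k l :: int
    using zero[of "k - l"] that zero_P by simp
  define \<psi> :: "'f \<Rightarrow> complex" where "\<psi> b = of_int (THE k. of_int k = b)" for b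
  have \<psi>: "\<psi> (of_int k) = of_int k" for k
  proof -
    have "(THE l. of_int l = (of_int k :: 'f)) = k" by (rule the_equality) (auto intro: inj)
    then show ?thesis by (simp add: \<psi>_def)
  qed
  have "hom_on (range of_int) \<psi>"
    unfolding hom_on_def
  proof (intro conjI ballI)
    fix x y :: 'f assume "x \<in> range of_int" "y \<in> range of_int"
    then obtain k l where "x = of_int k" "y = of_int l" by auto
    then show "\<psi> (x + y) = \<psi> x + \<psi> y" "\<psi> (x * y) = \<psi> x * \<psi> y"
      using \<psi>[of "k + l"] \<psi>[of "k * l"] by (simp_all add: \<psi>)
  next
    show "\<psi> 1 = 1" using \<psi>[of 1] by simp
    fix x assume "x \<in> range of_int \<inter> P"
    then obtain k :: int where k: "x = of_int k" "of_int k \<in> P" by auto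
    then have "k = 0" using zero by blast
    then show "\<psi> x = 0" using k \<psi>[of k] by simp
  qed
  moreover have "\<psi> v \<noteq> 0" using Nil zero_P \<psi> by auto
  ultimately show ?case by auto
next
  case (Cons x xs)
  then obtain u where u: "u \<in> gen_subring xs" "u \<notin> P"
    "\<And>\<psi>. hom_on (gen_subring xs) \<psi> \<Longrightarrow> \<psi> u \<noteq> 0 \<Longrightarrow> \<exists>\<psi>'. hom_on (adjoin (gen_subring xs) x) \<psi>' \<and> \<psi>' v \<noteq> 0"
    using extend_hom[OF subring_on_gen_subring, of v xs x] by auto
  then show ?case using Cons.IH[OF u(1,2)] by auto
qed

end

section \<open>Group rings over domains of characteristic zero\<close>

lemma coeffs_in_conv_closed:
  fixes A :: "'f::ring_1 set"
  assumes zero: "0 \<in> A" and add: "\<And>x y. x \<in> A \<Longrightarrow> y \<in> A \<Longrightarrow> x + y \<in> A"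
    and mult: "\<And>x y. x \<in> A \<Longrightarrow> y \<in> A \<Longrightarrow> x * y \<in> A"
    and f: "f \<in> coeffs_in A" and g: "g \<in> coeffs_in A"
  shows "conv (*) op f g \<in> coeffs_in A"
proof -
  have sum: "sum h K \<in> A" if "\<And>i. i \<in> K \<Longrightarrow> h i \<in> A" for h and K :: "'k set"
    using that by (induction K rule: infinite_finite_induct) (auto simp: zero add)
  have sum': "sum h K \<in> A" if "\<And>i. i \<in> K \<Longrightarrow> h i \<in> A" for h and K :: "'l set"
    using that by (induction K rule: infinite_finite_induct) (auto simp: zero add)
  have "lookup f p * lookup g q \<in> A" for p q
    using f g mult by (simp add: coeffs_in_def)
  then show ?thesis
    unfolding conv_def coeffs_in_def
    by (auto simp: lookup_sum when_def lookup_single zero split: option.split intro!: sum sum')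
qed

lemma (in prime_ideal_on) map_hom_conv:
  assumes hom: "hom_on A \<psi>" and A: "subring_on A" and f: "f \<in> coeffs_in A" and g: "g \<in> coeffs_in A"
  shows "Poly_Mapping.map \<psi> (conv (*) op f g) = conv (*) op (Poly_Mapping.map \<psi> f) (Poly_Mapping.map \<psi> g)"
proof (rule poly_mapping_eqI)
  fix z
  note H = hom_onD[OF hom A]
  have l: "lookup (Poly_Mapping.map \<psi> f) p = \<psi> (lookup f p)" for f :: "'p \<Rightarrow>\<^sub>0 'f" and p
    using H(5) by (auto simp: Poly_Mapping.map.rep_eq when_def)
  have k: "keys (Poly_Mapping.map \<psi> f) \<subseteq> keys f" for f :: "'p \<Rightarrow>\<^sub>0 'f"
    using H(5) by (auto simp: in_keys_iff l)
  have fg: "lookup f p \<in> A" "lookup g q \<in> A" for p q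
    using f g by (auto simp: coeffs_in_def)
  have mem: "(lookup f p * lookup g q when op p q = Some z) \<in> A" for p q
    using subring_onD(2,4)[OF A] fg by (simp add: when_def)
  have \<psi>: "\<psi> (lookup f p * lookup g q when op p q = Some z) =
      (\<psi> (lookup f p) * \<psi> (lookup g q) when op p q = Some z)" for p q
    using H(2)[OF fg] H(5) by (simp add: when_def)
  have "lookup (Poly_Mapping.map \<psi> (conv (*) op f g)) z =
      \<psi> (\<Sum>p\<in>keys f. \<Sum>q\<in>keys g. lookup f p * lookup g q when op p q = Some z)"
    by (simp add: l lookup_conv[of "keys f" "keys g"])
  also have "\<dots> = (\<Sum>p\<in>keys f. \<Sum>q\<in>keys g. \<psi> (lookup f p) * \<psi> (lookup g q) when op p q = Some z)"
    by (simp add: hom_on_sum[OF hom A] mem subring_on_sum[OF A] \<psi>)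
  also have "\<dots> = lookup (conv (*) op (Poly_Mapping.map \<psi> f) (Poly_Mapping.map \<psi> g)) z"
    by (subst cpx.lookup_conv[OF finite_keys finite_keys k k]) (simp add: l)
  finally show "lookup (Poly_Mapping.map \<psi> (conv (*) op f g)) z =
    lookup (conv (*) op (Poly_Mapping.map \<psi> f) (Poly_Mapping.map \<psi> g)) z" .
qed

theorem (in group) sfin_mod_prime:
  fixes P :: "'f::comm_ring_1 set"
  assumes "prime_ideal_on P" and char0: "\<And>n::nat. n > 0 \<Longrightarrow> of_nat n \<notin> P"
  shows "sfin_mod (*) P (carrier G) (\<otimes>)"
  unfolding sfin_mod_def
proof (intro allI impI)
  interpret P: prime_ideal_on P by (rule assms(1))
  let ?C = "carrier G"
  define cv :: "(nat \<times> 'a \<times> nat \<Rightarrow>\<^sub>0 'f) \<Rightarrow> _" where "cv = mat_conv (*) ?C (\<otimes>)"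
  interpret M: mult_mod cv "coeffs_in P"
    unfolding cv_def by (rule mult_mod_mat_conv[OF P.mult_mod_axioms semigroup_on_carrier])
  interpret N: mult_mod gcv "coeffs_in {0}"
    by (rule mult_mod_mat_conv[OF cpx.mult_mod_axioms semigroup_on_carrier])
  fix n e u v
  assume k: "keys e \<subseteq> triples n ?C" "keys u \<subseteq> triples n ?C" "keys v \<subseteq> triples n ?C"
    and cp: "mult_mod.corner_pair (mat_conv (*) ?C (\<otimes>)) (coeffs_in P) e u v"
  note cp = cp[folded cv_def]
  \<comment> \<open>Finitely many coefficients occur, and those of the defect are integral
    polynomial expressions in them, so a finitely generated subring contains everything.\<close>
  define X where "X = lookup e ` keys e \<union> lookup u ` keys u \<union> lookup v ` keys v"
  have "finite X" by (simp add: X_def)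
  then obtain xs where xs: "set xs = X" using finite_list by blast
  define A where "A = gen_subring xs"
  have A: "subring_on A" unfolding A_def by (rule subring_on_gen_subring)
  have "X \<subseteq> A" unfolding A_def xs[symmetric] by (rule gen_subring_generators)
  moreover have "w \<in> coeffs_in A" if "lookup w ` keys w \<subseteq> A" for w :: "nat \<times> 'a \<times> nat \<Rightarrow>\<^sub>0 'f"
  proof -
    have "lookup w p \<in> A" for p
      using that subring_onD(2)[OF A] by (cases "p \<in> keys w") (auto simp: in_keys_iff)
    then show ?thesis by (simp add: coeffs_in_def)
  qed
  ultimately have euv: "e \<in> coeffs_in A" "u \<in> coeffs_in A" "v \<in> coeffs_in A"
    by (auto simp: X_def)
  have cvA: "cv f g \<in> coeffs_in A" if "f \<in> coeffs_in A" "g \<in> coeffs_in A" for f g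
    unfolding cv_def
    by (rule coeffs_in_conv_closed[OF _ _ _ that]) (use subring_onD[OF A] in auto)
  have diffA: "f - g \<in> coeffs_in A" if "f \<in> coeffs_in A" "g \<in> coeffs_in A" for f g :: "nat \<times> 'a \<times> nat \<Rightarrow>\<^sub>0 'f"
    using that subring_onD(3)[OF A] by (simp add: coeffs_in_def lookup_minus)
  show "mat_conv (*) ?C (\<otimes>) v u - e \<in> coeffs_in P"
    unfolding cv_def[symmetric]
  proof (rule ccontr)
    assume "cv v u - e \<notin> coeffs_in P"
    then obtain p where p: "lookup (cv v u - e) p \<notin> P" unfolding coeffs_in_def by blast
    have vue: "cv v u - e \<in> coeffs_in A" by (intro diffA cvA euv)
    then have pA: "lookup (cv v u - e) p \<in> gen_subring xs" unfolding coeffs_in_def A_def by blast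
    obtain \<psi> where hom: "P.hom_on A \<psi>" and \<psi>p: "\<psi> (lookup (cv v u - e) p) \<noteq> 0"
      using P.ex_complex_hom[OF char0 pA p] unfolding A_def by blast
    note H = P.hom_onD[OF hom A]
    define \<Psi> where "\<Psi> f = Poly_Mapping.map \<psi> f" for f :: "nat \<times> 'a \<times> nat \<Rightarrow>\<^sub>0 'f"
    have l: "lookup (\<Psi> f) p = \<psi> (lookup f p)" for f p
      using H(5) by (auto simp: \<Psi>_def Poly_Mapping.map.rep_eq when_def)
    have \<Psi>k: "keys (\<Psi> f) \<subseteq> triples n ?C" if "keys f \<subseteq> triples n ?C" for f
    proof
      fix q assume "q \<in> keys (\<Psi> f)"
      then have "lookup f q \<noteq> 0" using H(5) by (auto simp: in_keys_iff l)
      then show "q \<in> triples n ?C" using that by (auto simp: in_keys_iff)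
    qed
    have \<Psi>_cv: "\<Psi> (cv f g) = gcv (\<Psi> f) (\<Psi> g)" if "f \<in> coeffs_in A" "g \<in> coeffs_in A" for f g
      unfolding \<Psi>_def cv_def by (rule P.map_hom_conv[OF hom A that])
    have \<Psi>_eq: "\<Psi> f = \<Psi> g" if "f - g \<in> coeffs_in P" "f \<in> coeffs_in A" "g \<in> coeffs_in A" for f g
    proof (rule poly_mapping_eqI)
      fix q
      have "lookup f q \<in> A" "lookup g q \<in> A" "lookup f q - lookup g q \<in> P"
        using that unfolding coeffs_in_def lookup_minus[symmetric] by blast+
      then show "lookup (\<Psi> f) q = lookup (\<Psi> g) q"
        using H(6)[of "lookup f q" "lookup g q"] H(4)[of "lookup f q - lookup g q"] subring_onD(3)[OF A]
        by (simp add: l)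
    qed
    have "N.corner_pair (\<Psi> e) (\<Psi> u) (\<Psi> v)"
    proof -
      have cong: "N.cong_mod (\<Psi> f) (\<Psi> g)" if "M.cong_mod f g" "f \<in> coeffs_in A" "g \<in> coeffs_in A" for f g
        using \<Psi>_eq[of f g] that by (simp add: M.cong_mod_def)
      show ?thesis
        unfolding N.corner_pair_def using M.corner_pairD[OF cp] euv cvA
        by (simp add: cong flip: \<Psi>_cv)
    qed
    then have "gcv (\<Psi> v) (\<Psi> u) - \<Psi> e \<in> coeffs_in {0}"
      by (rule sfin_modD[OF sfin_mod_complex \<Psi>k[OF k(1)] \<Psi>k[OF k(2)] \<Psi>k[OF k(3)]])
    then have "lookup (gcv (\<Psi> v) (\<Psi> u) - \<Psi> e) p = 0" unfolding coeffs_in_def by blast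
    then have "\<psi> (lookup (cv v u) p) = \<psi> (lookup e p)"
      by (simp add: lookup_minus l flip: \<Psi>_cv[OF euv(3,2)])
    moreover have "lookup (cv v u) p \<in> A" "lookup e p \<in> A"
      using cvA[OF euv(3,2)] euv(1) unfolding coeffs_in_def by blast+
    ultimately show False using \<psi>p by (simp add: lookup_minus H)
  qed
qed


subsection \<open>Chain conditions\<close>

context ring_cover
begin

sublocale unital_mod "(*)" ker 1
  by unfold_locales auto

lemma unital_mod_flip: "unital_mod (flip (*)) ker 1"
proof -
  interpret flip: mult_mod "flip (*)" ker by (rule mult_mod_flip) unfold_locales
  show ?thesis by unfold_locales auto
qed

text \<open>Here \<open>op\<close> and \<open>opR\<close> are the multiplications, or both their opposites.\<close>

lemma chain_stabilizes:
  assumes noeth: "\<And>J :: nat \<Rightarrow> 'a set. (\<And>n. additive_subgroup (J n) R \<and> (\<forall>a\<in>J n. \<forall>x\<in>carrier R. opR x a \<in> J n)) \<Longrightarrow>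
      (\<And>n. J n \<subseteq> J (Suc n)) \<Longrightarrow> \<exists>N. \<forall>n\<ge>N. J n = J N"
    and op: "\<And>x y. ev (op x y) = opR (ev x) (ev y)"
    and L: "\<And>n. 0 \<in> L n" "\<And>n x y. x \<in> L n \<Longrightarrow> y \<in> L n \<Longrightarrow> x - y \<in> L n"
      "\<And>n x a. x \<in> L n \<Longrightarrow> op a x \<in> L n" "\<And>n. ker \<subseteq> L n" "\<And>n. L n \<subseteq> L (Suc n)"
  shows "\<exists>N. \<forall>n\<ge>N. L n = L N"
proof -
  have "additive_subgroup (ev ` L n) R" for n
  proof (rule additive_subgroup.intro, rule add.subgroupI)
    show "ev ` L n \<subseteq> carrier R" by auto
    show "ev ` L n \<noteq> {}" using L(1) by auto
    fix a assume "a \<in> ev ` L n"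
    then obtain x where x: "x \<in> L n" "a = ev x" by auto
    then have "\<ominus> a = ev (0 - x)" by (simp add: ev_uminus)
    then show "\<ominus> a \<in> ev ` L n" using L(2)[OF L(1) x(1)] by blast
    fix b assume "b \<in> ev ` L n"
    then obtain y where y: "y \<in> L n" "b = ev y" by auto
    have "a \<oplus> b = ev (x - (0 - y))" using x y by (simp add: ev_add)
    then show "a \<oplus> b \<in> ev ` L n" using L(2)[OF x(1) L(2)[OF L(1) y(1)]] by blast
  qed
  moreover have "opR r a \<in> ev ` L n" if a: "a \<in> ev ` L n" and r: "r \<in> carrier R" for a r n
  proof -
    obtain x where x: "x \<in> L n" "a = ev x" using a by auto
    obtain y where "ev y = r" using ev_surj[OF r] by blast
    then have "opR r a = ev (op y x)" using x by (simp add: op)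
    then show ?thesis using L(3)[OF x(1)] by blast
  qed
  moreover have "ev ` L n \<subseteq> ev ` L (Suc n)" for n using L(5) by blast
  ultimately obtain N where N: "\<And>n. n \<ge> N \<Longrightarrow> ev ` L n = ev ` L N"
    using noeth[of "\<lambda>n. ev ` L n"] by blast
  have "L n = L N" if "n \<ge> N" for n
  proof
    show "L N \<subseteq> L n" by (rule lift_Suc_mono_le[of L, OF L(5) that])
    show "L n \<subseteq> L N"
    proof
      fix x assume "x \<in> L n"
      then have "ev x \<in> ev ` L N" unfolding N[OF that, symmetric] by (rule imageI)
      then obtain y where y: "y \<in> L N" "ev x = ev y" by auto
      then have "x - y \<in> L N" using L(4)[of N] by (auto simp: ev_eq_iff)
      then have "x - y - (0 - y) \<in> L N" by (rule L(2)[OF _ L(2)[OF L(1) y(1)]])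
      then show "x \<in> L N" by simp
    qed
  qed
  then show ?thesis by blast
qed

lemma left_noetherian_acc:
  assumes "left_noetherian R"
  shows "reg.acc_above ker"
  unfolding reg.acc_above_def
proof (intro allI impI)
  fix L :: "nat \<Rightarrow> 'f set"
  assume L: "\<forall>n. reg.submod (L n) \<and> ker \<subseteq> L n \<and> L n \<subseteq> L (Suc n)"
  show "\<exists>N. \<forall>n\<ge>N. L n = L N"
  proof (rule chain_stabilizes[where op = "(*)" and opR = "monoid.mult R"])
    fix J :: "nat \<Rightarrow> 'a set"
    assume "\<And>n. additive_subgroup (J n) R \<and> (\<forall>a\<in>J n. \<forall>x\<in>carrier R. x \<otimes> a \<in> J n)"
      and "\<And>n. J n \<subseteq> J (Suc n)"
    then show "\<exists>N. \<forall>n\<ge>N. J n = J N"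
      using assms unfolding left_noetherian_def left_ideal_def by blast
  qed (use L in \<open>auto simp: reg.submod_def ev_mult\<close>)
qed

lemma right_noetherian_acc:
  assumes "right_noetherian R"
  shows "left_module.acc_above (flip (*)) ker"
proof -
  interpret U: unital_mod "flip (*)" ker 1 by (rule unital_mod_flip)
  show ?thesis
    unfolding U.reg.acc_above_def
  proof (intro allI impI)
    fix L :: "nat \<Rightarrow> 'f set"
    assume L: "\<forall>n. U.reg.submod (L n) \<and> ker \<subseteq> L n \<and> L n \<subseteq> L (Suc n)"
    show "\<exists>N. \<forall>n\<ge>N. L n = L N"
    proof (rule chain_stabilizes[where op = "flip (*)" and opR = "flip (monoid.mult R)"])
      fix J :: "nat \<Rightarrow> 'a set"
      assume "\<And>n. additive_subgroup (J n) R \<and> (\<forall>a\<in>J n. \<forall>x\<in>carrier R. a \<otimes> x \<in> J n)"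
        and "\<And>n. J n \<subseteq> J (Suc n)"
      then show "\<exists>N. \<forall>n\<ge>N. J n = J N"
        using assms unfolding right_noetherian_def right_ideal_def by blast
    qed (use L in \<open>auto simp: U.reg.submod_def ev_mult\<close>)
  qed
qed

text \<open>A quotient of \<open>R\<close> is covered by the same type class ring with a larger
  kernel, so elements need not be lifted anew and corner pairs remain corner pairs.\<close>

lemma ring_cover_Quot:
  assumes "ideal J R"
  shows "ring_cover (R Quot J) (\<lambda>x. J +> ev x)"
proof -
  interpret J: ideal J R by (rule assms)
  have hom: "(+>) J \<in> ring_hom R (R Quot J)" by (rule J.rcos_ring_hom)
  show ?thesis
  proof (intro ring_cover.intro ring_cover_axioms.intro)
    show "ring (R Quot J)" by (rule J.quotient_is_ring)
    show "\<exists>x. J +> ev x = r" if "r \<in> carrier (R Quot J)" for r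
    proof -
      obtain a where "a \<in> carrier R" "r = J +> a"
        using \<open>r \<in> _\<close> by (auto simp: FactRing_def A_RCOSETS_def')
      then show ?thesis using ev_surj by metis
    qed
  qed (use hom in \<open>auto simp: ring_hom_def ev_add ev_mult ev_one\<close>)
qed

lemma ker_Quot:
  assumes "ideal J R"
  shows "ring_cover.ker (R Quot J) (\<lambda>x. J +> ev x) = {x. ev x \<in> J}"
proof -
  interpret Q: ring_cover "R Quot J" "\<lambda>x. J +> ev x" by (rule ring_cover_Quot[OF assms])
  interpret J: ideal J R by (rule assms)
  have "J +> a = J \<longleftrightarrow> a \<in> J" if "a \<in> carrier R" for a
    using that J.a_rcos_const by (metis J.a_rcos_self)
  moreover have "\<zero>\<^bsub>R Quot J\<^esub> = J" by (simp add: FactRing_def)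
  ultimately show ?thesis by (simp add: Q.ker_def)
qed

end

section \<open>Sofic groups over Noetherian and residually Noetherian rings\<close>

text \<open>Inversion identifies a group with its opposite, so each sofic approximation is
  precomposed with it.\<close>

lemma sofic_opposite:
  assumes G: "group G" and sof: "sofic G"
  shows "group (G\<lparr>monoid.mult := flip (monoid.mult G)\<rparr>)" "sofic (G\<lparr>monoid.mult := flip (monoid.mult G)\<rparr>)"
proof -
  interpret group G by (rule G)
  let ?G = "G\<lparr>monoid.mult := flip (monoid.mult G)\<rparr>"
  show "group ?G"
    by (rule groupI) (auto simp: m_assoc intro: r_inv)
  show "sofic ?G"
    unfolding sofic_def
  proof (intro allI impI)
    fix F and \<epsilon> :: real
    assume F: "finite F \<and> F \<subseteq> carrier ?G \<and> \<epsilon> > 0"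
    let ?F = "m_inv G ` F"
    have "finite ?F \<and> ?F \<subseteq> carrier G \<and> \<epsilon> > 0" using F by auto
    from sof[unfolded sofic_def, rule_format, OF this] obtain n \<sigma> where n: "n \<ge> 1"
      and \<sigma>: "\<sigma> \<in> carrier G \<rightarrow> carrier (sym_group n)"
      and hom: "\<forall>g\<in>?F. \<forall>h\<in>?F. (1 - \<epsilon>) * real n \<le>
        real (card {i \<in> {1..n}. (\<sigma> g \<otimes>\<^bsub>sym_group n\<^esub> \<sigma> h) i = \<sigma> (g \<otimes>\<^bsub>G\<^esub> h) i})"
      and fix_pts: "\<forall>g\<in>?F. g \<noteq> \<one>\<^bsub>G\<^esub> \<longrightarrow> real (card {i \<in> {1..n}. \<sigma> g i = i}) \<le> \<epsilon> * real n"
      by blast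
    let ?\<sigma> = "\<lambda>g. \<sigma> (inv\<^bsub>G\<^esub> g)"
    show "\<exists>n\<ge>1. \<exists>\<sigma>\<in>carrier ?G \<rightarrow> carrier (sym_group n).
        (\<forall>g\<in>F. \<forall>h\<in>F. (1 - \<epsilon>) * real n \<le>
          real (card {i \<in> {1..n}. (\<sigma> g \<otimes>\<^bsub>sym_group n\<^esub> \<sigma> h) i = \<sigma> (g \<otimes>\<^bsub>?G\<^esub> h) i})) \<and>
        (\<forall>g\<in>F. g \<noteq> \<one>\<^bsub>?G\<^esub> \<longrightarrow> real (card {i \<in> {1..n}. \<sigma> g i = i}) \<le> \<epsilon> * real n)"
    proof (intro exI[of _ n] conjI bexI[of _ ?\<sigma>] n ballI impI)
      show "?\<sigma> \<in> carrier ?G \<rightarrow> carrier (sym_group n)" using \<sigma> by auto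
      fix g assume g: "g \<in> F"
      then have gc: "g \<in> carrier G" using F by auto
      show "real (card {i \<in> {1..n}. ?\<sigma> g i = i}) \<le> \<epsilon> * real n" if "g \<noteq> \<one>\<^bsub>?G\<^esub>"
      proof -
        have "inv\<^bsub>G\<^esub> g \<noteq> \<one>\<^bsub>G\<^esub>" using that gc inv_eq_1_iff by simp
        then show ?thesis using fix_pts g by blast
      qed
      fix h assume h: "h \<in> F"
      then have hc: "h \<in> carrier G" using F by auto
      have "inv\<^bsub>G\<^esub> (g \<otimes>\<^bsub>?G\<^esub> h) = inv\<^bsub>G\<^esub> g \<otimes>\<^bsub>G\<^esub> inv\<^bsub>G\<^esub> h"
        using gc hc by (simp add: inv_mult_group)
      then show "(1 - \<epsilon>) * real n \<le>
          real (card {i \<in> {1..n}. (?\<sigma> g \<otimes>\<^bsub>sym_group n\<^esub> ?\<sigma> h) i = ?\<sigma> (g \<otimes>\<^bsub>?G\<^esub> h) i})"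
        using hom g h by simp
    qed
  qed
qed

text \<open>\<open>sofic_sfin_mod\<close> uses chains of left ideals. The right-handed condition is
  that condition for the opposite ring, and \<open>sfin_mod_flip\<close> transports the conclusion
  back.\<close>

lemma (in ring_cover) sofic_sfin_mod_noetherian:
  assumes G: "group G" and sof: "sofic G" and noeth: "right_noetherian R \<or> left_noetherian R"
  shows "sfin_mod (*) ker (carrier G) (monoid.mult G)"
  using noeth
proof
  assume "left_noetherian R"
  then show ?thesis using sofic_sfin_mod[OF G sof] left_noetherian_acc by blast
next
  assume R: "right_noetherian R"
  interpret U: unital_mod "flip (*)" ker 1 by (rule unital_mod_flip)
  let ?G = "G\<lparr>monoid.mult := flip (monoid.mult G)\<rparr>"
  have "sfin_mod (flip (*)) ker (carrier ?G) (monoid.mult ?G)"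
    by (rule U.sofic_sfin_mod[OF sofic_opposite[OF G sof] right_noetherian_acc[OF R]])
  then have "sfin_mod (flip (*)) ker (carrier G) (flip (monoid.mult G))" by simp
  moreover have "semigroup_on (carrier G) (flip (monoid.mult G))"
    by (rule semigroup_on_flip[OF group.semigroup_on_carrier[OF G]])
  ultimately show ?thesis
    using sfin_mod_flip[OF U.mult_mod_axioms] by blast
qed

text \<open>An ideal avoiding just one nonzero coefficient of the defect would keep the defect
  nonzero over a Noetherian quotient.\<close>

lemma (in ring_cover) sfin_mod_residually_noetherian:
  fixes G :: "('g, 'm) monoid_scheme"
  assumes G: "group G" and sof: "sofic G" and res: "residually_noetherian R"
  shows "sfin_mod (*) ker (carrier G) (monoid.mult G)"
  unfolding sfin_mod_def
proof (intro allI impI)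
  let ?C = "carrier G" and ?m = "monoid.mult G"
  note sg = group.semigroup_on_carrier[OF G]
  interpret M: mult_mod "mat_conv (*) ?C ?m" "coeffs_in ker"
    by (rule mult_mod_mat_conv[OF mult_mod_axioms sg])
  fix n and e u v :: "nat \<times> 'g \<times> nat \<Rightarrow>\<^sub>0 'f"
  assume k: "keys e \<subseteq> triples n ?C" "keys u \<subseteq> triples n ?C" "keys v \<subseteq> triples n ?C"
    and cp: "M.corner_pair e u v"
  show "mat_conv (*) ?C ?m v u - e \<in> coeffs_in ker"
  proof (rule ccontr)
    assume "mat_conv (*) ?C ?m v u - e \<notin> coeffs_in ker"
    then obtain p where p: "lookup (mat_conv (*) ?C ?m v u - e) p \<notin> ker" unfolding coeffs_in_def by blast
    define c where "c = lookup (mat_conv (*) ?C ?m v u - e) p"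
    have "ev c \<noteq> \<zero>" using p by (simp add: ker_def c_def)
    then obtain J where J: "ideal J R" "ev c \<notin> J" "right_noetherian (R Quot J) \<or> left_noetherian (R Quot J)"
      using res unfolding residually_noetherian_def by (metis ev_closed)
    interpret J: ideal J R by (rule J(1))
    interpret Q: ring_cover "R Quot J" "\<lambda>x. J +> ev x" by (rule ring_cover_Quot[OF J(1)])
    interpret N: mult_mod "mat_conv (*) ?C ?m" "coeffs_in Q.ker"
      by (rule mult_mod_mat_conv[OF Q.mult_mod_axioms sg])
    have "coeffs_in ker \<subseteq> (coeffs_in Q.ker :: (nat \<times> 'g \<times> nat \<Rightarrow>\<^sub>0 'f) set)"
      using J.zero_closed by (auto simp: coeffs_in_def ker_Quot[OF J(1)] ker_def)
    then have "N.corner_pair e u v"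
      using cp by (auto simp: N.corner_pair_def M.corner_pair_def N.cong_mod_def M.cong_mod_def)
    then have "mat_conv (*) ?C ?m v u - e \<in> coeffs_in Q.ker"
      by (rule sfin_modD[OF Q.sofic_sfin_mod_noetherian[OF G sof J(3)] k])
    then have "c \<in> Q.ker" unfolding c_def coeffs_in_def by blast
    then show False using J(2) by (simp add: ker_Quot[OF J(1)])
  qed
qed

text \<open>The subring \<open>K\<close> has its own word cover on the same type class ring, but
  letters outside \<open>K\<close> evaluate to zero there, so the two evaluations differ. The given
  matrices are therefore replaced by congruent ones with coefficients in \<open>B\<close>, where
  both evaluations agree.\<close>

theorem (in ring) sfin_mod_locally_residually_noetherian:
  fixes G :: "('g, 'm) monoid_scheme"
  assumes G: "group G" and sof: "sofic G" and res: "locally_residually_noetherian R"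
  shows "sfin_mod (*) (ring_cover.ker R (zeval word_eval)) (carrier G) (monoid.mult G)"
  unfolding sfin_mod_def
proof (intro allI impI)
  let ?C = "carrier G" and ?m = "monoid.mult G"
  note sg = group.semigroup_on_carrier[OF G]
  define ev where "ev = zeval word_eval"
  interpret cov: ring_cover R ev unfolding ev_def by (rule word_cover)
  define cv :: "(nat \<times> 'g \<times> nat \<Rightarrow>\<^sub>0 ('a word \<Rightarrow>\<^sub>0 int)) \<Rightarrow> _" where "cv = mat_conv (*) ?C ?m"
  interpret M: mult_mod cv "coeffs_in cov.ker"
    unfolding cv_def by (rule mult_mod_mat_conv[OF cov.mult_mod_axioms sg])
  fix n and e u v :: "nat \<times> 'g \<times> nat \<Rightarrow>\<^sub>0 ('a word \<Rightarrow>\<^sub>0 int)"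
  assume k: "keys e \<subseteq> triples n ?C" "keys u \<subseteq> triples n ?C" "keys v \<subseteq> triples n ?C"
    and cp: "mult_mod.corner_pair (mat_conv (*) ?C ?m) (coeffs_in (ring_cover.ker R (zeval word_eval))) e u v"
  note cp = cp[folded cv_def ev_def]
  define F where "F = ev ` (lookup e ` keys e \<union> lookup u ` keys u \<union> lookup v ` keys v)"
  have "finite F \<and> F \<subseteq> carrier R" by (auto simp: F_def)
  from res[unfolded locally_residually_noetherian_def, rule_format, OF this]
  obtain K where K: "subring K R" "generate_ring R F \<subseteq> K" "residually_noetherian (R\<lparr>carrier := K\<rparr>)"
    by blast
  have FK: "F \<subseteq> K"
  proof
    fix h assume "h \<in> F"
    then have "h \<in> generate_ring R F" by (rule generate_ring.incl)
    with K(2) show "h \<in> K" by (rule subsetD)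
  qed
  let ?R = "R\<lparr>carrier := K\<rparr>"
  have KR: "K \<subseteq> carrier R" using subringE(1)[OF K(1)] .
  interpret RK: ring ?R by (rule subring_is_ring[OF K(1)])
  define evK where "evK = RK.zeval RK.word_eval"
  interpret covK: ring_cover ?R evK unfolding evK_def by (rule RK.word_cover)
  have evK_R: "evK x \<in> carrier R" for x using covK.ev_closed[of x] KR by auto
  define B where "B = {x. evK x = ev x}"
  have B_zero: "0 \<in> B" using cov.ev_0 covK.ev_0 by (simp add: B_def)
  have B_add: "x + y \<in> B" if "x \<in> B" "y \<in> B" for x y
    using that cov.ev_add[of x y] covK.ev_add[of x y] by (simp add: B_def)
  have B_mult: "x * y \<in> B" if "x \<in> B" "y \<in> B" for x y
    using that cov.ev_mult[of x y] covK.ev_mult[of x y] by (simp add: B_def)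
  have B_diff: "x - y \<in> B" if "x \<in> B" "y \<in> B" for x y
  proof -
    have "ev (x - y) \<oplus> ev y = evK (x - y) \<oplus> ev y"
      using that cov.ev_add[of "x - y" y] covK.ev_add[of "x - y" y] by (simp add: B_def)
    then have "ev (x - y) = evK (x - y)" using add.right_cancel evK_R by simp
    then show ?thesis by (simp add: B_def)
  qed
  have B_ker: "x \<in> covK.ker \<longleftrightarrow> x \<in> cov.ker" if "x \<in> B" for x
    using that by (simp add: B_def covK.ker_def cov.ker_def)
  have coeffs_ker: "f \<in> coeffs_in covK.ker \<longleftrightarrow> f \<in> coeffs_in cov.ker" if "f \<in> coeffs_in B"
    for f :: "nat \<times> 'g \<times> nat \<Rightarrow>\<^sub>0 ('a word \<Rightarrow>\<^sub>0 int)"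
    using that B_ker unfolding coeffs_in_def by blast
  \<comment> \<open>A coefficient is replaced by the one-letter word of its value, on which both
    covers agree if the value lies in \<open>K\<close>. Value zero goes to 0, so that
    \<open>nf 0 = 0\<close> and supports do not grow.\<close>
  define nf where "nf c = (if ev c = \<zero> then 0 else single (Word [ev c]) (1::int))" for c
  have nf: "ev (nf c) = ev c" "nf 0 = 0" for c
    using zeval_letter[of "ev c"] cov.ev_closed[of c] by (auto simp: nf_def simp flip: ev_def)
  have nf_B: "nf c \<in> B" if "ev c \<in> K" for c
    using that RK.zeval_letter[of "ev c"] nf(1)[of c] B_zero
    by (auto simp: B_def nf_def simp flip: evK_def split: if_splits)
  define \<Psi> where "\<Psi> f = Poly_Mapping.map nf f" for f :: "nat \<times> 'g \<times> nat \<Rightarrow>\<^sub>0 ('a word \<Rightarrow>\<^sub>0 int)"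
  have l: "lookup (\<Psi> f) p = nf (lookup f p)" for f p
    using nf(2) by (auto simp: \<Psi>_def Poly_Mapping.map.rep_eq when_def)
  have \<Psi>k: "keys (\<Psi> f) \<subseteq> triples n ?C" if "keys f \<subseteq> triples n ?C" for f
  proof
    fix q assume "q \<in> keys (\<Psi> f)"
    then have "lookup f q \<noteq> 0" using nf(2) by (auto simp: in_keys_iff l)
    then show "q \<in> triples n ?C" using that by (auto simp: in_keys_iff)
  qed
  have \<Psi>_cong: "M.cong_mod (\<Psi> f) f" for f
  proof -
    have "lookup (\<Psi> f) q - lookup f q \<in> cov.ker" for q
      using nf(1) by (simp add: l flip: cov.ev_eq_iff)
    then have "\<Psi> f - f \<in> coeffs_in cov.ker" unfolding coeffs_in_def mem_Collect_eq lookup_minus by blast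
    then show ?thesis unfolding M.cong_mod_def .
  qed
  have \<Psi>_B: "\<Psi> f \<in> coeffs_in B" if "ev ` lookup f ` keys f \<subseteq> F" for f
  proof -
    have "ev (lookup f p) \<in> K" for p
    proof (cases "p \<in> keys f")
      case True
      then show ?thesis using that FK by blast
    next
      case False
      then have "ev (lookup f p) = \<zero>" by (simp add: in_keys_iff)
      then show ?thesis using subringE(2)[OF K(1)] by simp
    qed
    then show ?thesis using nf_B l unfolding coeffs_in_def by auto
  qed
  have B_euv: "\<Psi> e \<in> coeffs_in B" "\<Psi> u \<in> coeffs_in B" "\<Psi> v \<in> coeffs_in B"
    by (rule \<Psi>_B, force simp: F_def)+
  have cvB: "cv f g \<in> coeffs_in B" if "f \<in> coeffs_in B" "g \<in> coeffs_in B" for f g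
    unfolding cv_def by (rule coeffs_in_conv_closed[OF _ _ _ that]) (use B_zero B_add B_mult in auto)
  have diffB: "f - g \<in> coeffs_in B" if "f \<in> coeffs_in B" "g \<in> coeffs_in B"
    for f g :: "nat \<times> 'g \<times> nat \<Rightarrow>\<^sub>0 ('a word \<Rightarrow>\<^sub>0 int)"
  proof -
    have "lookup f q - lookup g q \<in> B" for q
      by (rule B_diff) (use that in \<open>unfold coeffs_in_def, blast+\<close>)
    then show ?thesis unfolding coeffs_in_def mem_Collect_eq lookup_minus by blast
  qed
  interpret N: mult_mod cv "coeffs_in covK.ker"
    unfolding cv_def by (rule mult_mod_mat_conv[OF covK.mult_mod_axioms sg])
  have MN: "N.cong_mod (cv (\<Psi> f) (\<Psi> g)) (\<Psi> h)"
    if "M.cong_mod (cv f g) h" "\<Psi> f \<in> coeffs_in B" "\<Psi> g \<in> coeffs_in B" "\<Psi> h \<in> coeffs_in B" for f g h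
  proof -
    have "M.cong_mod (cv (\<Psi> f) (\<Psi> g)) (\<Psi> h)"
      using M.cong_trans[OF M.cong_trans[OF M.cong_mul[OF \<Psi>_cong \<Psi>_cong] that(1)] M.cong_sym[OF \<Psi>_cong]] .
    then show ?thesis
      unfolding M.cong_mod_def N.cong_mod_def using coeffs_ker[OF diffB[OF cvB[OF that(2,3)] that(4)]] by blast
  qed
  have "N.corner_pair (\<Psi> e) (\<Psi> u) (\<Psi> v)"
    unfolding N.corner_pair_def using M.corner_pairD[OF cp] B_euv by (intro conjI MN)
  then have "cv (\<Psi> v) (\<Psi> u) - \<Psi> e \<in> coeffs_in covK.ker"
    unfolding cv_def
    by (rule sfin_modD[OF covK.sfin_mod_residually_noetherian[OF G sof K(3)] \<Psi>k[OF k(1)] \<Psi>k[OF k(2)] \<Psi>k[OF k(3)]])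
  then have "M.cong_mod (cv (\<Psi> v) (\<Psi> u)) (\<Psi> e)"
    unfolding M.cong_mod_def using coeffs_ker[OF diffB[OF cvB[OF B_euv(3,2)] B_euv(1)]] by blast
  then have "M.cong_mod (cv v u) e"
    by (rule M.cong_trans[OF M.cong_trans[OF M.cong_sym[OF M.cong_mul[OF \<Psi>_cong \<Psi>_cong]]] \<Psi>_cong])
  then have "cv v u - e \<in> coeffs_in cov.ker" unfolding M.cong_mod_def .
  then show "mat_conv (*) ?C ?m v u - e \<in> coeffs_in (ring_cover.ker R (zeval word_eval))"
    unfolding cv_def ev_def .
qed

theorem (in domain) sfin_mod_char_zero:
  assumes G: "group G" and char0: "char_zero R"
  shows "sfin_mod (*) (ring_cover.ker R (zeval mset_eval)) (carrier G) (monoid.mult G)"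
proof -
  define ev where "ev = zeval mset_eval"
  interpret cov: ring_cover R ev unfolding ev_def by (rule mset_cover)
  have nat: "ev (of_nat n) = [n] \<cdot> \<one>" for n :: nat
    by (induction n) (simp_all add: cov.ev_add cov.ev_one a_comm)
  have "prime_ideal_on cov.ker"
  proof
    show "x \<in> cov.ker \<or> y \<in> cov.ker" if "x * y \<in> cov.ker" for x y
      using that integral[of "ev x" "ev y"] by (simp add: cov.ker_def cov.ev_mult)
  qed (auto simp: cov.ker_def cov.ev_diff cov.ev_mult cov.ev_one a_minus_def)
  moreover have "of_nat n \<notin> cov.ker" if "n > 0" for n
    using that char0 by (simp add: cov.ker_def nat char_zero_def)
  ultimately show ?thesis
    using group.sfin_mod_prime[OF G] unfolding ev_def by blast
qed


subsection \<open>Hilbert's basis theorem\<close>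

definition ideal_in :: "'f::comm_ring_1 set \<Rightarrow> 'f set \<Rightarrow> bool" where
  "ideal_in A L \<longleftrightarrow> L \<subseteq> A \<and> 0 \<in> L \<and> (\<forall>x\<in>L. \<forall>y\<in>L. x - y \<in> L) \<and> (\<forall>a\<in>A. \<forall>x\<in>L. a * x \<in> L)"

definition noetherian_on :: "'f::comm_ring_1 set \<Rightarrow> bool" where
  "noetherian_on A \<longleftrightarrow> (\<forall>L :: nat \<Rightarrow> 'f set. (\<forall>n. ideal_in A (L n) \<and> L n \<subseteq> L (Suc n)) \<longrightarrow>
     (\<exists>N. \<forall>n\<ge>N. L n = L N))"

lemma noetherian_onD:
  assumes "noetherian_on A" "\<And>n. ideal_in A (L n)" "\<And>n. L n \<subseteq> L (Suc n)"
  shows "\<exists>N. \<forall>n\<ge>N. L n = L N"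
  using assms unfolding noetherian_on_def by blast

lemma ideal_inD:
  assumes "ideal_in A L"
  shows "L \<subseteq> A" "0 \<in> L" "x \<in> L \<Longrightarrow> y \<in> L \<Longrightarrow> x - y \<in> L" "a \<in> A \<Longrightarrow> x \<in> L \<Longrightarrow> a * x \<in> L"
    "x \<in> L \<Longrightarrow> y \<in> L \<Longrightarrow> x + y \<in> L"
proof -
  show *: "L \<subseteq> A" "0 \<in> L" "x \<in> L \<Longrightarrow> y \<in> L \<Longrightarrow> x - y \<in> L" "a \<in> A \<Longrightarrow> x \<in> L \<Longrightarrow> a * x \<in> L" for x y a
    using assms by (auto simp: ideal_in_def)
  show "x \<in> L \<Longrightarrow> y \<in> L \<Longrightarrow> x + y \<in> L" using *(3)[of x "0 - y"] *(3)[of 0 y] *(2) by simp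
qed

text \<open>The least positive integer whose image occurs in some \<open>L n\<close> generates all
  ideals from that stage on, by division with remainder; if there is none, all ideals are
  zero.\<close>

lemma noetherian_on_of_int: "noetherian_on (range of_int :: 'f::comm_ring_1 set)"
  unfolding noetherian_on_def
proof (intro allI impI)
  fix L :: "nat \<Rightarrow> 'f set"
  assume L: "\<forall>n. ideal_in (range of_int) (L n) \<and> L n \<subseteq> L (Suc n)"
  note I = ideal_inD[OF L[rule_format, THEN conjunct1]]
  have mono: "L i \<subseteq> L j" if "i \<le> j" for i j
    by (rule lift_Suc_mono_le[of L, OF L[rule_format, THEN conjunct2] that])
  define S where "S d \<longleftrightarrow> d > 0 \<and> (\<exists>n. of_int (int d) \<in> L n)" for d
  show "\<exists>N. \<forall>n\<ge>N. L n = L N"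
  proof (cases "\<exists>d. S d")
    case False
    have "L n = {0}" for n
    proof -
      have "x = 0" if x: "x \<in> L n" for x
      proof -
        obtain k where k: "x = of_int k" using I(1)[of n] x by auto
        have "of_int (- k) \<in> L n" using I(3)[OF I(2) x] k by simp
        then have m: "of_int (int (nat \<bar>k\<bar>)) \<in> L n" using x k by (cases "k \<ge> 0") auto
        have "nat \<bar>k\<bar> = 0"
        proof (rule ccontr)
          assume "nat \<bar>k\<bar> \<noteq> 0"
          then have "nat \<bar>k\<bar> > 0" by simp
          then have "S (nat \<bar>k\<bar>)" unfolding S_def by (intro conjI exI[of _ n] m)
          then show False using False by blast
        qed
        then show ?thesis using k by simp
      qed
      then show ?thesis using I(2)[of n] by blast
    qed
    then show ?thesis by simp
  next
    case True
    define d where "d = (LEAST d. S d)"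
    have "S d" unfolding d_def using True by (rule LeastI_ex)
    then obtain N where d: "d > 0" "of_int (int d) \<in> L N" by (auto simp: S_def)
    have sub: "x \<in> L N" if x: "x \<in> L n" and n: "n \<ge> N" for x n
    proof -
      obtain k where k: "x = of_int k" using I(1)[of n] x by auto
      have "of_int (k div int d) * of_int (int d) \<in> L n"
        using I(4)[of "of_int (k div int d)" "of_int (int d)" n] d mono[OF n] by blast
      then have "of_int k - of_int (k div int d) * of_int (int d) \<in> L n"
        using I(3) x k by blast
      then have "of_int (k - k div int d * int d) \<in> L n" by (simp del: of_int_of_nat_eq)
      moreover have "k - k div int d * int d = k mod int d" by (simp add: minus_div_mult_eq_mod)
      ultimately have m: "of_int (int (nat (k mod int d))) \<in> L n" using d by (simp del: of_int_of_nat_eq)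
      have "nat (k mod int d) = 0"
      proof (rule ccontr)
        assume "nat (k mod int d) \<noteq> 0"
        then have "S (nat (k mod int d))" using m unfolding S_def by blast
        then have "d \<le> nat (k mod int d)" unfolding d_def by (rule Least_le)
        moreover have "k mod int d < int d" using d by simp
        ultimately show False using d by linarith
      qed
      then have "k mod int d = 0" using d by (metis nat_eq_iff2 nat_0_iff pos_mod_sign of_nat_0_less_iff order_antisym)
      then have "k = k div int d * int d" by (metis add.right_neutral div_mult_mod_eq)
      then have "x = of_int (k div int d) * of_int (int d)" using k by (metis of_int_mult)
      then show ?thesis using I(4)[of "of_int (k div int d)" "of_int (int d)" N] d by blast
    qed
    have "L n = L N" if "n \<ge> N" for n using sub[OF _ that] mono[OF that] by blast
    then show ?thesis by blast
  qed
qed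

text \<open>Hilbert's argument with leading coefficients. As \<open>x\<close> may be algebraic, an
  element has many representing polynomials, so the coefficient ideals \<open>LC\<close> are formed
  from all polynomials whose value lies in the given ideal.\<close>

lemma noetherian_on_adjoin:
  assumes A: "subring_on A" and noeth: "noetherian_on A"
  shows "noetherian_on (adjoin A x)"
  unfolding noetherian_on_def
proof (intro allI impI)
  fix L :: "nat \<Rightarrow> 'a set"
  assume L: "\<forall>n. ideal_in (adjoin A x) (L n) \<and> L n \<subseteq> L (Suc n)"
  note I = ideal_inD[OF L[rule_format, THEN conjunct1]]
  note PA = polys_over[OF A] and SA = subring_onD[OF A]
  have mono: "L i \<subseteq> L j" if "i \<le> j" for i j
    by (rule lift_Suc_mono_le[of L, OF L[rule_format, THEN conjunct2] that])
  have x: "x \<in> adjoin A x" by (rule adjoin_generator[OF A])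
  define LC where "LC n d = {coeff p d | p. p \<in> polys_over A \<and> degree p \<le> d \<and> poly p x \<in> L n}" for n d
  have ideal: "ideal_in A (LC n d)" for n d
    unfolding ideal_in_def
  proof (intro conjI ballI subsetI)
    show "0 \<in> LC n d" unfolding LC_def using PA(6) I(2) by (intro CollectI exI[of _ 0]) auto
    show "c \<in> A" if "c \<in> LC n d" for c using that by (auto simp: LC_def polys_over_def)
    fix c assume "c \<in> LC n d"
    then obtain p where p: "p \<in> polys_over A" "degree p \<le> d" "poly p x \<in> L n" "c = coeff p d"
      by (auto simp: LC_def)
    show "a * c \<in> LC n d" if a: "a \<in> A" for a
      unfolding LC_def using p PA(5)[OF a p(1)] I(4)[OF adjoin_base[OF A a] p(3)] degree_smult_le[of a p]
      by (intro CollectI exI[of _ "smult a p"]) auto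
    fix c' assume "c' \<in> LC n d"
    then obtain q where q: "q \<in> polys_over A" "degree q \<le> d" "poly q x \<in> L n" "c' = coeff q d"
      by (auto simp: LC_def)
    show "c - c' \<in> LC n d"
      unfolding LC_def using p q PA(1)[OF p(1) q(1)] I(3)[OF p(3) q(3)]
      by (intro CollectI exI[of _ "p - q"]) (auto intro: degree_diff_le)
  qed
  have mono_n: "LC i d \<subseteq> LC j d" if "i \<le> j" for i j d
    unfolding LC_def using mono[OF that] by blast
  have mono_d1: "LC n d \<subseteq> LC n (Suc d)" for n d
  proof
    fix c assume "c \<in> LC n d"
    then obtain p where p: "p \<in> polys_over A" "degree p \<le> d" "poly p x \<in> L n" "c = coeff p d"
      by (auto simp: LC_def)
    have "monom 1 1 * p \<in> polys_over A" by (intro PA SA p)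
    moreover have "degree (monom 1 1 * p) \<le> Suc d"
      using degree_mult_le[of "monom (1 :: 'a) 1" p] degree_monom_le[of "1 :: 'a" 1] p(2) by linarith
    moreover have "poly (monom 1 1 * p) x \<in> L n" using I(4)[OF x p(3)] by (simp add: poly_monom)
    moreover have "coeff (monom 1 1 * p) (Suc d) = c" using p(4) by (simp add: coeff_monom_mult)
    ultimately show "c \<in> LC n (Suc d)"
      unfolding LC_def by (intro CollectI exI[of _ "monom 1 1 * p"]) simp
  qed
  have mono_d: "LC n i \<subseteq> LC n j" if "i \<le> j" for n i j
    by (rule lift_Suc_mono_le[of "LC n", OF mono_d1 that])
  \<comment> \<open>The diagonal chain controls all degrees from \<open>N\<close> on at once; the
    finitely many smaller degrees are treated one by one, and \<open>M\<close> lies beyond all these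
    stages.\<close>
  have "\<exists>N. \<forall>n\<ge>N. LC n n = LC N N"
  proof (rule noetherian_onD[OF noeth ideal])
    show "LC n n \<subseteq> LC (Suc n) (Suc n)" for n
      using mono_n[of n "Suc n" n] mono_d1[of "Suc n" n] by auto
  qed
  then obtain N where N: "\<And>n. n \<ge> N \<Longrightarrow> LC n n = LC N N" by blast
  have "\<exists>M. \<forall>n\<ge>M. LC n d = LC M d" for d
    by (rule noetherian_onD[OF noeth ideal]) (rule mono_n, simp)
  then have "\<exists>Nd. \<forall>d. \<forall>n\<ge>Nd d. LC n d = LC (Nd d) d" by (intro choice allI)
  then obtain Nd where Nd: "\<And>d n. n \<ge> Nd d \<Longrightarrow> LC n d = LC (Nd d) d" by blast
  define M where "M = N + (\<Sum>d<N. Nd d)"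
  have MN: "M \<ge> N" "\<And>d. d < N \<Longrightarrow> M \<ge> Nd d"
    using member_le_sum[of _ "{..<N}" Nd] by (force simp: M_def)+
  have LC_sub: "LC n d \<subseteq> LC M d" if n: "n \<ge> M" for n d
  proof (cases "d < N")
    case True
    have "LC n d = LC (Nd d) d" by (rule Nd[OF order_trans[OF MN(2)[OF True] n]])
    also have "\<dots> = LC M d" by (rule Nd[OF MN(2)[OF True], symmetric])
    finally show ?thesis by simp
  next
    case False
    have "LC n d \<subseteq> LC (max n d) (max n d)"
      by (rule order_trans[OF mono_n mono_d]) simp_all
    also have "\<dots> = LC N N" by (rule N) (use False in simp)
    also have "\<dots> \<subseteq> LC M d" 
      by (rule order_trans[OF mono_n[OF MN(1)] mono_d]) (use False in simp)
    finally show ?thesis .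
  qed
  \<comment> \<open>Subtract a polynomial with value in \<open>L M\<close> and the same top
    coefficient. Either the difference is zero or its degree drops; constants fall under the
    former.\<close>
  have main: "poly p x \<in> L M" if "p \<in> polys_over A" "poly p x \<in> L n" "n \<ge> M" for p n
    using that
  proof (induction "degree p" arbitrary: p rule: less_induct)
    case less
    have "coeff p (degree p) \<in> LC n (degree p)"
      unfolding LC_def using less.prems by (intro CollectI exI[of _ p]) simp
    then have "coeff p (degree p) \<in> LC M (degree p)" using LC_sub[OF less.prems(3)] by blast
    then obtain q where q: "q \<in> polys_over A" "degree q \<le> degree p" "poly q x \<in> L M"
      "coeff p (degree p) = coeff q (degree p)"
      by (auto simp: LC_def)
    have pq: "p - q \<in> polys_over A" "poly (p - q) x \<in> L n"
      using PA(1)[OF less.prems(1) q(1)] I(3)[OF less.prems(2)] mono[OF less.prems(3)] q(3) by auto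
    have "poly (p - q) x \<in> L M"
    proof (cases "p - q = 0")
      case True
      then show ?thesis using I(2) by simp
    next
      case False
      have "degree (p - q) \<noteq> degree p"
      proof
        assume e: "degree (p - q) = degree p"
        have "lead_coeff (p - q) = 0" unfolding e using q(4) by simp
        then show False using False leading_coeff_0_iff by blast
      qed
      moreover have "degree (p - q) \<le> degree p" by (rule degree_diff_le[OF order_refl q(2)])
      ultimately show ?thesis using less.hyps[of "p - q"] pq less.prems(3) by simp
    qed
    then show ?case using I(5)[OF _ q(3)] by fastforce
  qed
  have "L n = L M" if "n \<ge> M" for n
  proof
    show "L M \<subseteq> L n" by (rule mono[OF that])
    show "L n \<subseteq> L M"
    proof
      fix y assume y: "y \<in> L n"
      then obtain p where "p \<in> polys_over A" "y = poly p x" using I(1)[of n] by (auto simp: adjoin_def)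
      then show "y \<in> L M" using main y that by blast
    qed
  qed
  then show "\<exists>N. \<forall>n\<ge>N. L n = L N" by blast
qed

theorem noetherian_on_gen_subring: "noetherian_on (gen_subring xs)"
  by (induction xs) (simp_all add: noetherian_on_of_int noetherian_on_adjoin subring_on_gen_subring)

text \<open>A finitely generated commutative ring is Noetherian by the basis theorem, so the zero
  ideal serves for every nonzero element; this is why the quotient by the zero ideal
  appears.\<close>

theorem (in cring) locally_residually_noetherian: "locally_residually_noetherian R"
  unfolding locally_residually_noetherian_def
proof (intro allI impI)
  fix F assume F: "finite F \<and> F \<subseteq> carrier R"
  define ev where "ev = zeval mset_eval"
  interpret cov: ring_cover R ev unfolding ev_def by (rule mset_cover)
  from F obtain fs where fs: "set fs = F" using finite_list by blast
  define xs where "xs = map cov.sect fs"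
  define A where "A = gen_subring xs"
  have A: "subring_on A" unfolding A_def by (rule subring_on_gen_subring)
  note SA = subring_onD[OF A]
  define K where "K = ev ` A"
  have K: "subring K R"
  proof (rule subringI)
    show "K \<subseteq> carrier R" by (auto simp: K_def)
    show "\<one> \<in> K" unfolding K_def using cov.ev_one SA(1) by (metis imageI)
    fix a b assume "a \<in> K" "b \<in> K"
    then obtain x y where xy: "x \<in> A" "y \<in> A" "a = ev x" "b = ev y" by (auto simp: K_def)
    show "\<ominus> a \<in> K" unfolding K_def using SA(3)[OF SA(2) xy(1)] xy(3) cov.ev_uminus[of x]
      by (metis diff_0 imageI)
    show "a \<oplus> b \<in> K" "a \<otimes> b \<in> K"
      unfolding K_def using SA(4,5)[OF xy(1,2)] xy(3,4) cov.ev_add cov.ev_mult by (metis imageI)+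
  qed
  have "F \<subseteq> K"
  proof
    fix r assume r: "r \<in> F"
    then have "cov.sect r \<in> A" using gen_subring_generators[of xs] by (auto simp: A_def xs_def fs)
    moreover have "ev (cov.sect r) = r" using r F cov.ev_sect by blast
    ultimately show "r \<in> K" unfolding K_def by (metis imageI)
  qed
  then have gen: "generate_ring R F \<subseteq> K" using F K by (intro generate_ring_min_subring1) auto
  let ?R = "R\<lparr>carrier := K\<rparr>"
  interpret RK: ring ?R by (rule subring_is_ring[OF K])
  have ideal0: "ideal {\<zero>} ?R" using RK.zeroideal by simp
  interpret J: ideal "{\<zero>}" ?R by (rule ideal0)
  let ?Q = "?R Quot {\<zero>}"
  interpret Q: ring ?Q by (rule J.quotient_is_ring)
  define \<pi> where "\<pi> x = {\<zero>} +>\<^bsub>?R\<^esub> ev x" for x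
  have hom: "(+>\<^bsub>?R\<^esub>) {\<zero>} \<in> ring_hom ?R ?Q" by (rule J.rcos_ring_hom)
  have evK: "ev x \<in> carrier ?R" if "x \<in> A" for x using that by (simp add: K_def)
  have \<pi>: "\<pi> x \<in> carrier ?Q" "\<pi> (x + y) = \<pi> x \<oplus>\<^bsub>?Q\<^esub> \<pi> y" "\<pi> (x * y) = \<pi> x \<otimes>\<^bsub>?Q\<^esub> \<pi> y"
    if "x \<in> A" "y \<in> A" for x y
    using hom evK[OF that(1)] evK[OF that(2)]
    by (auto simp: \<pi>_def ring_hom_def cov.ev_add cov.ev_mult Pi_iff)
  have \<pi>_surj: "\<exists>x\<in>A. \<pi> x = r" if "r \<in> carrier ?Q" for r
    using that unfolding FactRing_def A_RCOSETS_def' by (auto simp: \<pi>_def K_def)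
  have "left_noetherian ?Q"
    unfolding left_noetherian_def
  proof (intro allI impI)
    fix J :: "nat \<Rightarrow> 'a set set"
    assume J: "(\<forall>n. left_ideal (J n) ?Q) \<and> (\<forall>n. J n \<subseteq> J (Suc n))"
    \<comment> \<open>The chain is pulled back along \<open>\<pi>\<close> to ideals of the type
      class subring \<open>A\<close>, where the basis theorem applies; surjectivity of
      \<open>\<pi>\<close> recovers the chain from them.\<close>
    define L where "L n = {x \<in> A. \<pi> x \<in> J n}" for n
    have "ideal_in A (L n)" for n
    proof -
      have as: "additive_subgroup (J n) ?Q" and
        mult: "\<And>a r. a \<in> J n \<Longrightarrow> r \<in> carrier ?Q \<Longrightarrow> r \<otimes>\<^bsub>?Q\<^esub> a \<in> J n"
        using J by (auto simp: left_ideal_def)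
      interpret as: additive_subgroup "J n" ?Q by (rule as)
      have zero: "\<pi> 0 = \<zero>\<^bsub>?Q\<^esub>"
        using \<pi>(2)[OF SA(2,2)] \<pi>(1)[OF SA(2,2)] Q.add.r_cancel_one by simp
      have minus: "\<pi> (x - y) = \<pi> x \<ominus>\<^bsub>?Q\<^esub> \<pi> y" if "x \<in> A" "y \<in> A" for x y
      proof -
        have xy: "x - y \<in> A" using SA(3) that by blast
        have "\<pi> x = \<pi> (x - y) \<oplus>\<^bsub>?Q\<^esub> \<pi> y" using \<pi>(2)[OF xy that(2)] by simp
        then show ?thesis
          using \<pi>(1)[OF xy xy] \<pi>(1)[OF that(2,2)] by (simp add: a_minus_def Q.a_assoc Q.r_neg)
      qed
      have "x - y \<in> L n" if "x \<in> L n" "y \<in> L n" for x y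
        using that SA(3) minus as.a_inv_closed as.a_closed by (auto simp: L_def a_minus_def)
      moreover have "a * x \<in> L n" if "a \<in> A" "x \<in> L n" for a x
        using that SA(4) \<pi>(3) mult \<pi>(1) by (auto simp: L_def)
      moreover have "0 \<in> L n" using SA(2) zero as.zero_closed by (simp add: L_def)
      ultimately show ?thesis by (auto simp: ideal_in_def L_def)
    qed
    moreover have "L n \<subseteq> L (Suc n)" for n using J by (auto simp: L_def)
    ultimately obtain N where N: "\<And>n. n \<ge> N \<Longrightarrow> L n = L N"
      using noetherian_onD[OF noetherian_on_gen_subring, of xs L] by (auto simp: A_def)
    have "J n = \<pi> ` L n" for n
    proof -
      have "J n \<subseteq> carrier ?Q" using J by (auto simp: left_ideal_def dest: additive_subgroup.a_subset)
      then show ?thesis using \<pi>_surj by (force simp: L_def)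
    qed
    then show "\<exists>N. \<forall>n\<ge>N. J n = J N" using N by metis
  qed
  then have "residually_noetherian ?R"
    unfolding residually_noetherian_def using ideal0 by auto
  then show "\<exists>K. subring K R \<and> generate_ring R F \<subseteq> K \<and> residually_noetherian (R\<lparr>carrier := K\<rparr>)"
    using K gen by blast
qed

theorem theorem7p13:
  fixes R :: "('r, 'k) ring_scheme" and S :: "('s, 'm) monoid_scheme"
  assumes "ring R"
    and "semigroup_struct S"
    and "stable_semigroup S"
    and "\<And>J. J \<in> regular_J_classes S \<Longrightarrow>
           finite {L \<in> carrier S // green_L S. L \<subseteq> J} \<or>
           finite {K \<in> carrier S // green_R S. K \<subseteq> J}"
  shows "(stably_finite (semigroup_ring R S) \<longleftrightarrow>
            (\<forall>G \<in> maximal_subgroups S. stably_finite (semigroup_ring R G))) \<and>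
         ((domain R \<and> char_zero R) \<or>
            (locally_residually_noetherian R \<and> (\<forall>G \<in> maximal_subgroups S. sofic G))
            \<longrightarrow> stably_finite (semigroup_ring R S)) \<and>
         (cring R \<longrightarrow> locally_residually_noetherian R)"
proof (intro conjI impI)
  show iff: "stably_finite (semigroup_ring R S) \<longleftrightarrow>
      (\<forall>G \<in> maximal_subgroups S. stably_finite (semigroup_ring R G))"
    by (rule ring.stably_finite_semigroup_ring_iff[OF assms])
  show "locally_residually_noetherian R" if "cring R"
    by (rule cring.locally_residually_noetherian[OF that])
  assume R: "(domain R \<and> char_zero R) \<or>
      (locally_residually_noetherian R \<and> (\<forall>G \<in> maximal_subgroups S. sofic G))"
  have "stably_finite (semigroup_ring R G)" if "G \<in> maximal_subgroups S" for G
  proof -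
    have G: "group G"
      using assms(2) that by (auto elim: semigroup_record.maximal_subgroups_cases simp flip: semigroup_record_iff)
    then have sg: "semigroup_struct G"
      using group.semigroup_on_carrier semigroup_on_iff by blast
    from R show ?thesis
    proof
      assume "domain R \<and> char_zero R"
      then have R: "domain R" "char_zero R" by simp_all
      \<comment> \<open>The commutative cover is used here and the word cover in the other case;
        \<open>stably_finite\<close> does not depend on the choice.\<close>
      then have "ring_cover R (ring.zeval R (cring.mset_eval R))"
        by (intro cring.mset_cover domain.axioms)
      then show ?thesis
        using domain.sfin_mod_char_zero[OF R(1) G R(2)] ring_cover.stably_finite_iff_sfin_mod[OF _ sg]
        by blast
    next
      assume "locally_residually_noetherian R \<and> (\<forall>G \<in> maximal_subgroups S. sofic G)"
      then show ?thesis
        using ring.sfin_mod_locally_residually_noetherian[OF assms(1) G]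
          ring_cover.stably_finite_iff_sfin_mod[OF ring.word_cover[OF assms(1)] sg] that
        by blast
    qed
  qed
  then show "stably_finite (semigroup_ring R S)" using iff by blast
qed

end
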